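(* (1) For all open subsets $\Omega,\Omega'$ of $\mathbb{R}^n$ such that $\overline{\Omega'}$ is a compact subset of $\Omega$, there exists $v\in\mathcal{G}(\Omega'\times\Omega)$ such that the union $\bigcup_{x\in\Omega'}\mathrm{supp}\,v(x,\cdot)\subseteq\Omega$ is compact, and such that for all $u\in\mathcal{G}^\infty(\Omega)$ $$u|_{\Omega'}(x)=\int_\Omega v(x,y)u(y)\,dy\qquad\text{in }\mathcal{G}(\Omega').$$ (2) Moreover, for every open subset $\Omega$ of $\mathbb{R}^n$ there exists $v\in\mathcal{G}(\Omega\times\Omega)$ such that for all $u\in\mathcal{G}_c^\infty(\Omega)$ $$u(x)=\int_\Omega v(x,y)u(y)\,dy\qquad\text{in }\mathcal{G}(\Omega).$$
   Context: All nets are indexed by $\varepsilon\in(0,1]$ and $O$-estimates are for $\varepsilon\to0$. For $W\subseteq\mathbb{R}^d$ open, $\mathcal{G}(W)=\mathcal{E}_M(W)/\mathcal{N}(W)$ is the Colombeau algebra on $W$, where $\mathcal{E}_M(W)$ is the set of nets $(u_\varepsilon)_\varepsilon\in C^\infty(W)^{(0,1]}$ such that for all compact $K\subset W$ and $\alpha\in\mathbb{N}^d$ there is $N\in\mathbb{N}$ with $\sup_{x\in K}|\partial^\alpha u_\varepsilon(x)|=O(\varepsilon^{-N})$, and $\mathcal{N}(W)$ is the set of nets in $C^\infty(W)^{(0,1]}$ such that for all compact $K\subset W$, all $\alpha\in\mathbb{N}^d$ and all $q\in\mathbb{N}$, $\sup_{x\in K}|\partial^\alpha u_\varepsilon(x)|=O(\varepsilon^{q})$.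 The support $\mathrm{supp}\,u$ of $u\in\mathcal{G}(W)$ is the complement in $W$ of the largest open set on which $u$ restricts to $0$. $\mathcal{G}^\infty(W)=\mathcal{E}_M^\infty(W)/\mathcal{N}(W)$ is the algebra of regular generalized functions, where $\mathcal{E}_M^\infty(W)$ is the set of nets in $C^\infty(W)^{(0,1]}$ such that for all compact $K\subset W$ there is $N\in\mathbb{N}$ such that for all $\alpha\in\mathbb{N}^d$, $\sup_{x\in K}|\partial^\alpha u_\varepsilon(x)|=O(\varepsilon^{-N})$. $\mathcal{G}_c^\infty(W)$ is the set of elements of $\mathcal{G}^\infty(W)$ with compact support. For $v=[(v_\varepsilon)_\varepsilon]\in\mathcal{G}(\Omega'\times\Omega)$ and $x\in\Omega'$, $v(x,\cdot):=[(v_\varepsilon(x,\cdot))_\varepsilon]\in\mathcal{G}(\Omega)$. In (1), $\int_\Omega v(x,y)u(y)\,dy$ denotes the element of $\mathcal{G}(\Omega')$ with representative $x\mapsto\int_{K}v_\varepsilon(x,y)u_\varepsilon(y)\,dy$, where $K\subset\Omega$ is any compact set containing $\bigcup_{x\in\Omega'}\mathrm{supp}\,v(x,\cdot)$ in its interior. In (2), $\int_\Omega v(x,y)u(y)\,dy$ denotes the element of $\mathcal{G}(\Omega)$ with representative $x\mapsto\int_{K}v_\varepsilon(x,y)u_\varepsilon(y)\,dy$, where $K\subset\Omega$ is any compact set containing $\mathrm{supp}\,u$ in its interior. *)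

theory Defs
  imports "HOL-Analysis.Analysis" "HOL-Library.Landau_Symbols"
begin

text \<open>
  Functions are total; only their values on the open set \<open>W\<close> under consideration matter, and
  of a net \<open>u\<close> only the members \<open>u \<epsilon>\<close> with \<open>0 < \<epsilon> \<le> 1\<close> matter.  The scalar field is kept
  abstract: the class constraint \<open>{real_normed_field, euclidean_space}\<close> on the value type
  comprises the real and the complex numbers.
\<close>

definition partial :: "'a::euclidean_space \<Rightarrow> ('a \<Rightarrow> 'k::real_normed_vector) \<Rightarrow> 'a \<Rightarrow> 'k"
  where "partial b f = (\<lambda>x. frechet_derivative f (at x) b)"

primrec C_k_on :: "nat \<Rightarrow> ('a::euclidean_space \<Rightarrow> 'k::real_normed_vector) \<Rightarrow> 'a set \<Rightarrow> bool"
  where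
    "C_k_on 0 f W \<longleftrightarrow> continuous_on W f"
  | "C_k_on (Suc k) f W \<longleftrightarrow> f differentiable_on W \<and> (\<forall>b\<in>Basis. C_k_on k (partial b f) W)"

definition smooth_on :: "('a::euclidean_space \<Rightarrow> 'k::real_normed_vector) \<Rightarrow> 'a set \<Rightarrow> bool"
  where "smooth_on f W \<longleftrightarrow> (\<forall>k. C_k_on k f W)"

text \<open>
  A multi-index is a function \<open>\<alpha>\<close> giving the order of differentiation \<open>\<alpha> b\<close> in each coordinate
  direction \<open>b \<in> Basis\<close> (its other values are irrelevant).  The chosen enumeration of the basis
  only fixes the order of the partial derivatives, which is immaterial for smooth functions.
\<close>

definition basis_enum :: "'a::euclidean_space list"
  where "basis_enum = (SOME bs. distinct bs \<and> set bs = Basis)"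

definition multi_deriv ::
    "('a::euclidean_space \<Rightarrow> nat) \<Rightarrow> ('a \<Rightarrow> 'k::real_normed_vector) \<Rightarrow> 'a \<Rightarrow> 'k"
  where "multi_deriv \<alpha> f = foldr (\<lambda>b. partial b ^^ \<alpha> b) basis_enum f"

type_synonym ('a, 'k) net = "real \<Rightarrow> 'a \<Rightarrow> 'k"

definition smooth_nets :: "'a::euclidean_space set \<Rightarrow> ('a, 'k::real_normed_vector) net set"
  where "smooth_nets W = {u. \<forall>\<epsilon>\<in>{0<..1}. smooth_on (u \<epsilon>) W}"

definition deriv_sup ::
    "'a::euclidean_space set \<Rightarrow> ('a \<Rightarrow> nat) \<Rightarrow> ('a, 'k::real_normed_vector) net \<Rightarrow> real \<Rightarrow> real"
  where "deriv_sup K \<alpha> u = (\<lambda>\<epsilon>. SUP x\<in>K. norm (multi_deriv \<alpha> (u \<epsilon>) x))"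

text \<open>
  The compact sets are required to be nonempty below because the supremum of the empty set of
  reals is unspecified in HOL; for the empty set the estimates are void.
\<close>

definition moderate_nets :: "'a::euclidean_space set \<Rightarrow> ('a, 'k::real_normed_vector) net set"
  where "moderate_nets W = {u \<in> smooth_nets W.
    \<forall>K \<alpha>. compact K \<and> K \<noteq> {} \<and> K \<subseteq> W \<longrightarrow>
      (\<exists>N::nat. deriv_sup K \<alpha> u \<in> O[at_right 0](\<lambda>\<epsilon>. \<epsilon> powr (- real N)))}"

definition regular_nets :: "'a::euclidean_space set \<Rightarrow> ('a, 'k::real_normed_vector) net set"
  where "regular_nets W = {u \<in> smooth_nets W.
    \<forall>K. compact K \<and> K \<noteq> {} \<and> K \<subseteq> W \<longrightarrow>
      (\<exists>N::nat. \<forall>\<alpha>. deriv_sup K \<alpha> u \<in> O[at_right 0](\<lambda>\<epsilon>. \<epsilon> powr (- real N)))}"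

definition negligible_nets :: "'a::euclidean_space set \<Rightarrow> ('a, 'k::real_normed_vector) net set"
  where "negligible_nets W = {u \<in> smooth_nets W.
    \<forall>K \<alpha>. compact K \<and> K \<noteq> {} \<and> K \<subseteq> W \<longrightarrow>
      (\<forall>q::nat. deriv_sup K \<alpha> u \<in> O[at_right 0](\<lambda>\<epsilon>. \<epsilon> ^ q))}"

definition net_rel ::
    "'a::euclidean_space set \<Rightarrow> (('a, 'k::real_normed_vector) net \<times> ('a, 'k) net) set"
  where "net_rel W = {(u, v). u \<in> moderate_nets W \<and> v \<in> moderate_nets W \<and>
    (\<lambda>\<epsilon> x. u \<epsilon> x - v \<epsilon> x) \<in> negligible_nets W}"

text \<open>A generalized function is a class of \<open>net_rel W\<close>, i.e. the set of its representatives.\<close>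

type_synonym ('a, 'k) gen_fun = "('a, 'k) net set"

definition colombeau :: "'a::euclidean_space set \<Rightarrow> ('a, 'k::real_normed_vector) gen_fun set"
  where "colombeau W = moderate_nets W // net_rel W"

text \<open>
  Negligible nets are regular, so a class of \<open>net_rel W\<close> that contains a regular net
  consists of regular nets only.
\<close>

definition colombeau_regular ::
    "'a::euclidean_space set \<Rightarrow> ('a, 'k::real_normed_vector) gen_fun set"
  where "colombeau_regular W = regular_nets W // net_rel W"

text \<open>
  The operations below are defined by applying an operation to all representatives and
  collecting the nets equivalent to one of the results; whenever the operation is well defined
  on classes, this set is the class of the result for an arbitrary choice of representatives.
\<close>

definition gen_restrict ::
    "'a::euclidean_space set \<Rightarrow> ('a, 'k::real_normed_vector) gen_fun \<Rightarrow> ('a, 'k) gen_fun"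
  where "gen_restrict V u = net_rel V `` u"

definition gen_zero :: "'a::euclidean_space set \<Rightarrow> ('a, 'k::real_normed_vector) gen_fun"
  where "gen_zero V = net_rel V `` {\<lambda>\<epsilon> x. 0}"

definition gen_supp ::
    "'a::euclidean_space set \<Rightarrow> ('a, 'k::real_normed_vector) gen_fun \<Rightarrow> 'a set"
  where "gen_supp W u = W - \<Union>{V. open V \<and> V \<subseteq> W \<and> gen_restrict V u = gen_zero V}"

definition colombeau_regular_c ::
    "'a::euclidean_space set \<Rightarrow> ('a, 'k::real_normed_vector) gen_fun set"
  where "colombeau_regular_c W = {u \<in> colombeau_regular W. compact (gen_supp W u)}"

text \<open>\<open>gen_slice W v x\<close> is the generalized function \<open>v(x, \<cdot>)\<close> on \<open>W\<close>.\<close>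

definition gen_slice ::
    "'b::euclidean_space set \<Rightarrow> ('a::euclidean_space \<times> 'b, 'k::real_normed_vector) gen_fun \<Rightarrow>
     'a \<Rightarrow> ('b, 'k) gen_fun"
  where "gen_slice W v x = net_rel W `` ((\<lambda>w \<epsilon> y. w \<epsilon> (x, y)) ` v)"

text \<open>
  The generalized function on \<open>V\<close> with representative
  \<open>x \<mapsto> \<integral>\<^sub>K v\<^sub>\<epsilon>(x,y) u\<^sub>\<epsilon>(y) dy\<close>.
\<close>

definition gen_integral ::
    "'a::euclidean_space set \<Rightarrow> 'b::euclidean_space set \<Rightarrow>
     ('a \<times> 'b, 'k::{real_normed_field, euclidean_space}) gen_fun \<Rightarrow> ('b, 'k) gen_fun \<Rightarrow>
     ('a, 'k) gen_fun"
  where "gen_integral V K v u =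
    net_rel V `` {(\<lambda>\<epsilon> x. LINT y:K|lborel. w \<epsilon> (x, y) * r \<epsilon> y) | w r. w \<in> v \<and> r \<in> u}"

end

theory Submission
  imports Defs
begin

text \<open>
  The binomial identity \<open>1 - (1 - T)\<^sup>m = -\<Sum>\<^sub>j\<^sub>\<ge>\<^sub>1 (-1)\<^sup>j (m choose j) T\<^sup>j\<close> turns one compactly supported
  mollifier \<open>\<phi>\<close> into an approximate identity of order \<open>m\<close>: the average of \<open>u(x + j \<epsilon> z)\<close> against
  \<open>\<phi>(z) dz\<close>, summed over \<open>1 \<le> j \<le> m\<close> with weights \<open>-(-1)\<^sup>j (m choose j)\<close>, differs from \<open>u(x)\<close> by the
  average of an \<open>m\<close>-th finite difference of \<open>u\<close> with step \<open>\<epsilon> z\<close>.  That difference is at most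
  \<open>2\<^sup>m \<epsilon>\<^sup>q\<close> times the derivatives of \<open>u\<close> of order \<open>q\<close>, for every \<open>q \<le> m\<close>.  Let \<open>m = m(\<epsilon>)\<close> tend to
  infinity so slowly that \<open>4\<^sup>m \<le> 1 / \<epsilon>\<close>.  Then the kernel is moderate, its support shrinks to the
  diagonal, and since all derivatives of a regular net have the same growth rate, the error is
  \<open>O(\<epsilon>\<^sup>q)\<close> for every \<open>q\<close>.

  For each fixed \<open>x\<close> this kernel is supported in \<open>{x}\<close>, so in part (1) the union of the supports
  would be the open set \<open>\<Omega>'\<close>, which is not compact.  One therefore adds a kernel, independent of
  \<open>x\<close>, that annihilates all regular functions and has support \<open>closure \<Omega>'\<close>: the \<open>m\<close>-th finite
  difference with step \<open>\<epsilon>\<close> of a bump of width \<open>\<epsilon>\<^sup>2\<close>, centred at a point \<open>p(\<epsilon>)\<close> that visits every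
  point of a countable dense subset of \<open>\<Omega>'\<close> for arbitrarily small \<open>\<epsilon>\<close>.
\<close>

section \<open>Iterated directional derivatives\<close>

text \<open>A single mollifier whose moments of positive order all vanish would give errors of every
  order at once, but it cannot have compact support: its Fourier transform would be entire with the
  Taylor series of a constant. Compact support cannot be given up, since the integral only extends
  over K and nothing is known of u beyond W. A fixed order m yields no more than O(\<epsilon>^m),
  hence an order that grows. The derivatives of u of order m(\<epsilon>) are out of reach, however,
  because the constants in the estimates of u depend on the order of differentiation. So q stays
  fixed: q of the m differences become derivatives and the others cost a factor 2 each. This loses
  one power of \<epsilon>, the growth \<epsilon>^(-N) of u loses N more, and q = Q + N + 1 leaves
  \<epsilon>^Q. The choice is possible because N does not depend on q; this is where regularity
  enters.

  The annihilating kernel has to escape negligibility. Its bumps are narrower than the step between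
  them, so at p(\<epsilon>) only one of them contributes and the value there is a fixed nonzero
  constant. Visits for arbitrarily small \<epsilon> suffice, as negligibility asks for a bound for
  all small \<epsilon>.\<close>

text \<open>
  Words of arbitrary vectors are used instead of multi-indices because composition with an affine
  map then acts on the word letter by letter.
\<close>

definition iter_partial ::
    "'a::euclidean_space list \<Rightarrow> ('a \<Rightarrow> 'k::real_normed_vector) \<Rightarrow> 'a \<Rightarrow> 'k"
  where "iter_partial ws f = foldr partial ws f"

lemma iter_partial_Nil [simp]: "iter_partial [] f = f"
  and iter_partial_Cons [simp]: "iter_partial (w # ws) f = partial w (iter_partial ws f)"
  by (simp_all add: iter_partial_def)

lemma iter_partial_append: "iter_partial (ws @ vs) f = iter_partial ws (iter_partial vs f)"
  by (simp add: iter_partial_def)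

lemma partial_eqI: "(f has_derivative f') (at x) \<Longrightarrow> partial v f x = f' v"
  unfolding partial_def using frechet_derivative_at by metis

lemma has_derivative_partial:
  assumes "open W" "f differentiable_on W" "x \<in> W"
  shows "(f has_derivative (\<lambda>v. partial v f x)) (at x)"
proof -
  have "f differentiable at x"
    using assms by (simp add: differentiable_on_eq_differentiable_at)
  then show ?thesis by (simp add: partial_def frechet_derivative_works[symmetric])
qed

lemma partial_Basis_sum:
  assumes "open W" "f differentiable_on W" "x \<in> W"
  shows "partial v f x = (\<Sum>b\<in>Basis. (v \<bullet> b) *\<^sub>R partial b f x)"
proof -
  have "linear (\<lambda>v. partial v f x)"
    using has_derivative_partial[OF assms] has_derivative_linear by blast
  then have "partial (\<Sum>b\<in>Basis. (v \<bullet> b) *\<^sub>R b) f x = (\<Sum>b\<in>Basis. (v \<bullet> b) *\<^sub>R partial b f x)"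
    using linear_sum[of "\<lambda>v. partial v f x" "\<lambda>b. (v \<bullet> b) *\<^sub>R b" Basis] linear_cmul[of "\<lambda>v. partial v f x"]
    by simp
  then show ?thesis by (simp add: euclidean_representation)
qed

lemma partial_cong:
  assumes "open W" "\<And>y. y \<in> W \<Longrightarrow> f y = g y" "x \<in> W"
  shows "partial v f x = partial v g x"
proof -
  have "(f has_derivative f') (at x) \<longleftrightarrow> (g has_derivative f') (at x)" for f'
    using assms by (metis has_derivative_transform_within_open)
  then show ?thesis by (simp add: partial_def frechet_derivative_def)
qed

lemma iter_partial_cong:
  assumes "open W" "\<And>y. y \<in> W \<Longrightarrow> f y = g y" "x \<in> W"
  shows "iter_partial ws f x = iter_partial ws g x"
  using assms(3)
proof (induction ws arbitrary: x)
  case (Cons w ws)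
  then show ?case using partial_cong[OF assms(1), of "iter_partial ws f" "iter_partial ws g"] by simp
qed (simp add: assms)

lemma differentiable_on_cong:
  assumes "\<And>x. x \<in> W \<Longrightarrow> f x = g x"
  shows "f differentiable_on W \<longleftrightarrow> g differentiable_on W"
proof -
  have "(f has_derivative f') (at x within W) \<longleftrightarrow> (g has_derivative f') (at x within W)"
    if "x \<in> W" for x f'
    using assms that by (intro iffI; elim has_derivative_transform_within[OF _ zero_less_one]) auto
  then show ?thesis unfolding differentiable_on_def differentiable_def by simp
qed

lemma C_k_on_cong:
  assumes "open W" "\<And>x. x \<in> W \<Longrightarrow> f x = g x"
  shows "C_k_on k f W \<longleftrightarrow> C_k_on k g W"
  using assms(2)
proof (induction k arbitrary: f g)
  case 0
  then show ?case using continuous_on_cong[OF refl, of W f g] by simp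
next
  case (Suc k)
  have "C_k_on k (partial b f) W \<longleftrightarrow> C_k_on k (partial b g) W" for b
    using Suc.IH[of "partial b f" "partial b g"] partial_cong[OF assms(1) Suc.prems] by simp
  with differentiable_on_cong[of W f g] Suc.prems show ?case by simp
qed

lemma smooth_on_cong:
  assumes "open W" "\<And>x. x \<in> W \<Longrightarrow> f x = g x"
  shows "smooth_on f W \<longleftrightarrow> smooth_on g W"
  unfolding smooth_on_def using C_k_on_cong[of W f g, OF assms] by blast

lemma smooth_on_differentiable: "smooth_on f W \<Longrightarrow> f differentiable_on W"
  unfolding smooth_on_def by (metis C_k_on.simps(2))

lemma smooth_on_continuous: "smooth_on f W \<Longrightarrow> continuous_on W f"
  unfolding smooth_on_def by (metis C_k_on.simps(1))

lemma smooth_on_partial_Basis: "smooth_on f W \<Longrightarrow> b \<in> Basis \<Longrightarrow> smooth_on (partial b f) W"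
  unfolding smooth_on_def by (metis C_k_on.simps(2))

text \<open>Smoothness is a greatest fixed point: it suffices to exhibit a class P of functions that
  are differentiable on W and stable under basis derivatives. P typically describes the shape shared
  by all derivatives, up to equality on W, because \<open>partial\<close> is uncontrolled
  elsewhere.\<close>

lemma smooth_on_coinduct:
  assumes "P f"
    and "\<And>f. P f \<Longrightarrow> f differentiable_on W"
    and "\<And>f b. P f \<Longrightarrow> b \<in> Basis \<Longrightarrow> P (partial b f)"
  shows "smooth_on f W"
  unfolding smooth_on_def
proof
  fix k show "C_k_on k f W"
    using assms(1)
    by (induction k arbitrary: f) (auto simp: assms(2,3) differentiable_imp_continuous_on)
qed

section \<open>Linear operations on smooth functions and their derivatives\<close>

lemma differentiable_on_linear:
  assumes "f differentiable_on W" "bounded_linear h"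
  shows "(\<lambda>x. h (f x)) differentiable_on W"
  using assms bounded_linear.has_derivative unfolding differentiable_on_def differentiable_def by blast

lemma partial_add:
  assumes "open W" "f differentiable_on W" "g differentiable_on W" "x \<in> W"
  shows "partial v (\<lambda>x. f x + g x) x = partial v f x + partial v g x"
  by (rule partial_eqI[OF has_derivative_add])
    (use assms has_derivative_partial in blast)+

lemma C_k_on_add:
  assumes "open W" "C_k_on k f W" "C_k_on k g W"
  shows "C_k_on k (\<lambda>x. f x + g x) W"
  using assms(2,3)
proof (induction k arbitrary: f g)
  case (Suc k)
  have "C_k_on k (partial b (\<lambda>x. f x + g x)) W" if "b \<in> Basis" for b
    using C_k_on_cong[of W "partial b (\<lambda>x. f x + g x)" "\<lambda>x. partial b f x + partial b g x" k]
      partial_add[OF \<open>open W\<close>, of f g] Suc that \<open>open W\<close> by simp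
  with Suc.prems show ?case by (simp add: differentiable_on_add)
qed (simp add: continuous_on_add)

lemma smooth_on_add:
  assumes "open W" "smooth_on f W" "smooth_on g W"
  shows "smooth_on (\<lambda>x. f x + g x) W"
  using assms C_k_on_add unfolding smooth_on_def by blast

lemma smooth_on_const: "smooth_on (\<lambda>x. c) W"
proof (rule smooth_on_coinduct[where P = "\<lambda>h. \<exists>c. h = (\<lambda>x. c)"])
  show "\<And>f b. \<exists>c. f = (\<lambda>x. c) \<Longrightarrow> \<exists>c. partial b f = (\<lambda>x. c)"
    using partial_eqI[OF has_derivative_const] by blast
qed (auto)

lemma smooth_on_linear:
  assumes "open W" "smooth_on f W" "bounded_linear h"
  shows "smooth_on (\<lambda>x. h (f x)) W"
proof (rule smooth_on_coinduct[where P = "\<lambda>k. \<exists>f. smooth_on f W \<and> (\<forall>x\<in>W. k x = h (f x))"])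
  fix k assume "\<exists>f. smooth_on f W \<and> (\<forall>x\<in>W. k x = h (f x))"
  then obtain f where *: "smooth_on f W" "\<And>x. x\<in>W \<Longrightarrow> k x = h (f x)" by blast
  have d: "f differentiable_on W"
    using * smooth_on_differentiable by blast
  show "k differentiable_on W"
    using differentiable_on_cong[of W k, OF *(2)] d differentiable_on_linear[OF _ assms(3)] by blast
  fix b :: 'a assume b: "b \<in> Basis"
  have "\<forall>x\<in>W. partial b k x = h (partial b f x)"
    using partial_cong[of W k "\<lambda>x. h (f x)", OF \<open>open W\<close> *(2), of _ b]
      partial_eqI[OF bounded_linear.has_derivative[OF assms(3) has_derivative_partial[OF \<open>open W\<close> d]], of _ b]
    by simp
  with b * show "\<exists>f. smooth_on f W \<and> (\<forall>x\<in>W. partial b k x = h (f x))"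
    using smooth_on_partial_Basis by blast
qed (use assms in blast)

lemma smooth_on_sum:
  assumes "open W" "\<And>i. i \<in> I \<Longrightarrow> smooth_on (f i) W"
  shows "smooth_on (\<lambda>x. \<Sum>i\<in>I. f i x) W"
  using assms(2)
  by (induction I rule: infinite_finite_induct) (auto simp: smooth_on_const smooth_on_add assms(1))

lemma smooth_on_scaleR:
  "open W \<Longrightarrow> smooth_on f W \<Longrightarrow> smooth_on (\<lambda>x. c *\<^sub>R f x) W"
  using smooth_on_linear bounded_linear_scaleR_right by blast

lemma smooth_on_diff:
  assumes "open W" "smooth_on f W" "smooth_on g W"
  shows "smooth_on (\<lambda>x. f x - g x) W"
  using smooth_on_add[OF assms(1,2) smooth_on_scaleR[OF assms(1,3), of "-1"]] by simp

lemma smooth_on_partial: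
  assumes "open W" "smooth_on f W"
  shows "smooth_on (partial v f) W"
proof -
  have "smooth_on (\<lambda>x. \<Sum>b\<in>Basis. (v \<bullet> b) *\<^sub>R partial b f x) W"
    using assms by (intro smooth_on_sum smooth_on_scaleR smooth_on_partial_Basis)
  moreover have "partial v f x = (\<Sum>b\<in>Basis. (v \<bullet> b) *\<^sub>R partial b f x)" if "x \<in> W" for x
    using partial_Basis_sum[OF assms(1) smooth_on_differentiable[OF assms(2)] that] .
  ultimately show ?thesis
    using smooth_on_cong[OF \<open>open W\<close>, of "partial v f" "\<lambda>x. \<Sum>b\<in>Basis. (v \<bullet> b) *\<^sub>R partial b f x"]
    by simp
qed

lemma smooth_on_iter_partial:
  "open W \<Longrightarrow> smooth_on f W \<Longrightarrow> smooth_on (iter_partial ws f) W"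
  by (induction ws) (auto simp: smooth_on_partial)

lemma smooth_on_subset:
  assumes "open V" "V \<subseteq> W" "smooth_on f W"
  shows "smooth_on f V"
proof (rule smooth_on_coinduct[where P = "\<lambda>h. smooth_on h W"])
qed (use assms smooth_on_differentiable differentiable_on_subset smooth_on_partial_Basis in blast)+

lemma iter_partial_add:
  assumes "open W" "smooth_on f W" "smooth_on g W" "x \<in> W"
  shows "iter_partial ws (\<lambda>x. f x + g x) x = iter_partial ws f x + iter_partial ws g x"
  using assms(4)
proof (induction ws arbitrary: x)
  case (Cons w ws)
  then show ?case
    using partial_cong[of W "iter_partial ws (\<lambda>x. f x + g x)"
        "\<lambda>x. iter_partial ws f x + iter_partial ws g x", OF \<open>open W\<close> Cons.IH, of x w]
      partial_add[OF \<open>open W\<close> _ _ \<open>x \<in> W\<close>, of "iter_partial ws f" "iter_partial ws g" w] assms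
    by (simp add: smooth_on_differentiable smooth_on_iter_partial)
qed simp

lemma iter_partial_zero: "iter_partial ws (\<lambda>x. 0) = (\<lambda>x. 0)"
  by (induction ws) (auto simp: partial_eqI[OF has_derivative_const])

lemma iter_partial_const: "ws \<noteq> [] \<Longrightarrow> iter_partial ws (\<lambda>x. c) = (\<lambda>x. 0)"
proof (induction ws rule: rev_induct)
  case (snoc w ws)
  have "partial w (\<lambda>x. c) = (\<lambda>x. 0)" using partial_eqI[OF has_derivative_const] by blast
  then show ?case by (simp add: iter_partial_append iter_partial_zero)
qed simp

lemma iter_partial_linear:
  assumes "open W" "smooth_on f W" "bounded_linear h" "x \<in> W"
  shows "iter_partial ws (\<lambda>x. h (f x)) x = h (iter_partial ws f x)"
  using assms(4)
proof (induction ws arbitrary: x)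
  case (Cons w ws)
  have d: "iter_partial ws f differentiable_on W"
    using assms by (simp add: smooth_on_differentiable smooth_on_iter_partial)
  show ?case
    using partial_cong[of W "iter_partial ws (\<lambda>x. h (f x))" "\<lambda>x. h (iter_partial ws f x)",
        OF \<open>open W\<close> Cons.IH, of x w] Cons.prems
      partial_eqI[OF bounded_linear.has_derivative[OF assms(3) has_derivative_partial[OF \<open>open W\<close> d \<open>x \<in> W\<close>]], of w]
    by simp
qed simp

lemma iter_partial_scaleR:
  "open W \<Longrightarrow> smooth_on f W \<Longrightarrow> x \<in> W \<Longrightarrow>
    iter_partial ws (\<lambda>x. c *\<^sub>R f x) x = c *\<^sub>R iter_partial ws f x"
  using iter_partial_linear bounded_linear_scaleR_right by blast

lemma iter_partial_diff:
  assumes "open W" "smooth_on f W" "smooth_on g W" "x \<in> W"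
  shows "iter_partial ws (\<lambda>x. f x - g x) x = iter_partial ws f x - iter_partial ws g x"
  using iter_partial_add[OF assms(1,2) smooth_on_scaleR[OF assms(1,3), of "-1"] assms(4), of ws]
    iter_partial_scaleR[OF assms(1,3,4), of ws "-1"] by simp

lemma iter_partial_sum:
  assumes "open W" "\<And>i. i \<in> I \<Longrightarrow> smooth_on (f i) W" "x \<in> W"
  shows "iter_partial ws (\<lambda>x. \<Sum>i\<in>I. f i x) x = (\<Sum>i\<in>I. iter_partial ws (f i) x)"
  using assms(2)
proof (induction I rule: infinite_finite_induct)
  case (insert i I)
  then show ?case
    using iter_partial_add[OF \<open>open W\<close>, of "f i" "\<lambda>x. \<Sum>i\<in>I. f i x" x ws] assms(1,3)
    by (simp add: smooth_on_sum)
qed (simp_all add: iter_partial_zero)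

section \<open>Composition with affine maps\<close>

lemma partial_affine:
  fixes M :: "'a::euclidean_space \<Rightarrow> 'b::euclidean_space"
  assumes "bounded_linear M" "open U" "f differentiable_on U" "M x + c \<in> U"
  shows "((\<lambda>x. f (M x + c)) has_derivative (\<lambda>v. partial (M v) f (M x + c))) (at x)"
proof -
  have "((\<lambda>x. M x + c) has_derivative M) (at x)"
    using has_derivative_add[OF bounded_linear_imp_has_derivative[OF assms(1)] has_derivative_const]
    by simp
  from has_derivative_compose[OF this has_derivative_partial[OF assms(2,3,4)]] show ?thesis .
qed

lemma smooth_on_affine:
  fixes M :: "'a::euclidean_space \<Rightarrow> 'b::euclidean_space"
  assumes "bounded_linear M" "open U" "open W" "\<And>x. x \<in> W \<Longrightarrow> M x + c \<in> U" "smooth_on f U"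
  shows "smooth_on (\<lambda>x. f (M x + c)) W"
proof (rule smooth_on_coinduct[where P = "\<lambda>h. \<exists>f. smooth_on f U \<and> (\<forall>x\<in>W. h x = f (M x + c))"])
  fix h assume "\<exists>f. smooth_on f U \<and> (\<forall>x\<in>W. h x = f (M x + c))"
  then obtain f where *: "smooth_on f U" "\<And>x. x\<in>W \<Longrightarrow> h x = f (M x + c)" by blast
  note D = partial_affine[OF assms(1,2) smooth_on_differentiable[OF *(1)] assms(4)]
  have "(\<lambda>x. f (M x + c)) differentiable_on W"
    using D unfolding differentiable_on_def differentiable_def
    using has_derivative_at_withinI by blast
  then show "h differentiable_on W"
    using differentiable_on_cong[of W h, OF *(2)] by blast
  fix b :: 'a assume b: "b \<in> Basis"
  have "\<forall>x\<in>W. partial b h x = partial (M b) f (M x + c)"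
    using partial_cong[of W h "\<lambda>x. f (M x + c)", OF \<open>open W\<close> *(2), of _ b] partial_eqI[OF D, of _ b]
    by simp
  \<comment> \<open>The new witness is \<open>partial (M b) f\<close>. As M b need not be a basis
    vector, smoothness of derivatives in arbitrary directions is required.\<close>
  with * show "\<exists>f. smooth_on f U \<and> (\<forall>x\<in>W. partial b h x = f (M x + c))"
    using smooth_on_partial[OF assms(2)] by blast
qed (use assms in blast)

lemma iter_partial_affine:
  fixes M :: "'a::euclidean_space \<Rightarrow> 'b::euclidean_space"
  assumes "bounded_linear M" "open U" "open W" "\<And>x. x \<in> W \<Longrightarrow> M x + c \<in> U" "smooth_on f U" "x \<in> W"
  shows "iter_partial ws (\<lambda>x. f (M x + c)) x = iter_partial (map M ws) f (M x + c)"
  using assms(6)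
proof (induction ws arbitrary: x)
  case (Cons w ws)
  have d: "iter_partial (map M ws) f differentiable_on U"
    using assms(2,5) smooth_on_differentiable smooth_on_iter_partial by blast
  show ?case
    using partial_cong[of W "iter_partial ws (\<lambda>x. f (M x + c))" "\<lambda>x. iter_partial (map M ws) f (M x + c)",
        OF \<open>open W\<close> Cons.IH, of x w]
    partial_eqI[OF partial_affine[OF assms(1,2) d assms(4)[OF Cons.prems]], of w] Cons.prems by simp
qed simp

lemma partial_scaleR_dir:
  assumes "open W" "f differentiable_on W" "x \<in> W"
  shows "partial (c *\<^sub>R v) f x = c *\<^sub>R partial v f x"
  using linear_cmul[OF has_derivative_linear[OF has_derivative_partial[OF assms]]] .

lemma iter_partial_scaleR_dir:
  assumes "open W" "smooth_on f W" "x \<in> W"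
  shows "iter_partial (map (\<lambda>w. c *\<^sub>R w) ws) f x = c ^ length ws *\<^sub>R iter_partial ws f x"
  using assms(3)
proof (induction ws arbitrary: x)
  case (Cons w ws)
  have s: "smooth_on (iter_partial ws f) W" using assms smooth_on_iter_partial by blast
  have "partial (c *\<^sub>R w) (iter_partial (map ((*\<^sub>R) c) ws) f) x
      = partial (c *\<^sub>R w) (\<lambda>x. c ^ length ws *\<^sub>R iter_partial ws f x) x"
    by (rule partial_cong[OF \<open>open W\<close> _ Cons.prems]) (use Cons.IH in auto)
  also have "\<dots> = c *\<^sub>R partial w (\<lambda>x. c ^ length ws *\<^sub>R iter_partial ws f x) x"
    by (rule partial_scaleR_dir[OF \<open>open W\<close> smooth_on_differentiable Cons.prems])
      (use smooth_on_scaleR[OF \<open>open W\<close> s] in blast)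
  also have "\<dots> = c *\<^sub>R c ^ length ws *\<^sub>R partial w (iter_partial ws f) x"
    using iter_partial_scaleR[OF \<open>open W\<close> s Cons.prems, of "[w]"] by simp
  finally show ?case by simp
qed simp

section \<open>Symmetry of iterated derivatives\<close>

lemma vector_derivative_bound:
  fixes F :: "real \<Rightarrow> 'k::real_normed_vector"
  assumes "a \<le> b" "\<And>t. t \<in> {a..b} \<Longrightarrow> (F has_vector_derivative F' t) (at t)"
    "\<And>t. t \<in> {a..b} \<Longrightarrow> norm (F' t) \<le> B"
  shows "norm (F b - F a) \<le> B * (b - a)"
proof -
  have "norm (F b - F a) \<le> B * norm (b - a)"
  proof (rule differentiable_bound[where S = "{a..b}" and f' = "\<lambda>t h. h *\<^sub>R F' t"])
    fix t assume t: "t \<in> {a..b}"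
    show "(F has_derivative (\<lambda>h. h *\<^sub>R F' t)) (at t within {a..b})"
      using assms(2)[OF t] has_derivative_at_withinI unfolding has_vector_derivative_def by blast
    show "onorm (\<lambda>h. h *\<^sub>R F' t) \<le> B"
      using assms(3)[OF t] by (intro onorm_le) (simp add: mult.commute[of B] mult_left_mono)
  qed (use assms(1) in auto)
  then show ?thesis using assms(1) by simp
qed

lemma has_vector_derivative_line:
  assumes "open W" "f differentiable_on W" "y + t *\<^sub>R v \<in> W"
  shows "((\<lambda>t. f (y + t *\<^sub>R v)) has_vector_derivative partial v f (y + t *\<^sub>R v)) (at t)"
proof -
  have "bounded_linear (\<lambda>t::real. t *\<^sub>R v)" by (rule bounded_linear_scaleR_left)
  from partial_affine[OF this assms(1,2), of t y] assms
  show ?thesis unfolding has_vector_derivative_def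
    by (simp add: add.commute partial_scaleR_dir)
qed

text \<open>The mean value inequality is applied twice, once in each direction, after the expected
  value has been subtracted; continuity of the mixed derivative at x makes what remains at most
  \<eta>. The second difference is symmetric in a and b, which is what
  \<open>partial_commute\<close> exploits.\<close>

lemma second_difference_approx:
  fixes f :: "'a::euclidean_space \<Rightarrow> 'k::real_normed_vector"
  assumes W: "open W" "smooth_on f W" "x \<in> W" and "\<eta> > 0"
  shows "\<exists>\<delta>>0. \<forall>s. 0 < s \<and> s < \<delta> \<longrightarrow>
    norm (f (x + s *\<^sub>R a + s *\<^sub>R b) - f (x + s *\<^sub>R a) - f (x + s *\<^sub>R b) + f x
      - s\<^sup>2 *\<^sub>R partial a (partial b f) x) \<le> s\<^sup>2 * \<eta>"
proof -
  define c where "c = partial a (partial b f) x"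
  have sm: "smooth_on (partial b f) W" "smooth_on (partial a (partial b f)) W"
    using W smooth_on_partial by blast+
  have df: "f differentiable_on W" "partial b f differentiable_on W"
    using sm W smooth_on_differentiable by blast+
  have "isCont (partial a (partial b f)) x"
    using smooth_on_continuous[OF sm(2)] W by (simp add: continuous_on_eq_continuous_at)
  then obtain d where d: "d > 0" "\<And>y. dist y x < d \<Longrightarrow> dist (partial a (partial b f) y) c < \<eta>"
    unfolding continuous_at_eps_delta c_def using \<open>\<eta> > 0\<close> by blast
  obtain d' where d': "d' > 0" "ball x d' \<subseteq> W" using W open_contains_ball by blast
  define D where "D = min d d'"
  have near: "dist (x + \<sigma> *\<^sub>R a + \<tau> *\<^sub>R b) x < D"
    if "0 \<le> \<sigma>" "\<sigma> \<le> s" "0 \<le> \<tau>" "\<tau> \<le> s" "s < D / (norm a + norm b + 1)" for \<sigma> \<tau> s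
  proof -
    have "dist (x + \<sigma> *\<^sub>R a + \<tau> *\<^sub>R b) x = norm (\<sigma> *\<^sub>R a + \<tau> *\<^sub>R b)"
      by (simp add: dist_norm algebra_simps)
    also have "\<dots> \<le> \<sigma> * norm a + \<tau> * norm b" using norm_triangle_ineq that by (metis abs_of_nonneg norm_scaleR)
    also have "\<dots> \<le> s * norm a + s * norm b" using that by (intro add_mono mult_right_mono) auto
    also have "\<dots> \<le> s * (norm a + norm b + 1)" using that by (simp add: algebra_simps)
    also have "\<dots> < D" using that by (simp add: pos_less_divide_eq add_nonneg_pos)
    finally show ?thesis .
  qed
  have inW: "x + \<sigma> *\<^sub>R a + \<tau> *\<^sub>R b \<in> W"
    and close: "norm (partial a (partial b f) (x + \<sigma> *\<^sub>R a + \<tau> *\<^sub>R b) - c) \<le> \<eta>"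
    if "0 \<le> \<sigma>" "\<sigma> \<le> s" "0 \<le> \<tau>" "\<tau> \<le> s" "s < D / (norm a + norm b + 1)" for \<sigma> \<tau> s
  proof -
    let ?y = "x + \<sigma> *\<^sub>R a + \<tau> *\<^sub>R b"
    have "dist ?y x < d" "dist x ?y < d'" using near[OF that] by (auto simp: D_def dist_commute)
    then show "?y \<in> W" "norm (partial a (partial b f) ?y - c) \<le> \<eta>"
      using d(2)[of ?y] d'(2) by (auto simp: dist_norm[symmetric] mem_ball less_imp_le)
  qed
  have main: "norm (f (x + s *\<^sub>R a + s *\<^sub>R b) - f (x + s *\<^sub>R a) - f (x + s *\<^sub>R b) + f x - s\<^sup>2 *\<^sub>R c)
      \<le> s\<^sup>2 * \<eta>" if s: "0 < s" "s < D / (norm a + norm b + 1)" for s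
  proof -
    \<comment> \<open>The first difference in direction a, as a function of the parameter of b,
      minus its expected value. Its derivative H' is in turn \<open>G s - G 0\<close>, a difference
      of \<open>partial b f\<close> along a minus its expected value.\<close>
    define H where "H = (\<lambda>\<tau>. f (x + s *\<^sub>R a + \<tau> *\<^sub>R b) - f (x + \<tau> *\<^sub>R b) - \<tau> *\<^sub>R (s *\<^sub>R c))"
    define H' where "H' = (\<lambda>\<tau>. partial b f (x + s *\<^sub>R a + \<tau> *\<^sub>R b) - partial b f (x + \<tau> *\<^sub>R b) - s *\<^sub>R c)"
    have "norm (H s - H 0) \<le> (\<eta> * s) * (s - 0)"
    proof (rule vector_derivative_bound)
      fix \<tau> assume t: "\<tau> \<in> {0..s}"
      have in1: "x + s *\<^sub>R a + \<tau> *\<^sub>R b \<in> W" using inW[of s s \<tau>] s t by simp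
      have in2: "x + \<tau> *\<^sub>R b \<in> W" using inW[of 0 s \<tau>] s t by simp
      have "((\<lambda>\<tau>. \<tau> *\<^sub>R (s *\<^sub>R c)) has_vector_derivative s *\<^sub>R c) (at \<tau>)"
        using has_vector_derivative_scaleR[OF DERIV_ident has_vector_derivative_const, of "s *\<^sub>R c" \<tau> UNIV]
        by simp
      then show "(H has_vector_derivative H' \<tau>) (at \<tau>)"
        unfolding H_def H'_def
        by (intro has_vector_derivative_diff has_vector_derivative_line[OF W(1) df(1)] in1 in2)
      define G where "G = (\<lambda>\<sigma>. partial b f ((x + \<tau> *\<^sub>R b) + \<sigma> *\<^sub>R a) - \<sigma> *\<^sub>R c)"
      have "norm (G s - G 0) \<le> \<eta> * (s - 0)"
      proof (rule vector_derivative_bound)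
        fix \<sigma> assume u: "\<sigma> \<in> {0..s}"
        have e: "x + \<tau> *\<^sub>R b + \<sigma> *\<^sub>R a = x + \<sigma> *\<^sub>R a + \<tau> *\<^sub>R b" by simp
        have "((\<lambda>\<sigma>. \<sigma> *\<^sub>R c) has_vector_derivative c) (at \<sigma>)"
          using has_vector_derivative_scaleR[OF DERIV_ident has_vector_derivative_const, of c \<sigma> UNIV]
          by simp
        moreover have "x + \<tau> *\<^sub>R b + \<sigma> *\<^sub>R a \<in> W" unfolding e using inW[of \<sigma> s \<tau>] s t u by simp
        ultimately show "(G has_vector_derivative
            partial a (partial b f) ((x + \<tau> *\<^sub>R b) + \<sigma> *\<^sub>R a) - c) (at \<sigma>)"
          unfolding G_def
          by (intro has_vector_derivative_diff has_vector_derivative_line[OF W(1) df(2)])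
        show "norm (partial a (partial b f) ((x + \<tau> *\<^sub>R b) + \<sigma> *\<^sub>R a) - c) \<le> \<eta>"
          unfolding e using close[of \<sigma> s \<tau>] s t u by simp
      qed (use s in simp)
      then show "norm (H' \<tau>) \<le> \<eta> * s"
        unfolding G_def H'_def by (simp add: algebra_simps)
    qed (use s in simp)
    moreover have "H s - H 0 =
        f (x + s *\<^sub>R a + s *\<^sub>R b) - f (x + s *\<^sub>R a) - f (x + s *\<^sub>R b) + f x - s\<^sup>2 *\<^sub>R c"
      unfolding H_def by (simp add: power2_eq_square)
    ultimately show ?thesis by (simp add: power2_eq_square mult.commute mult.left_commute)
  qed
  have "D / (norm a + norm b + 1) > 0"
    using d d' unfolding D_def by (simp add: add_nonneg_pos)
  with main show ?thesis unfolding c_def by blast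
qed

lemma partial_commute:
  assumes "open W" "smooth_on f W" "x \<in> W"
  shows "partial a (partial b f) x = partial b (partial a f) x"
proof (rule ccontr)
  let ?c = "partial a (partial b f) x" and ?d = "partial b (partial a f) x"
  assume "?c \<noteq> ?d"
  \<comment> \<open>With a third of the distance as tolerance, the two errors together cover only
    two thirds of it.\<close>
  define \<eta> where "\<eta> = norm (?c - ?d) / 3"
  have \<eta>: "\<eta> > 0" using \<open>?c \<noteq> ?d\<close> by (simp add: \<eta>_def)
  define X where "X = (\<lambda>s. f (x + s *\<^sub>R a + s *\<^sub>R b) - f (x + s *\<^sub>R a) - f (x + s *\<^sub>R b) + f x)"
  obtain \<delta> where \<delta>: "\<delta> > 0" "\<And>s. 0 < s \<and> s < \<delta> \<Longrightarrow> norm (X s - s\<^sup>2 *\<^sub>R ?c) \<le> s\<^sup>2 * \<eta>"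
    using second_difference_approx[OF assms \<eta>, of a b] unfolding X_def by blast
  obtain \<delta>' where \<delta>': "\<delta>' > 0" "\<And>s. 0 < s \<and> s < \<delta>' \<Longrightarrow> norm (f (x + s *\<^sub>R b + s *\<^sub>R a) - f (x + s *\<^sub>R b) - f (x + s *\<^sub>R a) + f x - s\<^sup>2 *\<^sub>R ?d) \<le> s\<^sup>2 * \<eta>"
    using second_difference_approx[OF assms \<eta>, of b a] by blast
  define s where "s = min \<delta> \<delta>' / 2"
  have s: "0 < s" "s < \<delta>" "s < \<delta>'" using \<delta> \<delta>' by (auto simp: s_def)
  have "norm (X s - s\<^sup>2 *\<^sub>R ?d) \<le> s\<^sup>2 * \<eta>"
    using \<delta>'(2)[of s] s unfolding X_def by (simp add: algebra_simps)
  moreover have "norm (X s - s\<^sup>2 *\<^sub>R ?c) \<le> s\<^sup>2 * \<eta>" using \<delta>(2) s by simp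
  ultimately have "norm ((X s - s\<^sup>2 *\<^sub>R ?d) - (X s - s\<^sup>2 *\<^sub>R ?c)) \<le> s\<^sup>2 * \<eta> + s\<^sup>2 * \<eta>"
    using norm_triangle_ineq4[of "X s - s\<^sup>2 *\<^sub>R ?d" "X s - s\<^sup>2 *\<^sub>R ?c"] by linarith
  moreover have "(X s - s\<^sup>2 *\<^sub>R ?d) - (X s - s\<^sup>2 *\<^sub>R ?c) = s\<^sup>2 *\<^sub>R (?c - ?d)"
    by (simp add: algebra_simps)
  ultimately have "s\<^sup>2 * (3 * \<eta>) \<le> s\<^sup>2 * (2 * \<eta>)"
    by (simp add: \<eta>_def)
  with s \<eta> show False by simp
qed

lemma iter_partial_move_front:
  assumes "open W" "smooth_on f W" "x \<in> W"
  shows "iter_partial (us @ w # ts) f x = iter_partial (w # us @ ts) f x"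
  using assms(3)
proof (induction us arbitrary: x)
  case (Cons u us)
  have s: "smooth_on (iter_partial (us @ ts) f) W" using assms smooth_on_iter_partial by blast
  show ?case
    using partial_cong[of W "iter_partial (us @ w # ts) f" "iter_partial (w # us @ ts) f", OF \<open>open W\<close> Cons.IH, of x u]
      partial_commute[OF \<open>open W\<close> s, of x u w] Cons.prems by simp
qed simp

lemma iter_partial_mset_cong:
  assumes "open W" "smooth_on f W" "mset ws = mset vs" "x \<in> W"
  shows "iter_partial ws f x = iter_partial vs f x"
  using assms(3,4)
proof (induction ws arbitrary: vs x)
  case (Cons w ws)
  then have "w \<in> set vs" by (metis list.set_intros(1) mset_eq_setD)
  then obtain us ts where vs: "vs = us @ w # ts" by (meson split_list)
  with Cons.prems have "mset ws = mset (us @ ts)" by simp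
  from partial_cong[of W "iter_partial ws f" "iter_partial (us @ ts) f", OF \<open>open W\<close> Cons.IH[OF this], of x w]
  show ?case using iter_partial_move_front[OF assms(1,2), of x us w ts] Cons.prems vs by simp
qed simp

lemma basis_enum: "distinct (basis_enum :: 'a::euclidean_space list)" "set (basis_enum :: 'a list) = Basis"
proof -
  have "\<exists>bs :: 'a list. distinct bs \<and> set bs = Basis"
    using finite_distinct_list[OF finite_Basis] by blast
  from someI_ex[OF this] show "distinct (basis_enum :: 'a list)" "set (basis_enum :: 'a list) = Basis"
    unfolding basis_enum_def by blast+
qed

lemma multi_deriv_eq_iter_partial:
  "multi_deriv \<alpha> f = iter_partial (concat (map (\<lambda>b. replicate (\<alpha> b) b) basis_enum)) f"
proof -
  have "foldr (\<lambda>b. partial b ^^ \<alpha> b) bs f = iter_partial (concat (map (\<lambda>b. replicate (\<alpha> b) b) bs)) f" for bs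
  proof (induction bs)
    case (Cons b bs)
    have "(partial b ^^ n) g = iter_partial (replicate n b) g" for n and g :: "'a \<Rightarrow> 'b"
      by (induction n) auto
    with Cons show ?case by (simp add: iter_partial_append)
  qed simp
  then show ?thesis by (simp add: multi_deriv_def)
qed

text \<open>A word over \<open>Basis\<close> matters only through the multiset of its letters, which
  is a multi-index. This carries estimates that the definitions state for multi-indices over to
  words.\<close>

lemma iter_partial_eq_multi_deriv:
  assumes "open W" "smooth_on f W" "set ws \<subseteq> Basis" "x \<in> W"
  shows "iter_partial ws f x = multi_deriv (count (mset ws)) f x"
proof -
  have "mset (concat (map (\<lambda>b. replicate (count (mset ws) b) b) bs)) = filter_mset (\<lambda>b. b \<in> set bs) (mset ws)"
    if "distinct bs" for bs
    using that
  proof (induction bs)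
    case (Cons b bs)
    then show ?case by (intro multiset_eqI) auto
  qed simp
  from this[OF basis_enum(1)] have "mset (concat (map (\<lambda>b. replicate (count (mset ws) b) b) basis_enum)) = mset ws"
    using assms(3) by (auto simp: basis_enum(2) filter_mset_eq_conv)
  then show ?thesis unfolding multi_deriv_eq_iter_partial
    using iter_partial_mset_cong[OF assms(1,2) _ assms(4)] by metis
qed

lemma set_multi_deriv_word:
  "set (concat (map (\<lambda>b. replicate (\<alpha> b) b) (basis_enum :: 'a::euclidean_space list))) \<subseteq> Basis"
  by (auto simp: basis_enum(2))

text \<open>Expanding each letter h in the basis gives \<open>DIM('a) ^ q\<close> basis words, each
  with a coefficient of size at most \<open>norm h ^ q\<close>.\<close>

lemma norm_iter_partial_replicate:
  fixes f :: "'a::euclidean_space \<Rightarrow> 'k::real_normed_vector"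
  assumes "open W" "smooth_on f W" "x \<in> W"
    and "\<And>ws. set ws \<subseteq> Basis \<Longrightarrow> length ws = q \<Longrightarrow> norm (iter_partial ws f x) \<le> B"
  shows "norm (iter_partial (replicate q h) f x) \<le> (real DIM('a) * norm h) ^ q * B"
  using assms(2,4)
proof (induction q arbitrary: f)
  case (Suc q)
  have IH: "norm (iter_partial (replicate q h) (partial b f) x) \<le> (real DIM('a) * norm h) ^ q * B"
    if "b \<in> Basis" for b
  proof (rule Suc.IH)
    fix ws :: "'a list" assume "set ws \<subseteq> Basis" "length ws = q"
    with Suc.prems(2)[of "ws @ [b]"] that show "norm (iter_partial ws (partial b f) x) \<le> B"
      by (simp add: iter_partial_append)
  qed (use assms(1) Suc.prems smooth_on_partial in blast)
  have s: "smooth_on (partial b f) W" for b using assms(1) Suc.prems smooth_on_partial by blast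
  \<comment> \<open>The innermost letter is split off, so that the induction hypothesis applies to
    the function \<open>partial b f\<close> at the same point x.\<close>
  have "iter_partial (replicate (Suc q) h) f x = iter_partial (replicate q h) (partial h f) x"
    by (metis iter_partial_Cons iter_partial_Nil iter_partial_append replicate_append_same replicate_Suc)
  also have "\<dots> = iter_partial (replicate q h) (\<lambda>x. \<Sum>b\<in>Basis. (h \<bullet> b) *\<^sub>R partial b f x) x"
    using partial_Basis_sum[OF assms(1) smooth_on_differentiable[OF Suc.prems(1)]]
    by (intro iter_partial_cong[OF assms(1) _ assms(3)]) blast
  also have "\<dots> = (\<Sum>b\<in>Basis. iter_partial (replicate q h) (\<lambda>x. (h \<bullet> b) *\<^sub>R partial b f x) x)"
    by (rule iter_partial_sum[OF assms(1) _ assms(3)]) (use assms(1) s smooth_on_scaleR in blast)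
  also have "\<dots> = (\<Sum>b\<in>Basis. (h \<bullet> b) *\<^sub>R iter_partial (replicate q h) (partial b f) x)"
    using iter_partial_scaleR[OF assms(1) s assms(3)] by simp
  finally have "norm (iter_partial (replicate (Suc q) h) f x) \<le>
      (\<Sum>b\<in>Basis. norm ((h \<bullet> b) *\<^sub>R iter_partial (replicate q h) (partial b f) x))"
    using norm_sum by metis
  also have "\<dots> \<le> (\<Sum>b\<in>(Basis::'a set). norm h * ((real DIM('a) * norm h) ^ q * B))"
    by (intro sum_mono) (use IH Basis_le_norm in \<open>auto intro!: mult_mono\<close>)
  finally show ?case by (simp add: mult_ac)
qed simp

section \<open>Finite differences\<close>

definition alt_binom :: "nat \<Rightarrow> nat \<Rightarrow> real"
  where "alt_binom m j = (-1) ^ j * real (m choose j)"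

text \<open>This is (1 - T)^m g at x with T the shift by h, that is, (-1)^m times the usual forward
  difference. With this sign the weight of \<open>g x\<close> is 1 for every m.\<close>

definition fin_diff :: "nat \<Rightarrow> ('a::real_vector \<Rightarrow> 'k::real_vector) \<Rightarrow> 'a \<Rightarrow> 'a \<Rightarrow> 'k"
  where "fin_diff m g h x = (\<Sum>j\<le>m. alt_binom m j *\<^sub>R g (x + real j *\<^sub>R h))"

lemma alt_binom_0 [simp]: "alt_binom m 0 = 1"
  by (simp add: alt_binom_def)

lemma sum_abs_alt_binom: "(\<Sum>j\<le>m. \<bar>alt_binom m j\<bar>) = 2 ^ m"
proof -
  have "(\<Sum>j\<le>m. \<bar>alt_binom m j\<bar>) = real (\<Sum>j\<le>m. m choose j)"
    by (simp add: alt_binom_def abs_mult power_abs)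
  then show ?thesis by (simp add: choose_row_sum)
qed

text \<open>Pascal's rule in operator form: (1 - T)^(m+1) = (1 - T)^m (1 - T), with T the shift of
  the index.\<close>

lemma alt_binom_pascal:
  fixes g :: "nat \<Rightarrow> 'k::real_vector"
  shows "(\<Sum>j\<le>Suc m. alt_binom (Suc m) j *\<^sub>R g j) = (\<Sum>j\<le>m. alt_binom m j *\<^sub>R (g j - g (Suc j)))"
proof -
  have "alt_binom (Suc m) (Suc i) = alt_binom m (Suc i) - alt_binom m i" for i
    by (simp add: alt_binom_def algebra_simps)
  then have "(\<Sum>j\<le>Suc m. alt_binom (Suc m) j *\<^sub>R g j)
      = (g 0 + (\<Sum>i\<le>m. alt_binom m (Suc i) *\<^sub>R g (Suc i))) - (\<Sum>i\<le>m. alt_binom m i *\<^sub>R g (Suc i))"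
    by (simp only: sum.atMost_Suc_shift) (simp add: scaleR_left_diff_distrib sum_subtractf)
  also have "g 0 + (\<Sum>i\<le>m. alt_binom m (Suc i) *\<^sub>R g (Suc i)) = (\<Sum>j\<le>Suc m. alt_binom m j *\<^sub>R g j)"
    by (simp only: sum.atMost_Suc_shift) simp
  also have "\<dots> = (\<Sum>j\<le>m. alt_binom m j *\<^sub>R g j)" by (simp add: alt_binom_def)
  finally show ?thesis by (simp add: scaleR_right_diff_distrib sum_subtractf)
qed

text \<open>The m unit differences are removed one by one: q of them by the mean value inequality,
  each raising the order of the derivative by one, the remaining m - q by the triangle inequality,
  each at the cost of a factor 2. The whole sequence G of derivatives is kept arbitrary in the
  induction, since differencing produces a sequence of the same kind.\<close>

lemma norm_alternating_sum_le:
  fixes G :: "nat \<Rightarrow> real \<Rightarrow> 'k::real_normed_vector"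
  assumes "\<And>i t. t \<in> {0..real m} \<Longrightarrow> (G i has_vector_derivative G (Suc i) t) (at t)"
    and "\<And>t. t \<in> {0..real m} \<Longrightarrow> norm (G q t) \<le> M" and "q \<le> m"
  shows "norm (\<Sum>j\<le>m. alt_binom m j *\<^sub>R G 0 (real j)) \<le> 2 ^ (m - q) * M"
  using assms
proof (induction m arbitrary: G q M)
  case 0
  then show ?case by simp
next
  case (Suc m)
  \<comment> \<open>The shift commutes with differentiation, so H is again a sequence of successive
    derivatives, on an interval shorter by 1.\<close>
  define H where "H = (\<lambda>i t. G i t - G i (t + 1))"
  have dH: "(H i has_vector_derivative H (Suc i) t) (at t)" if "t \<in> {0..real m}" for i t
  proof -
    have "((\<lambda>t. t + 1) has_vector_derivative 1) (at t)"
      by (auto intro!: derivative_eq_intros)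
    from vector_diff_chain_at[OF this, of "G i" "G (Suc i) (t + 1)"] Suc.prems(1)[of "t + 1" i] that
    have "((\<lambda>t. G i (t + 1)) has_vector_derivative G (Suc i) (t + 1)) (at t)"
      by (simp add: o_def)
    then show ?thesis
      unfolding H_def using Suc.prems(1)[of t i] that by (intro has_vector_derivative_diff) auto
  qed
  have eq: "(\<Sum>j\<le>Suc m. alt_binom (Suc m) j *\<^sub>R G 0 (real j)) = (\<Sum>j\<le>m. alt_binom m j *\<^sub>R H 0 (real j))"
    unfolding alt_binom_pascal H_def by (simp add: add.commute)
  show ?case
  proof (cases q)
    case 0
    have "norm (H 0 t) \<le> 2 * M" if "t \<in> {0..real m}" for t
      using norm_triangle_ineq4[of "G 0 t" "G 0 (t+1)"] Suc.prems(2)[of t] Suc.prems(2)[of "t+1"] that 0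
      unfolding H_def by simp
    from Suc.IH[of H 0, OF dH this] show ?thesis unfolding eq 0 by simp
  next
    case (Suc p)
    have "norm (H p t) \<le> M" if "t \<in> {0..real m}" for t
    proof -
      have "norm (G p (t + 1) - G p t) \<le> M * (t + 1 - t)"
        by (rule vector_derivative_bound[where F' = "G q"]) (use Suc.prems(1)[of _ p] Suc.prems(2) that Suc in auto)
      then show ?thesis unfolding H_def by (simp add: norm_minus_commute)
    qed
    from Suc.IH[of H p, OF dH this] Suc.prems(3) show ?thesis unfolding eq Suc by simp
  qed
qed

text \<open>Restriction to the segment t \<mapsto> x + t h turns the step into 1 and each derivative
  in t into a derivative in direction h. The segment extends to x + m h, so later, with steps of
  size \<epsilon>, the product m \<epsilon> has to tend to 0.\<close>

lemma norm_fin_diff_le: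
  fixes g :: "'a::euclidean_space \<Rightarrow> 'k::real_normed_vector"
  assumes "open W" "smooth_on g W" "q \<le> m"
    and inW: "\<And>t. t \<in> {0..real m} \<Longrightarrow> x + t *\<^sub>R h \<in> W"
    and B: "\<And>t ws. t \<in> {0..real m} \<Longrightarrow> set ws \<subseteq> Basis \<Longrightarrow> length ws = q \<Longrightarrow>
      norm (iter_partial ws g (x + t *\<^sub>R h)) \<le> B"
  shows "norm (fin_diff m g h x) \<le> 2 ^ (m - q) * ((real DIM('a) * norm h) ^ q * B)"
proof -
  define G where "G = (\<lambda>i t. iter_partial (replicate i h) g (x + t *\<^sub>R h))"
  have "norm (\<Sum>j\<le>m. alt_binom m j *\<^sub>R G 0 (real j)) \<le> 2 ^ (m - q) * ((real DIM('a) * norm h) ^ q * B)"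
  proof (rule norm_alternating_sum_le)
    fix i t assume t: "t \<in> {0..real m}"
    have "smooth_on (iter_partial (replicate i h) g) W" using assms smooth_on_iter_partial by blast
    from has_vector_derivative_line[OF assms(1) smooth_on_differentiable[OF this] inW[OF t]]
    show "(G i has_vector_derivative G (Suc i) t) (at t)" by (simp add: G_def)
    show "norm (G q t) \<le> (real DIM('a) * norm h) ^ q * B"
      unfolding G_def by (rule norm_iter_partial_replicate[OF assms(1,2) inW[OF t] B[OF t]])
  qed (use assms in simp)
  then show ?thesis by (simp add: G_def fin_diff_def)
qed

section \<open>A compactly supported mollifier\<close>

lemma C_k_on_Suc_imp: "C_k_on (Suc k) f W \<Longrightarrow> C_k_on k f W"
  by (induction k arbitrary: f) (auto simp: differentiable_imp_continuous_on)

text \<open>Induction on k instead of \<open>smooth_on_coinduct\<close>: the derivative of a product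
  is a sum of two products, so products alone are not stable under differentiation.\<close>

lemma C_k_on_mult:
  fixes f g :: "'a::euclidean_space \<Rightarrow> real"
  assumes "open W" "C_k_on k f W" "C_k_on k g W"
  shows "C_k_on k (\<lambda>x. f x * g x) W"
  using assms(2,3)
proof (induction k arbitrary: f g)
  case (Suc k)
  have d: "f differentiable_on W" "g differentiable_on W" using Suc.prems by auto
  have "C_k_on k (partial b (\<lambda>x. f x * g x)) W" if "b \<in> Basis" for b
  proof -
    have "C_k_on k (\<lambda>x. f x * partial b g x + partial b f x * g x) W"
      using Suc.prems that C_k_on_Suc_imp[OF Suc.prems(1)] C_k_on_Suc_imp[OF Suc.prems(2)]
      by (intro C_k_on_add[OF assms(1)] Suc.IH) auto
    moreover have "partial b (\<lambda>x. f x * g x) x = f x * partial b g x + partial b f x * g x" if "x \<in> W" for x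
      by (rule partial_eqI[OF has_derivative_mult[OF has_derivative_partial[OF assms(1) d(1) that]
            has_derivative_partial[OF assms(1) d(2) that]]])
    ultimately show ?thesis
      using C_k_on_cong[of W "partial b (\<lambda>x. f x * g x)" "\<lambda>x. f x * partial b g x + partial b f x * g x" k] assms(1)
      by simp
  qed
  with d show ?case by (simp add: differentiable_on_mult)
qed (simp add: continuous_on_mult)

lemma smooth_on_mult:
  fixes f g :: "'a::euclidean_space \<Rightarrow> real"
  shows "open W \<Longrightarrow> smooth_on f W \<Longrightarrow> smooth_on g W \<Longrightarrow> smooth_on (\<lambda>x. f x * g x) W"
  using C_k_on_mult unfolding smooth_on_def by blast

text \<open>The chain rule passes from \<open>e i\<close> to \<open>e (Suc i)\<close> and multiplies
  by \<open>partial b g\<close>, so the induction on the order of smoothness keeps i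
  arbitrary.\<close>

lemma smooth_on_compose_real:
  fixes e :: "nat \<Rightarrow> real \<Rightarrow> real" and g :: "'a::euclidean_space \<Rightarrow> real"
  assumes "open W" "smooth_on g W"
    and e: "\<And>i t. (e i has_real_derivative e (Suc i) t) (at t)"
  shows "smooth_on (\<lambda>x. e i (g x)) W"
proof -
  have dg: "g differentiable_on W" using assms(2) smooth_on_differentiable by blast
  have D: "((\<lambda>x. e i (g x)) has_derivative (\<lambda>v. e (Suc i) (g x) * partial v g x)) (at x)" if "x \<in> W" for i x
    using has_derivative_compose[OF has_derivative_partial[OF assms(1) dg that] has_field_derivative_imp_has_derivative[OF e]] .
  then have D': "(\<lambda>x. e i (g x)) differentiable_on W" for i
    unfolding differentiable_on_def differentiable_def using has_derivative_at_withinI by blast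
  have "C_k_on k (\<lambda>x. e i (g x)) W" for k
  proof (induction k arbitrary: i)
    case 0
    then show ?case using D' by (simp add: differentiable_imp_continuous_on)
  next
    case (Suc k)
    have "C_k_on k (partial b (\<lambda>x. e i (g x))) W" if "b \<in> Basis" for b
    proof -
      have "C_k_on k (\<lambda>x. e (Suc i) (g x) * partial b g x) W"
        using smooth_on_partial_Basis[OF assms(2) that] Suc by (auto intro: C_k_on_mult assms simp: smooth_on_def)
      then show ?thesis
        using C_k_on_cong[of W "partial b (\<lambda>x. e i (g x))" "\<lambda>x. e (Suc i) (g x) * partial b g x" k]
          partial_eqI[OF D] assms(1) by simp
    qed
    with D' show ?case by simp
  qed
  then show ?thesis by (simp add: smooth_on_def)
qed

lemma smooth_on_ident: "smooth_on (\<lambda>x. x) W"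
proof -
  have "partial b (\<lambda>x::'a. x) = (\<lambda>x. b)" for b :: 'a
    using partial_eqI[OF has_derivative_ident] by blast
  then have "C_k_on k (\<lambda>x. x) W" for k
    using smooth_on_const[of _ W] by (cases k) (auto simp: smooth_on_def)
  then show ?thesis by (simp add: smooth_on_def)
qed

text \<open>The recursion is the one obtained by differentiating \<open>poly p (1 / t) * exp (- (1 / t))\<close>.\<close>

primrec exp_poly :: "nat \<Rightarrow> real poly"
  where
    "exp_poly 0 = 1"
  | "exp_poly (Suc i) = [:0, 0, 1:] * (exp_poly i - pderiv (exp_poly i))"

text \<open>The i-th derivative of the function that is exp(-1/t) for t > 0 and 0 for t \<le> 0,
  which is smooth and flat at 0.\<close>

definition exp_inv :: "nat \<Rightarrow> real \<Rightarrow> real"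
  where "exp_inv i t = (if t > 0 then poly (exp_poly i) (1 / t) * exp (- (1 / t)) else 0)"

lemma poly_times_exp_tendsto: "((\<lambda>s::real. poly p s * exp (- s)) \<longlongrightarrow> 0) at_top"
proof -
  have "((\<lambda>s. \<Sum>i\<le>degree p. coeff p i * (s ^ i / exp s)) \<longlongrightarrow> (\<Sum>i\<le>degree p. coeff p i * 0)) at_top"
    by (intro tendsto_sum tendsto_mult tendsto_const tendsto_power_div_exp_0)
  then show ?thesis
    by (simp add: poly_altdef sum_distrib_right exp_minus divide_inverse mult.assoc)
qed

lemma exp_inv_deriv: "(exp_inv i has_real_derivative exp_inv (Suc i) t) (at t)"
proof -
  consider "t > 0" | "t < 0" | "t = 0" by linarith
  then show ?thesis
  proof cases
    case 1
    have "((\<lambda>t. poly (exp_poly i) (1 / t) * exp (- (1 / t))) has_real_derivative exp_inv (Suc i) t) (at t)"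
      using 1 by (auto intro!: derivative_eq_intros poly_DERIV[THEN DERIV_chain2]
          simp: exp_inv_def field_simps power2_eq_square)
    then show ?thesis
      by (rule has_field_derivative_transform_within_open[where S = "{0<..}"]) (use 1 in \<open>auto simp: exp_inv_def\<close>)
  next
    case 2
    have "((\<lambda>t. 0) has_real_derivative exp_inv (Suc i) t) (at t)" using 2 by (simp add: exp_inv_def)
    then show ?thesis
      by (rule has_field_derivative_transform_within_open[where S = "{..<0}"]) (use 2 in \<open>auto simp: exp_inv_def\<close>)
  next
    case 3
    \<comment> \<open>With s = 1/h the right-hand difference quotient at 0 is s times
      \<open>exp_inv i h\<close>; multiplication of the polynomial by s is
      \<open>pCons 0\<close>.\<close>
    have "((\<lambda>s. poly (pCons 0 (exp_poly i)) s * exp (- s)) \<longlongrightarrow> 0) at_top" by (rule poly_times_exp_tendsto)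
    then have "((\<lambda>h. poly (pCons 0 (exp_poly i)) (inverse h) * exp (- inverse h)) \<longlongrightarrow> 0) (at_right 0)"
      by (rule filterlim_compose[OF _ filterlim_inverse_at_top_right])
    then have r: "((\<lambda>h. (exp_inv i (0 + h) - exp_inv i 0) / h) \<longlongrightarrow> 0) (at_right 0)"
      by (rule Lim_transform_eventually)
        (auto simp: exp_inv_def eventually_at_filter field_simps)
    have l: "((\<lambda>h. (exp_inv i (0 + h) - exp_inv i 0) / h) \<longlongrightarrow> 0) (at_left 0)"
      by (rule tendsto_eventually) (auto simp: exp_inv_def eventually_at_filter)
    have "((\<lambda>h. (exp_inv i (0 + h) - exp_inv i 0) / h) \<longlongrightarrow> 0) (at 0)"
      using l r by (simp add: filterlim_at_split)
    then show ?thesis unfolding 3 DERIV_def by (simp add: exp_inv_def)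
  qed
qed

text \<open>Built on \<open>x \<bullet> x\<close> rather than on \<open>norm x\<close>, which is not
  differentiable at 0.\<close>

definition bump :: "'a::euclidean_space \<Rightarrow> real"
  where "bump x = exp_inv 0 (1 - x \<bullet> x)"

lemma smooth_on_bump: "smooth_on bump UNIV"
proof -
  have s: "smooth_on (\<lambda>x::'a. x \<bullet> b) UNIV" for b
    by (rule smooth_on_linear[OF open_UNIV smooth_on_ident bounded_linear_inner_left])
  have "smooth_on (\<lambda>x::'a. 1 - (\<Sum>b\<in>Basis. (x \<bullet> b) * (x \<bullet> b))) UNIV"
    by (intro smooth_on_diff smooth_on_sum smooth_on_mult smooth_on_const s open_UNIV)
  then have "smooth_on (\<lambda>x::'a. 1 - x \<bullet> x) UNIV"
    by (simp add: euclidean_inner[symmetric])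
  from smooth_on_compose_real[OF open_UNIV this, of exp_inv 0] exp_inv_deriv show ?thesis
    by (simp add: bump_def[abs_def])
qed

lemma bump_nonneg: "bump x \<ge> 0"
  by (simp add: bump_def exp_inv_def)

lemma bump_pos_iff: "bump x > 0 \<longleftrightarrow> norm x < 1"
proof -
  have "norm x < 1 \<longleftrightarrow> x \<bullet> x < 1" by (simp add: norm_eq_sqrt_inner)
  then show ?thesis by (simp add: bump_def exp_inv_def)
qed

lemma bump_eq_0: "norm x \<ge> 1 \<Longrightarrow> bump x = 0"
  using bump_pos_iff[of x] bump_nonneg[of x] by linarith

lemma integrable_bump: "integrable lborel (bump :: 'a::euclidean_space \<Rightarrow> real)"
proof -
  have "integrable lborel (\<lambda>x::'a. indicator (cball 0 1) x *\<^sub>R bump x)"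
    by (rule borel_integrable_compact[OF compact_cball
        continuous_on_subset[OF smooth_on_continuous[OF smooth_on_bump] subset_UNIV]])
  moreover have "indicator (cball 0 1) x *\<^sub>R bump x = bump x" for x :: 'a
    using bump_eq_0[of x] by (cases "norm x \<le> 1") (simp_all add: indicator_def)
  ultimately show ?thesis by (simp only:)
qed

text \<open>A nonnegative function with integral 0 vanishes almost everywhere, whereas
  \<open>bump\<close> is positive on a ball, which is not a null set.\<close>

lemma integral_bump_pos: "integral\<^sup>L lborel (bump :: 'a::euclidean_space \<Rightarrow> real) > 0"
proof -
  have "integral\<^sup>L lborel (bump :: 'a \<Rightarrow> real) \<noteq> 0"
  proof
    assume "integral\<^sup>L lborel (bump :: 'a \<Rightarrow> real) = 0"
    then have "AE x in lborel. bump (x::'a) = 0"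
      using integral_nonneg_eq_0_iff_AE[OF integrable_bump[where 'a = 'a]] by (simp add: bump_nonneg)
    then have "AE x in lborel. (x::'a) \<notin> ball 0 1"
      by (rule AE_mp) (use bump_pos_iff in \<open>auto intro!: AE_I2 simp: less_le\<close>)
    then have "ball (0::'a) 1 \<in> null_sets lborel"
      using AE_iff_null_sets[of "ball (0::'a) 1" lborel] by simp
    then have "negligible (ball (0::'a) 1)"
      by (simp add: negligible_iff_null_sets null_sets_completionI)
    then show False using open_not_negligible[of "ball (0::'a) 1"] by simp
  qed
  moreover have "integral\<^sup>L lborel (bump :: 'a \<Rightarrow> real) \<ge> 0" by (simp add: bump_nonneg)
  ultimately show ?thesis by linarith
qed

definition mollifier :: "'a::euclidean_space \<Rightarrow> real"
  where "mollifier x = bump x / integral\<^sup>L lborel (bump :: 'a \<Rightarrow> real)"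

lemma smooth_on_mollifier: "smooth_on mollifier UNIV"
  using smooth_on_scaleR[OF open_UNIV smooth_on_bump, of "1 / integral\<^sup>L lborel (bump :: 'a \<Rightarrow> real)"]
  by (simp add: mollifier_def[abs_def])

lemma mollifier_nonneg: "mollifier (x :: 'a::euclidean_space) \<ge> 0"
  using bump_nonneg[of x] integral_bump_pos[where 'a = 'a] by (simp add: mollifier_def divide_nonneg_pos)

text \<open>This constant is, up to the embedding of the reals, the value of the annihilating kernel
  at its centre, and so the reason that it is not negligible.\<close>

lemma mollifier_pos: "mollifier (0 :: 'a::euclidean_space) > 0"
  using bump_pos_iff[of "0 :: 'a"] integral_bump_pos[where 'a = 'a] by (simp add: mollifier_def divide_pos_pos)

lemma mollifier_eq_0: "norm x \<ge> 1 \<Longrightarrow> mollifier x = 0"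
  by (simp add: mollifier_def bump_eq_0)

lemma integral_mollifier: "(LINT z:cball (0::'a::euclidean_space) 1|lborel. mollifier z) = 1"
proof -
  have "indicator (cball 0 1) x *\<^sub>R mollifier x = bump x / integral\<^sup>L lborel (bump :: 'a \<Rightarrow> real)" for x :: 'a
    using bump_eq_0[of x] by (cases "norm x \<le> 1") (simp_all add: indicator_def mollifier_def)
  then show ?thesis using integral_bump_pos[where 'a = 'a] by (simp add: set_lebesgue_integral_def)
qed

section \<open>Nets and their classes\<close>

text \<open>A uniform O-estimate on K with the supremum replaced by pointwise bounds. It is
  meaningful for empty K and for any set K, so it passes freely to subsets, finite unions and nets
  that agree near K.\<close>

definition net_bound ::
    "'a::euclidean_space set \<Rightarrow> 'a list \<Rightarrow> ('a, 'k::real_normed_vector) net \<Rightarrow> (real \<Rightarrow> real) \<Rightarrow> bool"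
  where "net_bound K ws u g \<longleftrightarrow>
    (\<exists>C. \<forall>\<^sub>F e in at_right 0. \<forall>x\<in>K. norm (iter_partial ws (u e) x) \<le> C * g e)"

lemma eventually_unit_interval: "\<forall>\<^sub>F e::real in at_right 0. e \<in> {0<..1}"
  using eventually_at_right_real[of 0 1] by (rule eventually_mono) auto

lemma net_boundE:
  assumes "net_bound K ws u g" "\<And>e. 0 < e \<Longrightarrow> 0 \<le> g e"
  obtains C where "C \<ge> 0"
    "\<forall>\<^sub>F e in at_right 0. e \<in> {0<..1} \<and> (\<forall>x\<in>K. norm (iter_partial ws (u e) x) \<le> C * g e)"
proof -
  from assms(1) obtain C where
    "\<forall>\<^sub>F e in at_right 0. \<forall>x\<in>K. norm (iter_partial ws (u e) x) \<le> C * g e"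
    unfolding net_bound_def by blast
  with eventually_unit_interval
  have "\<forall>\<^sub>F e in at_right 0. e \<in> {0<..1} \<and> (\<forall>x\<in>K. norm (iter_partial ws (u e) x) \<le> \<bar>C\<bar> * g e)"
  proof eventually_elim
    case (elim e)
    have "C * g e \<le> \<bar>C\<bar> * g e" using assms(2)[of e] elim(1) by (intro mult_right_mono) auto
    with elim show ?case by force
  qed
  then show thesis using that[of "\<bar>C\<bar>"] by simp
qed

lemma net_bound_diff:
  assumes "open W" "u \<in> smooth_nets W" "v \<in> smooth_nets W" "K \<subseteq> W"
    and "net_bound K ws u g" "net_bound K ws v g"
  shows "net_bound K ws (\<lambda>e x. u e x - v e x) g"
proof -
  from assms(5,6) obtain C D where
    C: "\<forall>\<^sub>F e in at_right 0. \<forall>x\<in>K. norm (iter_partial ws (u e) x) \<le> C * g e" and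
    D: "\<forall>\<^sub>F e in at_right 0. \<forall>x\<in>K. norm (iter_partial ws (v e) x) \<le> D * g e"
    unfolding net_bound_def by blast
  have "\<forall>\<^sub>F e in at_right 0. \<forall>x\<in>K. norm (iter_partial ws (\<lambda>x. u e x - v e x) x) \<le> (C + D) * g e"
    using C D eventually_unit_interval
  proof eventually_elim
    case (elim e)
    show ?case
    proof
      fix x assume x: "x \<in> K"
      have "iter_partial ws (\<lambda>x. u e x - v e x) x = iter_partial ws (u e) x - iter_partial ws (v e) x"
        using assms elim(3) x by (intro iter_partial_diff[of W]) (auto simp: smooth_nets_def)
      also have "norm \<dots> \<le> (C + D) * g e"
        unfolding distrib_right using elim x
        by (intro order_trans[OF norm_triangle_ineq4] add_mono) auto
      finally show "norm (iter_partial ws (\<lambda>x. u e x - v e x) x) \<le> (C + D) * g e" .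
    qed
  qed
  then show ?thesis unfolding net_bound_def by blast
qed

lemma net_bound_zero: "net_bound K ws (\<lambda>e x. 0) g"
  unfolding net_bound_def iter_partial_zero by (rule exI[of _ 0]) simp

lemma net_bound_add:
  fixes u v :: "('a::euclidean_space, 'k::real_normed_vector) net"
  assumes "open W" "u \<in> smooth_nets W" "v \<in> smooth_nets W" "K \<subseteq> W"
    and "net_bound K ws u g" "net_bound K ws v g"
  shows "net_bound K ws (\<lambda>e x. u e x + v e x) g"
proof -
  have z: "(\<lambda>e x. 0 :: 'k) \<in> smooth_nets W" by (simp add: smooth_nets_def smooth_on_const)
  have m: "(\<lambda>e x. 0 - v e x) \<in> smooth_nets W"
    using assms(1,3) unfolding smooth_nets_def by (auto intro!: smooth_on_diff simp del: diff_0 simp: smooth_on_const)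
  show ?thesis
    using net_bound_diff[OF assms(1,2) m assms(4,5) net_bound_diff[OF assms(1) z assms(3,4) net_bound_zero assms(6)]]
    by simp
qed

lemma net_bound_mono:
  assumes "net_bound K ws u g" "\<And>e. e \<in> {0<..1} \<Longrightarrow> 0 \<le> g e \<and> g e \<le> h e"
  shows "net_bound K ws u h"
proof -
  from assms(1) obtain C where
    "\<forall>\<^sub>F e in at_right 0. \<forall>x\<in>K. norm (iter_partial ws (u e) x) \<le> C * g e"
    unfolding net_bound_def by blast
  with eventually_unit_interval
  have "\<forall>\<^sub>F e in at_right 0. \<forall>x\<in>K. norm (iter_partial ws (u e) x) \<le> \<bar>C\<bar> * h e"
  proof eventually_elim
    case (elim e)
    have "C * g e \<le> \<bar>C\<bar> * h e" using assms(2)[OF elim(1)] by (intro mult_mono) auto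
    with elim show ?case by force
  qed
  then show ?thesis unfolding net_bound_def by blast
qed

text \<open>Derivatives on K only see values near K, and the neighbourhood may vary with e. This is
  applied where a kernel vanishes, or two integrals coincide, only once e is small.\<close>

lemma net_bound_eventually_cong:
  assumes "\<forall>\<^sub>F e in at_right 0. \<exists>O'. open O' \<and> K \<subseteq> O' \<and> (\<forall>x\<in>O'. u e x = v e x)" "net_bound K ws v g"
  shows "net_bound K ws u g"
proof -
  from assms(2) obtain C where
    "\<forall>\<^sub>F e in at_right 0. \<forall>x\<in>K. norm (iter_partial ws (v e) x) \<le> C * g e"
    unfolding net_bound_def by blast
  with assms(1)
  have "\<forall>\<^sub>F e in at_right 0. \<forall>x\<in>K. norm (iter_partial ws (u e) x) \<le> C * g e"
  proof eventually_elim
    case (elim e)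
    then obtain O' where "open O'" "K \<subseteq> O'" "\<forall>x\<in>O'. u e x = v e x" by blast
    then have "iter_partial ws (u e) x = iter_partial ws (v e) x" if "x \<in> K" for x
      using iter_partial_cong[of O' "u e" "v e" x] that by blast
    with elim(2) show ?case by simp
  qed
  then show ?thesis unfolding net_bound_def by blast
qed

lemma net_bound_cong:
  assumes "open W" "K \<subseteq> W" "\<And>e x. e \<in> {0<..1} \<Longrightarrow> x \<in> W \<Longrightarrow> u e x = v e x" "net_bound K ws v g"
  shows "net_bound K ws u g"
proof (rule net_bound_eventually_cong[OF _ assms(4)])
  show "\<forall>\<^sub>F e in at_right 0. \<exists>V. open V \<and> K \<subseteq> V \<and> (\<forall>x\<in>V. u e x = v e x)"
    using eventually_unit_interval by (rule eventually_mono) (use assms(1-3) in blast)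
qed

lemma net_bound_Un:
  assumes "net_bound K ws u g" "net_bound L ws u g" "\<And>e. 0 < e \<Longrightarrow> 0 \<le> g e"
  shows "net_bound (K \<union> L) ws u g"
proof -
  obtain C where C: "\<forall>\<^sub>F e in at_right 0. e \<in> {0<..1} \<and> (\<forall>x\<in>K. norm (iter_partial ws (u e) x) \<le> C * g e)"
    by (rule net_boundE[OF assms(1)]) (use assms(3) in blast)+
  obtain D where D: "\<forall>\<^sub>F e in at_right 0. e \<in> {0<..1} \<and> (\<forall>x\<in>L. norm (iter_partial ws (u e) x) \<le> D * g e)"
    by (rule net_boundE[OF assms(2)]) (use assms(3) in blast)+
  from C D have "\<forall>\<^sub>F e in at_right 0. \<forall>x\<in>K \<union> L. norm (iter_partial ws (u e) x) \<le> max C D * g e"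
  proof eventually_elim
    case (elim e)
    have "C * g e \<le> max C D * g e" "D * g e \<le> max C D * g e"
      using assms(3)[of e] elim(1) by (auto intro: mult_right_mono)
    with elim show ?case by force
  qed
  then show ?thesis unfolding net_bound_def by blast
qed

lemma net_bound_finite_Union:
  assumes "finite F" "\<And>K. K \<in> F \<Longrightarrow> net_bound K ws u g" "\<And>e. 0 < e \<Longrightarrow> 0 \<le> g e"
  shows "net_bound (\<Union>F) ws u g"
  using assms(1,2)
proof (induction F)
  case empty
  then show ?case by (simp add: net_bound_def)
next
  case (insert K F)
  then show ?case using net_bound_Un[of K ws u g "\<Union>F"] assms(3) by simp
qed

lemma net_bound_subset:
  assumes "net_bound L ws u g" "K \<subseteq> L"
  shows "net_bound K ws u g"
proof -
  from assms(1) obtain C where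
    "\<forall>\<^sub>F e in at_right 0. \<forall>x\<in>L. norm (iter_partial ws (u e) x) \<le> C * g e"
    unfolding net_bound_def by blast
  then have "\<forall>\<^sub>F e in at_right 0. \<forall>x\<in>K. norm (iter_partial ws (u e) x) \<le> C * g e"
    by (rule eventually_mono) (use assms(2) in blast)
  then show ?thesis unfolding net_bound_def by blast
qed

text \<open>The bridge from \<open>deriv_sup\<close> to \<open>net_bound\<close>. Compactness of K
  and continuity of the derivative make the set of values bounded, without which the supremum would
  say nothing.\<close>

lemma deriv_sup_bigo_iff:
  fixes u :: "('a::euclidean_space, 'k::real_normed_vector) net"
  assumes "open W" "u \<in> smooth_nets W" "compact K" "K \<noteq> {}" "K \<subseteq> W" "\<And>e. 0 < e \<Longrightarrow> 0 < g e"
  shows "deriv_sup K \<alpha> u \<in> O[at_right 0](g) \<longleftrightarrow>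
    net_bound K (concat (map (\<lambda>b. replicate (\<alpha> b) b) basis_enum)) u g"
proof -
  let ?w = "concat (map (\<lambda>b. replicate (\<alpha> b) b) basis_enum)"
  have le_iff: "deriv_sup K \<alpha> u e \<le> c \<longleftrightarrow> (\<forall>x\<in>K. norm (iter_partial ?w (u e) x) \<le> c)"
    and ge: "deriv_sup K \<alpha> u e \<ge> 0" if "e \<in> {0<..1}" for e c
  proof -
    have "smooth_on (iter_partial ?w (u e)) W"
      using assms that by (auto simp: smooth_nets_def intro: smooth_on_iter_partial)
    then have "continuous_on K (\<lambda>x. norm (iter_partial ?w (u e) x))"
      using smooth_on_continuous continuous_on_subset assms(5) continuous_on_norm by blast
    then have bdd: "bdd_above ((\<lambda>x. norm (iter_partial ?w (u e) x)) ` K)"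
      by (intro bounded_imp_bdd_above compact_imp_bounded compact_continuous_image assms(3))
    show "deriv_sup K \<alpha> u e \<le> c \<longleftrightarrow> (\<forall>x\<in>K. norm (iter_partial ?w (u e) x) \<le> c)"
      unfolding deriv_sup_def multi_deriv_eq_iter_partial using cSUP_le_iff[OF assms(4) bdd] .
    obtain x where "x \<in> K" using assms(4) by blast
    show "deriv_sup K \<alpha> u e \<ge> 0"
      unfolding deriv_sup_def multi_deriv_eq_iter_partial
      by (rule cSUP_upper2[OF bdd \<open>x \<in> K\<close>]) simp
  qed
  show ?thesis
  proof
    assume "deriv_sup K \<alpha> u \<in> O[at_right 0](g)"
    then obtain c where "\<forall>\<^sub>F e in at_right 0. norm (deriv_sup K \<alpha> u e) \<le> c * norm (g e)"
      using landau_o.bigE by blast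
    with eventually_unit_interval
    have "\<forall>\<^sub>F e in at_right 0. \<forall>x\<in>K. norm (iter_partial ?w (u e) x) \<le> c * g e"
    proof eventually_elim
      case (elim e)
      then have "deriv_sup K \<alpha> u e \<le> c * g e" using assms(6)[of e] by auto
      then show ?case using le_iff elim(1) by blast
    qed
    then show "net_bound K ?w u g" unfolding net_bound_def by blast
  next
    assume "net_bound K ?w u g"
    then obtain c where c: "\<forall>\<^sub>F e in at_right 0. \<forall>x\<in>K. norm (iter_partial ?w (u e) x) \<le> c * g e"
      unfolding net_bound_def by blast
    \<comment> \<open>The constant c may be 0 or negative, while the Landau constant has to be
      positive; hence \<open>\<bar>c\<bar> + 1\<close>.\<close>
    show "deriv_sup K \<alpha> u \<in> O[at_right 0](g)"
    proof (rule landau_o.bigI[where c = "\<bar>c\<bar> + 1"])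
      show "\<forall>\<^sub>F e in at_right 0. norm (deriv_sup K \<alpha> u e) \<le> (\<bar>c\<bar> + 1) * norm (g e)"
        using c eventually_unit_interval
      proof eventually_elim
        case (elim e)
        have "deriv_sup K \<alpha> u e \<le> c * g e" using le_iff elim by blast
        also have "\<dots> \<le> (\<bar>c\<bar> + 1) * g e" using assms(6)[of e] elim by (intro mult_right_mono) auto
        finally show ?case using ge[of e] assms(6)[of e] elim by simp
      qed
    qed simp
  qed
qed

lemma net_bound_multi_index:
  assumes "open W" "u \<in> smooth_nets W" "K \<subseteq> W" "set ws \<subseteq> Basis"
    and "net_bound K (concat (map (\<lambda>b. replicate (count (mset ws) b) b) basis_enum)) u g"
  shows "net_bound K ws u g"
proof -
  from assms(5) obtain C where
    "\<forall>\<^sub>F e in at_right 0. \<forall>x\<in>K. norm (multi_deriv (count (mset ws)) (u e) x) \<le> C * g e"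
    unfolding net_bound_def multi_deriv_eq_iter_partial by blast
  with eventually_unit_interval
  have "\<forall>\<^sub>F e in at_right 0. \<forall>x\<in>K. norm (iter_partial ws (u e) x) \<le> C * g e"
  proof eventually_elim
    case (elim e)
    then show ?case using iter_partial_eq_multi_deriv[OF assms(1) _ assms(4), of "u e"] assms(2,3)
      by (auto simp: smooth_nets_def)
  qed
  then show ?thesis unfolding net_bound_def by blast
qed

lemma net_bound_of_deriv_sup:
  assumes "open W" "u \<in> smooth_nets W" "compact K" "K \<subseteq> W" "set ws \<subseteq> Basis" "\<And>e. 0 < e \<Longrightarrow> 0 < g e"
    and "K \<noteq> {} \<Longrightarrow> deriv_sup K (count (mset ws)) u \<in> O[at_right 0](g)"
  shows "net_bound K ws u g"
proof (cases "K = {}")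
  case False
  then show ?thesis
    using net_bound_multi_index[OF assms(1,2,4,5)] assms(6,7)
      deriv_sup_bigo_iff[OF assms(1,2,3) False assms(4), of g "count (mset ws)"] by simp
qed (simp add: net_bound_def)

lemma negligible_nets_iff:
  assumes "open W"
  shows "u \<in> negligible_nets W \<longleftrightarrow> u \<in> smooth_nets W \<and>
    (\<forall>K ws q. compact K \<and> K \<subseteq> W \<and> set ws \<subseteq> Basis \<longrightarrow> net_bound K ws u (\<lambda>e. e ^ q))"
    (is "_ \<longleftrightarrow> _ \<and> ?R")
proof (cases "u \<in> smooth_nets W")
  case True
  have "net_bound K ws u (\<lambda>e. e ^ q)"
    if "u \<in> negligible_nets W" "compact K" "K \<subseteq> W" "set ws \<subseteq> Basis" for K ws q
    using that by (intro net_bound_of_deriv_sup[OF assms True]) (auto simp: negligible_nets_def)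
  moreover have "u \<in> negligible_nets W" if R: ?R
    unfolding negligible_nets_def
  proof (intro CollectI conjI True allI impI)
    fix K \<alpha> q assume K: "compact K \<and> K \<noteq> {} \<and> K \<subseteq> W"
    then show "deriv_sup K \<alpha> u \<in> O[at_right 0](\<lambda>e. e ^ q)"
      using R[rule_format, of K] set_multi_deriv_word[of \<alpha>]
        deriv_sup_bigo_iff[OF assms True, of K "\<lambda>e. e ^ q" \<alpha>] by simp
  qed
  ultimately show ?thesis using True by blast
qed (simp add: negligible_nets_def)

lemma moderate_nets_iff:
  assumes "open W"
  shows "u \<in> moderate_nets W \<longleftrightarrow> u \<in> smooth_nets W \<and>
    (\<forall>K ws. compact K \<and> K \<subseteq> W \<and> set ws \<subseteq> Basis \<longrightarrow> (\<exists>N::nat. net_bound K ws u (\<lambda>e. e powr (- real N))))"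
    (is "_ \<longleftrightarrow> _ \<and> ?R")
proof (cases "u \<in> smooth_nets W")
  case True
  have "\<exists>N::nat. net_bound K ws u (\<lambda>e. e powr (- real N))"
    if h: "u \<in> moderate_nets W" "compact K" "K \<subseteq> W" "set ws \<subseteq> Basis" for K ws
  proof -
    obtain N :: nat where "K \<noteq> {} \<longrightarrow> deriv_sup K (count (mset ws)) u \<in> O[at_right 0](\<lambda>e. e powr (- real N))"
      using h unfolding moderate_nets_def by blast
    then show ?thesis
      using net_bound_of_deriv_sup[OF assms True h(2-4), of "\<lambda>e. e powr (- real N)"] by auto
  qed
  moreover have "u \<in> moderate_nets W" if R: ?R
    unfolding moderate_nets_def
  proof (intro CollectI conjI True allI impI)
    fix K \<alpha> assume K: "compact K \<and> K \<noteq> {} \<and> K \<subseteq> W"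
    have "\<exists>N::nat. net_bound K (concat (map (\<lambda>b. replicate (\<alpha> b) b) basis_enum)) u (\<lambda>e. e powr (- real N))"
      by (rule R[rule_format]) (use K set_multi_deriv_word[of \<alpha>] in simp)
    then obtain N :: nat where
      "net_bound K (concat (map (\<lambda>b. replicate (\<alpha> b) b) basis_enum)) u (\<lambda>e. e powr (- real N))" ..
    then have "deriv_sup K \<alpha> u \<in> O[at_right 0](\<lambda>e. e powr (- real N))"
      using deriv_sup_bigo_iff[OF assms True, of K "\<lambda>e. e powr (- real N)" \<alpha>] K by simp
    then show "\<exists>N::nat. deriv_sup K \<alpha> u \<in> O[at_right 0](\<lambda>e. e powr (- real N))" ..
  qed
  ultimately show ?thesis using True by blast
qed (simp add: moderate_nets_def)

lemma regular_nets_bound: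
  assumes "open W" "u \<in> regular_nets W" "compact K" "K \<subseteq> W"
  obtains N :: nat where "\<And>ws. set ws \<subseteq> Basis \<Longrightarrow> net_bound K ws u (\<lambda>e. e powr (- real N))"
proof (cases "K = {}")
  case False
  have s: "u \<in> smooth_nets W" using assms by (simp add: regular_nets_def)
  obtain N :: nat where N: "\<And>\<alpha>. deriv_sup K \<alpha> u \<in> O[at_right 0](\<lambda>e. e powr (- real N))"
    using assms False unfolding regular_nets_def by blast
  have "net_bound K ws u (\<lambda>e. e powr (- real N))" if "set ws \<subseteq> Basis" for ws
    using N net_bound_of_deriv_sup[OF assms(1) s assms(3,4) that, of "\<lambda>e. e powr (- real N)"] by simp
  then show thesis by (rule that)
qed (use that in \<open>auto simp: net_bound_def\<close>)

section \<open>Restriction, sums and equivalence of nets\<close>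

lemma smooth_nets_subset: "open V \<Longrightarrow> V \<subseteq> W \<Longrightarrow> u \<in> smooth_nets W \<Longrightarrow> u \<in> smooth_nets V"
  by (auto simp: smooth_nets_def intro: smooth_on_subset)

lemma smooth_nets_add:
  "open W \<Longrightarrow> u \<in> smooth_nets W \<Longrightarrow> v \<in> smooth_nets W \<Longrightarrow> (\<lambda>e x. u e x + v e x) \<in> smooth_nets W"
  by (auto simp: smooth_nets_def intro: smooth_on_add)

lemma smooth_nets_diff:
  "open W \<Longrightarrow> u \<in> smooth_nets W \<Longrightarrow> v \<in> smooth_nets W \<Longrightarrow> (\<lambda>e x. u e x - v e x) \<in> smooth_nets W"
  by (auto simp: smooth_nets_def intro: smooth_on_diff)

lemma negligible_nets_add:
  assumes "open W" "u \<in> negligible_nets W" "v \<in> negligible_nets W"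
  shows "(\<lambda>e x. u e x + v e x) \<in> negligible_nets W"
  using assms(2,3) unfolding negligible_nets_iff[OF assms(1)]
  by (auto intro: smooth_nets_add net_bound_add assms(1))

lemma negligible_nets_diff:
  assumes "open W" "u \<in> negligible_nets W" "v \<in> negligible_nets W"
  shows "(\<lambda>e x. u e x - v e x) \<in> negligible_nets W"
  using assms(2,3) unfolding negligible_nets_iff[OF assms(1)]
  by (auto intro: smooth_nets_diff net_bound_diff assms(1))

lemma negligible_nets_subset:
  "open V \<Longrightarrow> V \<subseteq> W \<Longrightarrow> u \<in> negligible_nets W \<Longrightarrow> u \<in> negligible_nets V"
  unfolding negligible_nets_def using smooth_nets_subset[of V W u] by (simp add: subset_trans[of _ V W])

lemma moderate_nets_subset:
  "open V \<Longrightarrow> V \<subseteq> W \<Longrightarrow> u \<in> moderate_nets W \<Longrightarrow> u \<in> moderate_nets V"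
  unfolding moderate_nets_def using smooth_nets_subset[of V W u] by (simp add: subset_trans[of _ V W])

lemma regular_imp_moderate: "u \<in> regular_nets W \<Longrightarrow> u \<in> moderate_nets W"
  unfolding regular_nets_def moderate_nets_def by blast

lemma negligible_zero: "(\<lambda>e x. 0) \<in> negligible_nets W"
  unfolding negligible_nets_def smooth_nets_def deriv_sup_def multi_deriv_eq_iter_partial
  by (auto simp: smooth_on_const iter_partial_zero)

lemma negligible_bound_powr:
  assumes "open W" "u \<in> negligible_nets W" "compact K" "K \<subseteq> W" "set ws \<subseteq> Basis"
  shows "net_bound K ws u (\<lambda>e. e powr (- real N))"
proof (rule net_bound_mono)
  show "net_bound K ws u (\<lambda>e. e ^ 0)" using assms negligible_nets_iff by blast
  show "0 \<le> e ^ 0 \<and> e ^ 0 \<le> e powr (- real N)" if "e \<in> {0<..1}" for e :: real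
    using powr_mono'[of "- real N" 0 e] that by simp
qed

lemma moderate_add_negligible:
  assumes "open W" "u \<in> moderate_nets W" "v \<in> negligible_nets W"
  shows "(\<lambda>e x. u e x + v e x) \<in> moderate_nets W"
proof -
  have s: "u \<in> smooth_nets W" "v \<in> smooth_nets W"
    using assms by (auto simp: moderate_nets_def negligible_nets_def)
  have "\<exists>N. net_bound K ws (\<lambda>e x. u e x + v e x) (\<lambda>e. e powr (- real N))"
    if "compact K" "K \<subseteq> W" "set ws \<subseteq> Basis" for K ws
    using net_bound_add[OF assms(1) s that(2)] negligible_bound_powr[OF assms(1,3) that] assms(2) that
    unfolding moderate_nets_iff[OF assms(1)] by blast
  then show ?thesis using s assms(1) by (auto simp: moderate_nets_iff smooth_nets_add)
qed

lemma negligible_imp_moderate: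
  assumes "open W" "u \<in> negligible_nets W"
  shows "u \<in> moderate_nets W"
proof -
  have "u \<in> smooth_nets W" using assms by (simp add: negligible_nets_def)
  then show ?thesis unfolding moderate_nets_iff[OF assms(1)] using negligible_bound_powr[OF assms] by blast
qed

lemma net_rel_sym:
  assumes "open W" "(u, v) \<in> net_rel W" shows "(v, u) \<in> net_rel W"
  using assms negligible_nets_diff[OF assms(1) negligible_zero, of "\<lambda>e x. u e x - v e x"]
  by (simp add: net_rel_def)

lemma net_rel_trans:
  assumes "open W" "(u, v) \<in> net_rel W" "(v, w) \<in> net_rel W" shows "(u, w) \<in> net_rel W"
  using assms negligible_nets_add[OF assms(1), of "\<lambda>e x. u e x - v e x" "\<lambda>e x. v e x - w e x"]
  by (simp add: net_rel_def)

lemma net_rel_refl: "u \<in> moderate_nets W \<Longrightarrow> (u, u) \<in> net_rel W"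
  by (simp add: net_rel_def negligible_zero)

lemma net_relI:
  assumes "open W" "u \<in> moderate_nets W" "(\<lambda>e x. v e x - u e x) \<in> negligible_nets W"
  shows "(u, v) \<in> net_rel W"
proof -
  have "v \<in> moderate_nets W" using moderate_add_negligible[OF assms] by simp
  with assms have "(v, u) \<in> net_rel W" by (simp add: net_rel_def)
  then show ?thesis using net_rel_sym assms(1) by blast
qed

lemma net_rel_subset:
  "open V \<Longrightarrow> V \<subseteq> W \<Longrightarrow> (u, v) \<in> net_rel W \<Longrightarrow> (u, v) \<in> net_rel V"
  by (auto simp: net_rel_def intro: moderate_nets_subset negligible_nets_subset)

text \<open>Operations on classes are defined by applying them to all representatives and collecting
  the equivalent nets. If every result is equivalent to one net \<open>a\<close>, what is collected
  is exactly the class of \<open>a\<close>.\<close>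

lemma net_rel_Image_eq:
  assumes "open W" "X \<noteq> {}" "\<And>x. x \<in> X \<Longrightarrow> (a, x) \<in> net_rel W"
  shows "net_rel W `` X = net_rel W `` {a}"
proof
  show "net_rel W `` X \<subseteq> net_rel W `` {a}"
    using assms(3) net_rel_trans[OF assms(1)] by blast
  obtain x where "x \<in> X" using assms(2) by blast
  then show "net_rel W `` {a} \<subseteq> net_rel W `` X"
    using net_rel_sym[OF assms(1) assms(3)] net_rel_trans[OF assms(1)] by blast
qed

lemma negligible_nets_cong:
  assumes "open W" "v \<in> negligible_nets W" "\<And>e x. e \<in> {0<..1} \<Longrightarrow> x \<in> W \<Longrightarrow> u e x = v e x"
  shows "u \<in> negligible_nets W"
proof -
  have "u \<in> smooth_nets W"
    unfolding smooth_nets_def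
  proof (intro CollectI ballI)
    fix e :: real assume e: "e \<in> {0<..1}"
    then have "smooth_on (v e) W" using assms(2) by (simp add: negligible_nets_def smooth_nets_def)
    then show "smooth_on (u e) W" using smooth_on_cong[OF assms(1), of "u e" "v e"] assms(3) e by blast
  qed
  moreover have "net_bound K ws u (\<lambda>e. e ^ q)" if "compact K" "K \<subseteq> W" "set ws \<subseteq> Basis" for K ws q
    using net_bound_cong[where u = u and v = v, OF assms(1) that(2) assms(3)] assms(2) that
    unfolding negligible_nets_iff[OF assms(1)] by blast
  ultimately show ?thesis unfolding negligible_nets_iff[OF assms(1)] by blast
qed

section \<open>Restriction and support in terms of a representative\<close>

lemma gen_restrict_class:
  assumes "open V" "open W" "V \<subseteq> W" "u0 \<in> moderate_nets W"
  shows "gen_restrict V (net_rel W `` {u0}) = net_rel V `` {u0}"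
  unfolding gen_restrict_def
  by (rule net_rel_Image_eq) (use assms net_rel_refl net_rel_subset in blast)+

lemma gen_restrict_eq_zero_iff:
  fixes u0 :: "('a::euclidean_space, 'k::real_normed_vector) net"
  assumes "open V" "open W" "V \<subseteq> W" "u0 \<in> moderate_nets W"
  shows "gen_restrict V (net_rel W `` {u0}) = gen_zero V \<longleftrightarrow> u0 \<in> negligible_nets V"
proof -
  have m: "u0 \<in> moderate_nets V" using assms moderate_nets_subset by blast
  have z: "(\<lambda>e x. 0 :: 'k) \<in> moderate_nets V" using negligible_imp_moderate assms(1) negligible_zero by blast
  have "net_rel V `` {u0} = net_rel V `` {\<lambda>e x. 0} \<longleftrightarrow> (u0, \<lambda>e x. 0) \<in> net_rel V"
    using net_rel_refl[OF m] net_rel_refl[OF z] net_rel_sym[OF assms(1)] net_rel_trans[OF assms(1)] by blast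
  also have "\<dots> \<longleftrightarrow> u0 \<in> negligible_nets V" unfolding net_rel_def using m z by simp
  finally show ?thesis unfolding gen_restrict_class[OF assms] gen_zero_def .
qed

lemma gen_supp_class:
  assumes "open W" "u0 \<in> moderate_nets W"
  shows "gen_supp W (net_rel W `` {u0}) = W - \<Union>{V. open V \<and> V \<subseteq> W \<and> u0 \<in> negligible_nets V}"
  unfolding gen_supp_def using gen_restrict_eq_zero_iff[OF _ assms(1) _ assms(2)] by blast

text \<open>Off the support each point has a neighbourhood on which u0 is negligible, and
  compactness of C leaves finitely many of them to consider.\<close>

lemma negligible_bound_off_supp:
  assumes "open W" "u0 \<in> moderate_nets W" "compact C" "C \<subseteq> W"
    and "C \<inter> gen_supp W (net_rel W `` {u0}) = {}" "set ws \<subseteq> Basis"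
  shows "net_bound C ws u0 (\<lambda>e. e ^ q)"
proof -
  \<comment> \<open>Closed balls, because negligibility gives bounds on compact sets only; the open
    balls of the same radii form the cover.\<close>
  have "\<exists>d>0. \<exists>V. open V \<and> u0 \<in> negligible_nets V \<and> cball x d \<subseteq> V" if "x \<in> C" for x
  proof -
    obtain V where "open V" "u0 \<in> negligible_nets V" "x \<in> V"
    proof -
      have "x \<in> \<Union>{V. open V \<and> V \<subseteq> W \<and> u0 \<in> negligible_nets V}"
        using \<open>x \<in> C\<close> assms(4,5) unfolding gen_supp_class[OF assms(1,2)] by auto
      then show thesis using that by auto
    qed
    moreover from this obtain d where "d > 0" "cball x d \<subseteq> V" using open_contains_cball[of V] by auto
    ultimately show ?thesis by blast
  qed
  then obtain d V where d: "\<And>x. x \<in> C \<Longrightarrow> d x > 0 \<and> open (V x) \<and> u0 \<in> negligible_nets (V x) \<and> cball x (d x) \<subseteq> V x"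
    by metis
  have "C \<subseteq> (\<Union>x\<in>C. ball x (d x))" using d by auto
  then obtain D where D: "D \<subseteq> C" "finite D" "C \<subseteq> (\<Union>x\<in>D. ball x (d x))"
    using compactE_image[OF assms(3), of C "\<lambda>x. ball x (d x)"] by auto
  have "net_bound (\<Union>((\<lambda>x. cball x (d x)) ` D)) ws u0 (\<lambda>e. e ^ q)"
  proof (rule net_bound_finite_Union)
    fix K assume "K \<in> (\<lambda>x. cball x (d x)) ` D"
    then obtain x where "x \<in> C" "K = cball x (d x)" using D by blast
    then show "net_bound K ws u0 (\<lambda>e. e ^ q)"
      using d[of x] negligible_nets_iff[of "V x" u0] assms(6) by auto
  qed (use D in auto)
  moreover have "C \<subseteq> \<Union>((\<lambda>x. cball x (d x)) ` D)" using D(3) by force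
  ultimately show ?thesis using net_bound_subset by blast
qed

section \<open>Slices of nets on a product\<close>

lemma iter_partial_slice:
  assumes "open V" "open W" "smooth_on w (V \<times> W)" "x \<in> V" "y \<in> W"
  shows "iter_partial ws (\<lambda>y. w (x, y)) y = iter_partial (map (\<lambda>b. (0, b)) ws) w (x, y)"
  using iter_partial_affine[of "\<lambda>b. (0, b)" "V \<times> W" W "(x, 0)" w y ws] assms
  by (simp add: open_Times bounded_linear_Pair bounded_linear_zero bounded_linear_ident)

lemma iter_partial_slice_fst:
  assumes "open V" "open W" "smooth_on w (V \<times> W)" "x \<in> V" "y \<in> W"
  shows "iter_partial ws (\<lambda>x. w (x, y)) x = iter_partial (map (\<lambda>b. (b, 0)) ws) w (x, y)"
  using iter_partial_affine[of "\<lambda>b. (b, 0)" "V \<times> W" V "(0, y)" w x ws] assms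
  by (simp add: open_Times bounded_linear_Pair bounded_linear_zero bounded_linear_ident)

lemma smooth_on_slice:
  assumes "open V" "open W" "smooth_on w (V \<times> W)" "x \<in> V"
  shows "smooth_on (\<lambda>y. w (x, y)) W"
  using smooth_on_affine[of "\<lambda>b. (0, b)" "V \<times> W" W "(x, 0)" w] assms
  by (simp add: open_Times bounded_linear_Pair bounded_linear_zero bounded_linear_ident)

lemma smooth_on_slice_fst:
  assumes "open V" "open W" "smooth_on w (V \<times> W)" "y \<in> W"
  shows "smooth_on (\<lambda>x. w (x, y)) V"
  using smooth_on_affine[of "\<lambda>b. (b, 0)" "V \<times> W" V "(0, y)" w] assms
  by (simp add: open_Times bounded_linear_Pair bounded_linear_zero bounded_linear_ident)

lemma net_bound_slice:
  assumes "open V" "open W" "w \<in> smooth_nets (V \<times> W)" "x \<in> V" "K \<subseteq> W"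
    and "net_bound ({x} \<times> K) (map (\<lambda>b. (0, b)) ws) w g"
  shows "net_bound K ws (\<lambda>e y. w e (x, y)) g"
proof -
  from assms(6) obtain C where
    "\<forall>\<^sub>F e in at_right 0. \<forall>z\<in>{x} \<times> K. norm (iter_partial (map (\<lambda>b. (0, b)) ws) (w e) z) \<le> C * g e"
    unfolding net_bound_def by blast
  with eventually_unit_interval
  have "\<forall>\<^sub>F e in at_right 0. \<forall>y\<in>K. norm (iter_partial ws (\<lambda>y. w e (x, y)) y) \<le> C * g e"
  proof eventually_elim
    case (elim e)
    then show ?case using iter_partial_slice[OF assms(1,2) _ assms(4), of "w e"] assms(3,5)
      by (auto simp: smooth_nets_def)
  qed
  then show ?thesis unfolding net_bound_def by blast
qed

lemma smooth_nets_slice: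
  "open V \<Longrightarrow> open W \<Longrightarrow> w \<in> smooth_nets (V \<times> W) \<Longrightarrow> x \<in> V \<Longrightarrow> (\<lambda>e y. w e (x, y)) \<in> smooth_nets W"
  by (auto simp: smooth_nets_def intro: smooth_on_slice)

text \<open>A slice is a composition with an affine embedding, which turns letters b into (0, b) or
  (b, 0). These are still basis vectors of the product, so the estimates for nets on V \<times> W
  apply to them.\<close>

lemma set_map_Pair_Basis:
  assumes "set ws \<subseteq> Basis"
  shows "set (map (\<lambda>b. (0, b)) ws) \<subseteq> Basis" "set (map (\<lambda>b. (b, 0)) ws) \<subseteq> Basis"
  using assms by (auto simp: Basis_prod_def)

lemma negligible_nets_slice:
  assumes "open V" "open W" "w \<in> negligible_nets (V \<times> W)" "x \<in> V"
  shows "(\<lambda>e y. w e (x, y)) \<in> negligible_nets W"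
proof -
  have VW: "open (V \<times> W)" using assms by (simp add: open_Times)
  have s: "w \<in> smooth_nets (V \<times> W)" using assms by (simp add: negligible_nets_def)
  have "net_bound K ws (\<lambda>e y. w e (x, y)) (\<lambda>e. e ^ q)" if "compact K" "K \<subseteq> W" "set ws \<subseteq> Basis" for K ws q
  proof (rule net_bound_slice[OF assms(1,2) s assms(4) that(2)])
    have K: "compact ({x} \<times> K)" "{x} \<times> K \<subseteq> V \<times> W" using that assms(4) by (auto intro: compact_Times)
    show "net_bound ({x} \<times> K) (map (Pair 0) ws) w (\<lambda>e. e ^ q)"
      using assms(3)[unfolded negligible_nets_iff[OF VW], THEN conjunct2, rule_format, of "{x} \<times> K" "map (\<lambda>b. (0, b)) ws"]
        K set_map_Pair_Basis(1)[OF that(3)] by simp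
  qed
  then show ?thesis using smooth_nets_slice[OF assms(1,2) s assms(4)] unfolding negligible_nets_iff[OF assms(2)] by simp
qed

lemma moderate_nets_slice:
  assumes "open V" "open W" "w \<in> moderate_nets (V \<times> W)" "x \<in> V"
  shows "(\<lambda>e y. w e (x, y)) \<in> moderate_nets W"
proof -
  have VW: "open (V \<times> W)" using assms by (simp add: open_Times)
  have s: "w \<in> smooth_nets (V \<times> W)" using assms by (simp add: moderate_nets_def)
  have "\<exists>N. net_bound K ws (\<lambda>e y. w e (x, y)) (\<lambda>e. e powr (- real N))"
    if "compact K" "K \<subseteq> W" "set ws \<subseteq> Basis" for K ws
  proof -
    have K: "compact ({x} \<times> K)" "{x} \<times> K \<subseteq> V \<times> W" using that assms(4) by (auto intro: compact_Times)
    have "\<exists>N. net_bound ({x} \<times> K) (map (\<lambda>b. (0, b)) ws) w (\<lambda>e. e powr (- real N))"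
      using assms(3)[unfolded moderate_nets_iff[OF VW], THEN conjunct2, rule_format, of "{x} \<times> K" "map (\<lambda>b. (0, b)) ws"]
        K set_map_Pair_Basis(1)[OF that(3)] by simp
    then show ?thesis using net_bound_slice[OF assms(1,2) s assms(4) that(2)] by blast
  qed
  then show ?thesis using smooth_nets_slice[OF assms(1,2) s assms(4)] unfolding moderate_nets_iff[OF assms(2)] by simp
qed

lemma gen_slice_class:
  assumes "open V" "open W" "w0 \<in> moderate_nets (V \<times> W)" "x \<in> V"
  shows "gen_slice W (net_rel (V \<times> W) `` {w0}) x = net_rel W `` {\<lambda>e y. w0 e (x, y)}"
  unfolding gen_slice_def
proof (rule net_rel_Image_eq[OF assms(2)])
  show "(\<lambda>w e y. w e (x, y)) ` net_rel (V \<times> W) `` {w0} \<noteq> {}"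
    using net_rel_refl[OF assms(3)] by blast
  fix r assume "r \<in> (\<lambda>w e y. w e (x, y)) ` net_rel (V \<times> W) `` {w0}"
  then obtain w where w: "(w0, w) \<in> net_rel (V \<times> W)" "r = (\<lambda>e y. w e (x, y))" by blast
  then show "(\<lambda>e y. w0 e (x, y), r) \<in> net_rel W"
    using moderate_nets_slice[OF assms(1,2) _ assms(4), of w0] moderate_nets_slice[OF assms(1,2) _ assms(4), of w]
      negligible_nets_slice[OF assms(1,2) _ assms(4), of "\<lambda>e z. w0 e z - w e z"]
    by (simp add: net_rel_def)
qed

section \<open>Integral kernels\<close>

lemma set_integrable_compact:
  fixes f :: "'b::euclidean_space \<Rightarrow> 'k::euclidean_space"
  shows "compact K \<Longrightarrow> continuous_on K f \<Longrightarrow> set_integrable lborel K f"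
  unfolding set_integrable_def by (rule borel_integrable_compact)

lemma norm_set_integral_compact_le:
  fixes f :: "'b::euclidean_space \<Rightarrow> 'k::euclidean_space"
  assumes "compact K" "continuous_on K f" "\<And>y. y \<in> K \<Longrightarrow> norm (f y) \<le> B"
  shows "norm (LINT y:K|lborel. f y) \<le> B * measure lborel K"
proof -
  have "integrable lborel (\<lambda>y. indicator K y *\<^sub>R B)"
    using borel_integrable_compact[OF assms(1) continuous_on_const] .
  with borel_integrable_compact[OF assms(1,2)]
  have "norm (LINT y:K|lborel. f y) \<le> (LINT y:K|lborel. B)"
    unfolding set_lebesgue_integral_def
    by (rule Bochner_Integration.integral_norm_bound_integral) (use assms(3) in \<open>auto simp: indicator_def\<close>)
  also have "(LINT y:K|lborel. B) = B * measure lborel K"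
    using assms(1) by (simp add: set_lebesgue_integral_def compact_imp_closed)
  finally show ?thesis .
qed

lemma set_integral_sum_compact:
  fixes f :: "'i \<Rightarrow> 'b::euclidean_space \<Rightarrow> 'k::euclidean_space"
  assumes "compact K" "\<And>i. i \<in> I \<Longrightarrow> continuous_on K (f i)"
  shows "(LINT y:K|lborel. \<Sum>i\<in>I. f i y) = (\<Sum>i\<in>I. LINT y:K|lborel. f i y)"
  unfolding set_lebesgue_integral_def scaleR_sum_right
  by (rule Bochner_Integration.integral_sum) (use assms borel_integrable_compact in blast)

lemma set_integral_diff_compact:
  fixes f g :: "'b::euclidean_space \<Rightarrow> 'k::euclidean_space"
  assumes "compact K" "continuous_on K f" "continuous_on K g"
  shows "(LINT y:K|lborel. f y - g y) = (LINT y:K|lborel. f y) - (LINT y:K|lborel. g y)"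
  using set_integral_diff(2)[OF set_integrable_compact set_integrable_compact] assms by blast

lemma continuous_on_slice:
  assumes "continuous_on (W \<times> K) (\<lambda>(x, y). g x y)" "x \<in> W"
  shows "continuous_on K (g x)"
proof -
  have "continuous_on K (\<lambda>y. (x, y))" by (intro continuous_intros)
  from continuous_on_compose2[OF assms(1) this] assms(2) show ?thesis by auto
qed

text \<open>Differentiation under the integral sign. The error of the linear approximation is
  bounded uniformly in y \<in> K, because the partial derivatives are uniformly continuous on the
  product of a closed ball around x with K; this bound is then integrated over K.\<close>

lemma has_derivative_set_integral:
  fixes f :: "'a::euclidean_space \<Rightarrow> 'b::euclidean_space \<Rightarrow> 'k::euclidean_space"
  assumes "open W" "compact K"
    and d: "\<And>y. y \<in> K \<Longrightarrow> (\<lambda>x. f x y) differentiable_on W"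
    and c0: "continuous_on (W \<times> K) (\<lambda>(x, y). f x y)"
    and c: "\<And>b. b \<in> Basis \<Longrightarrow> continuous_on (W \<times> K) (\<lambda>(x, y). partial b (\<lambda>x. f x y) x)"
    and "x \<in> W"
  shows "((\<lambda>x. LINT y:K|lborel. f x y) has_derivative
    (\<lambda>v. \<Sum>b\<in>Basis. (v \<bullet> b) *\<^sub>R (LINT y:K|lborel. partial b (\<lambda>x. f x y) x))) (at x)"
proof -
  define P where "P = (\<lambda>b x y. partial b (\<lambda>x. f x y) x)"
  have cP: "continuous_on (W \<times> K) (\<lambda>(x, y). P b x y)" if "b \<in> Basis" for b
    using c[OF that] by (simp add: P_def)
  define n where "n = real DIM('a)"
  define vol where "vol = measure lborel K"
  have n: "n > 0" and vol: "vol \<ge> 0" by (simp_all add: n_def vol_def)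
  have deriv: "((\<lambda>x. f x y) has_derivative (\<lambda>v. \<Sum>b\<in>Basis. (v \<bullet> b) *\<^sub>R P b x y)) (at x)"
    if "x \<in> W" "y \<in> K" for x y
    unfolding P_def
    by (rule has_derivative_eq_rhs[OF has_derivative_partial[OF assms(1) d[OF that(2)] that(1)]])
      (rule ext, rule partial_Basis_sum[OF assms(1) d[OF that(2)] that(1)])
  have "\<exists>\<delta>>0. \<forall>x'. norm (x' - x) < \<delta> \<longrightarrow>
      norm ((LINT y:K|lborel. f x' y) - (LINT y:K|lborel. f x y)
        - (\<Sum>b\<in>Basis. ((x' - x) \<bullet> b) *\<^sub>R (LINT y:K|lborel. P b x y))) \<le> e * norm (x' - x)"
    if "e > 0" for e
  proof -
    \<comment> \<open>The factor n accounts for the sum over the basis directions and vol for the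
      integration over K; 1 is added because K may be a null set.\<close>
    define \<eta> where "\<eta> = e / (n * (vol + 1))"
    have \<eta>: "\<eta> > 0" using that n vol by (simp add: \<eta>_def)
    obtain \<delta>0 where \<delta>0: "\<delta>0 > 0" "cball x \<delta>0 \<subseteq> W" using assms(1,6) open_contains_cball by blast
    have "\<exists>\<delta>>0. \<forall>x'\<in>cball x \<delta>0. \<forall>y\<in>K. dist x' x < \<delta> \<longrightarrow> norm (P b x' y - P b x y) < \<eta>"
      if "b \<in> Basis" for b
    proof -
      have "continuous_on (cball x \<delta>0 \<times> K) (\<lambda>(x, y). P b x y)"
        using continuous_on_subset[OF cP[OF that]] \<delta>0 by (simp add: Sigma_mono)
      then have "uniformly_continuous_on (cball x \<delta>0 \<times> K) (\<lambda>(x, y). P b x y)"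
        by (intro compact_uniformly_continuous compact_Times compact_cball assms(2))
      then obtain \<delta> where \<delta>: "\<delta> > 0" "\<And>z z'. z \<in> cball x \<delta>0 \<times> K \<Longrightarrow> z' \<in> cball x \<delta>0 \<times> K \<Longrightarrow>
          dist z' z < \<delta> \<Longrightarrow> dist ((\<lambda>(x, y). P b x y) z') ((\<lambda>(x, y). P b x y) z) < \<eta>"
        using \<eta> unfolding uniformly_continuous_on_def by metis
      have "norm (P b x' y - P b x y) < \<eta>" if "x' \<in> cball x \<delta>0" "y \<in> K" "dist x' x < \<delta>" for x' y
        using \<delta>(2)[of "(x, y)" "(x', y)"] that \<delta>0(1) by (simp add: dist_Pair_Pair dist_norm)
      with \<delta>(1) show ?thesis by blast
    qed
    then obtain D where D: "\<And>b. b \<in> Basis \<Longrightarrow> D b > 0"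
      "\<And>b x' y. b \<in> Basis \<Longrightarrow> x' \<in> cball x \<delta>0 \<Longrightarrow> y \<in> K \<Longrightarrow> dist x' x < D b \<Longrightarrow> norm (P b x' y - P b x y) < \<eta>"
      by metis
    define \<delta> where "\<delta> = min \<delta>0 (Min (D ` Basis))"
    have \<delta>: "\<delta> > 0" "\<delta> \<le> \<delta>0" "\<And>b. b \<in> Basis \<Longrightarrow> \<delta> \<le> D b"
      using \<delta>0(1) D(1) by (auto simp: \<delta>_def min.coboundedI2)
    have "norm ((LINT y:K|lborel. f x' y) - (LINT y:K|lborel. f x y)
        - (\<Sum>b\<in>Basis. ((x' - x) \<bullet> b) *\<^sub>R (LINT y:K|lborel. P b x y))) \<le> e * norm (x' - x)"
      if x': "norm (x' - x) < \<delta>" for x'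
    proof -
      have x'W: "x' \<in> W" "x' \<in> ball x \<delta>" using x' \<delta> \<delta>0 by (auto simp: dist_norm norm_minus_commute subset_iff)
      have cf: "continuous_on K (f x)" "continuous_on K (f x')"
        using continuous_on_slice[OF c0] assms(6) x'W by auto
      have cPx: "continuous_on K (P b x)" if "b \<in> Basis" for b
        using continuous_on_slice[OF cP[OF that]] assms(6) by blast
      have pw: "norm (f x' y - f x y - (\<Sum>b\<in>Basis. ((x' - x) \<bullet> b) *\<^sub>R P b x y)) \<le> n * \<eta> * norm (x' - x)"
        if y: "y \<in> K" for y
      proof -
        \<comment> \<open>With the linear part at x subtracted, the derivative of G is made of
          differences of partial derivatives at \<xi> and at x, which are small on the ball. The
          mean value inequality then bounds \<open>G x' - G x\<close>.\<close>
        define G where "G = (\<lambda>\<xi>. f \<xi> y - (\<Sum>b\<in>Basis. (\<xi> \<bullet> b) *\<^sub>R P b x y))"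
        have "norm (G x' - G x) \<le> n * \<eta> * norm (x' - x)"
        proof (rule differentiable_bound[OF convex_ball])
          fix \<xi> assume \<xi>: "\<xi> \<in> ball x \<delta>"
          have \<xi>W: "\<xi> \<in> W" "\<xi> \<in> cball x \<delta>0" using \<xi> \<delta> \<delta>0 by (auto simp: subset_iff)
          have "(G has_derivative (\<lambda>v. (\<Sum>b\<in>Basis. (v \<bullet> b) *\<^sub>R P b \<xi> y) - (\<Sum>b\<in>Basis. (v \<bullet> b) *\<^sub>R P b x y))) (at \<xi>)"
            unfolding G_def by (intro has_derivative_diff deriv[OF \<xi>W(1) y]) (auto intro!: derivative_eq_intros)
          also have "(\<lambda>v. (\<Sum>b\<in>Basis. (v \<bullet> b) *\<^sub>R P b \<xi> y) - (\<Sum>b\<in>Basis. (v \<bullet> b) *\<^sub>R P b x y))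
              = (\<lambda>v. \<Sum>b\<in>Basis. (v \<bullet> b) *\<^sub>R (P b \<xi> y - P b x y))"
            by (simp add: sum_subtractf scaleR_right_diff_distrib)
          finally show "(G has_derivative (\<lambda>v. \<Sum>b\<in>Basis. (v \<bullet> b) *\<^sub>R (P b \<xi> y - P b x y))) (at \<xi> within ball x \<delta>)"
            using has_derivative_at_withinI by blast
          show "onorm (\<lambda>v. \<Sum>b\<in>Basis. (v \<bullet> b) *\<^sub>R (P b \<xi> y - P b x y)) \<le> n * \<eta>"
          proof (rule onorm_le)
            fix v :: 'a
            have "norm (\<Sum>b\<in>Basis. (v \<bullet> b) *\<^sub>R (P b \<xi> y - P b x y)) \<le> (\<Sum>b\<in>(Basis::'a set). norm v * \<eta>)"
            proof (rule sum_norm_le)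
              fix b :: 'a assume b: "b \<in> Basis"
              have "norm (P b \<xi> y - P b x y) \<le> \<eta>"
                using D(2)[OF b \<xi>W(2) y] \<delta>(3)[OF b] \<xi> by (simp add: dist_commute less_imp_le)
              then show "norm ((v \<bullet> b) *\<^sub>R (P b \<xi> y - P b x y)) \<le> norm v * \<eta>"
                using Basis_le_norm[OF b, of v] by (auto intro!: mult_mono)
            qed
            then show "norm (\<Sum>b\<in>Basis. (v \<bullet> b) *\<^sub>R (P b \<xi> y - P b x y)) \<le> n * \<eta> * norm v"
              by (simp add: n_def mult_ac)
          qed
        qed (use x'W \<delta>(1) in auto)
        then show ?thesis
          unfolding G_def by (simp add: inner_diff_left scaleR_left_diff_distrib sum_subtractf algebra_simps)
      qed
      have cS: "continuous_on K (\<lambda>y. \<Sum>b\<in>Basis. ((x' - x) \<bullet> b) *\<^sub>R P b x y)"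
        by (intro continuous_on_sum continuous_on_scaleR continuous_on_const cPx)
      have "(LINT y:K|lborel. \<Sum>b\<in>Basis. ((x' - x) \<bullet> b) *\<^sub>R P b x y)
          = (\<Sum>b\<in>Basis. ((x' - x) \<bullet> b) *\<^sub>R (LINT y:K|lborel. P b x y))"
        using set_integral_sum_compact[OF assms(2), of Basis "\<lambda>b y. ((x' - x) \<bullet> b) *\<^sub>R P b x y"] cPx
        by (simp add: continuous_on_scaleR continuous_on_const)
      then have "(LINT y:K|lborel. f x' y) - (LINT y:K|lborel. f x y)
        - (\<Sum>b\<in>Basis. ((x' - x) \<bullet> b) *\<^sub>R (LINT y:K|lborel. P b x y))
        = (LINT y:K|lborel. f x' y - f x y - (\<Sum>b\<in>Basis. ((x' - x) \<bullet> b) *\<^sub>R P b x y))"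
        using set_integral_diff_compact[OF assms(2) continuous_on_diff[OF cf(2,1)] cS]
          set_integral_diff_compact[OF assms(2) cf(2,1)] by simp
      also have "norm \<dots> \<le> n * \<eta> * norm (x' - x) * measure lborel K"
        using pw by (intro norm_set_integral_compact_le assms(2) continuous_on_diff cf cS)
      also have "\<dots> = e * norm (x' - x) * (vol / (vol + 1))"
      proof -
        have "n * \<eta> = e / (vol + 1)" using n by (simp add: \<eta>_def)
        then show ?thesis by (simp add: vol_def)
      qed
      also have "\<dots> \<le> e * norm (x' - x)"
        using vol \<open>e > 0\<close> by (intro mult_left_le) (auto simp: divide_le_eq)
      finally show ?thesis .
    qed
    with \<delta>(1) show ?thesis by blast
  qed
  moreover have "bounded_linear (\<lambda>v. \<Sum>b\<in>Basis. (v \<bullet> b) *\<^sub>R (LINT y:K|lborel. P b x y))"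
    by (intro bounded_linear_sum bounded_linear_scaleR_const bounded_linear_inner_left)
  ultimately show ?thesis unfolding has_derivative_at_alt P_def by blast
qed

lemma iter_partial_set_integral:
  fixes f :: "'a::euclidean_space \<Rightarrow> 'b::euclidean_space \<Rightarrow> 'k::euclidean_space"
  assumes "open W" "compact K"
    and s: "\<And>y. y \<in> K \<Longrightarrow> smooth_on (\<lambda>x. f x y) W"
    and c: "\<And>ws. set ws \<subseteq> Basis \<Longrightarrow> continuous_on (W \<times> K) (\<lambda>(x, y). iter_partial ws (\<lambda>x. f x y) x)"
  shows "smooth_on (\<lambda>x. LINT y:K|lborel. f x y) W"
    and "\<And>ws x. set ws \<subseteq> Basis \<Longrightarrow> x \<in> W \<Longrightarrow>
      iter_partial ws (\<lambda>x. LINT y:K|lborel. f x y) x = (LINT y:K|lborel. iter_partial ws (\<lambda>x. f x y) x)"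
proof -
  have D: "((\<lambda>x. LINT y:K|lborel. iter_partial ws (\<lambda>x. f x y) x) has_derivative
      (\<lambda>v. \<Sum>b\<in>Basis. (v \<bullet> b) *\<^sub>R (LINT y:K|lborel. iter_partial (b # ws) (\<lambda>x. f x y) x))) (at x)"
    if "set ws \<subseteq> Basis" "x \<in> W" for ws x
    unfolding iter_partial_Cons
  proof (rule has_derivative_set_integral[OF assms(1,2) _ c[OF that(1)] _ that(2)])
    show "iter_partial ws (\<lambda>x. f x y) differentiable_on W" if "y \<in> K" for y
      using s[OF that] assms(1) smooth_on_iter_partial smooth_on_differentiable by blast
    show "continuous_on (W \<times> K) (\<lambda>(x, y). partial b (iter_partial ws (\<lambda>x. f x y)) x)" if "b \<in> Basis" for b
      using c[of "b # ws"] that \<open>set ws \<subseteq> Basis\<close> by simp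
  qed
  have P: "partial b (\<lambda>x. LINT y:K|lborel. iter_partial ws (\<lambda>x. f x y) x) x
      = (LINT y:K|lborel. iter_partial (b # ws) (\<lambda>x. f x y) x)"
    if "set ws \<subseteq> Basis" "x \<in> W" "b \<in> Basis" for ws x b
  proof -
    have "partial b (\<lambda>x. LINT y:K|lborel. iter_partial ws (\<lambda>x. f x y) x) x
        = (\<Sum>a\<in>Basis. (b \<bullet> a) *\<^sub>R (LINT y:K|lborel. iter_partial (a # ws) (\<lambda>x. f x y) x))"
      by (rule partial_eqI[OF D[OF that(1,2)]])
    also have "\<dots> = (\<Sum>a\<in>Basis. if a = b then (LINT y:K|lborel. iter_partial (a # ws) (\<lambda>x. f x y) x) else 0)"
      by (intro sum.cong) (use that(3) in \<open>auto simp: inner_Basis\<close>)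
    finally show ?thesis using that(3) by simp
  qed
  show "smooth_on (\<lambda>x. LINT y:K|lborel. f x y) W"
  \<comment> \<open>The invariant shape: on W, an integral over K of some derivative of the
    integrand with respect to x.\<close>
  proof (rule smooth_on_coinduct[where P = "\<lambda>h. \<exists>ws. set ws \<subseteq> Basis \<and>
        (\<forall>x\<in>W. h x = (LINT y:K|lborel. iter_partial ws (\<lambda>x. f x y) x))"])
    show "\<exists>ws. set ws \<subseteq> Basis \<and> (\<forall>x\<in>W. (LINT y:K|lborel. f x y) = (LINT y:K|lborel. iter_partial ws (\<lambda>x. f x y) x))"
      by (rule exI[of _ "[]"]) simp
    fix h assume "\<exists>ws. set ws \<subseteq> Basis \<and> (\<forall>x\<in>W. h x = (LINT y:K|lborel. iter_partial ws (\<lambda>x. f x y) x))"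
    then obtain ws where ws: "set ws \<subseteq> Basis" "\<And>x. x \<in> W \<Longrightarrow> h x = (LINT y:K|lborel. iter_partial ws (\<lambda>x. f x y) x)"
      by blast
    have "(\<lambda>x. LINT y:K|lborel. iter_partial ws (\<lambda>x. f x y) x) differentiable_on W"
      using has_derivative_at_withinI[OF D[OF ws(1)]] unfolding differentiable_on_def differentiable_def by blast
    then show "h differentiable_on W"
      using differentiable_on_cong[of W h, OF ws(2)] by blast
    fix b :: 'a assume b: "b \<in> Basis"
    have "\<forall>x\<in>W. partial b h x = (LINT y:K|lborel. iter_partial (b # ws) (\<lambda>x. f x y) x)"
      using partial_cong[of W h "\<lambda>x. LINT y:K|lborel. iter_partial ws (\<lambda>x. f x y) x", OF assms(1) ws(2), of _ b]
        P[OF ws(1) _ b] by simp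
    then show "\<exists>ws. set ws \<subseteq> Basis \<and> (\<forall>x\<in>W. partial b h x = (LINT y:K|lborel. iter_partial ws (\<lambda>x. f x y) x))"
      using ws(1) b by (intro exI[of _ "b # ws"]) simp
  qed
  show "iter_partial ws (\<lambda>x. LINT y:K|lborel. f x y) x = (LINT y:K|lborel. iter_partial ws (\<lambda>x. f x y) x)"
    if "set ws \<subseteq> Basis" "x \<in> W" for ws x
    using that
  proof (induction ws arbitrary: x)
    case (Cons b ws)
    have "partial b (iter_partial ws (\<lambda>x. LINT y:K|lborel. f x y)) x
        = partial b (\<lambda>x. LINT y:K|lborel. iter_partial ws (\<lambda>x. f x y) x) x"
      by (rule partial_cong[OF assms(1) _ Cons.prems(2)]) (use Cons in auto)
    then show ?case using P[of ws x b] Cons.prems by simp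
  qed simp
qed

text \<open>Multiplication by \<open>r y\<close> is bounded linear and does not involve x, so all
  derivatives fall on the kernel and continuity of r is enough. The third claim serves to split and
  to bound the integrals.\<close>

lemma kernel_integral:
  fixes w :: "'a::euclidean_space \<times> 'b::euclidean_space \<Rightarrow> 'k::{real_normed_field, euclidean_space}"
  assumes "open V" "open W" "compact K" "K \<subseteq> W" "smooth_on w (V \<times> W)" "continuous_on K r"
  shows "smooth_on (\<lambda>x. LINT y:K|lborel. w (x, y) * r y) V"
    and "\<And>ws x. set ws \<subseteq> Basis \<Longrightarrow> x \<in> V \<Longrightarrow>
      iter_partial ws (\<lambda>x. LINT y:K|lborel. w (x, y) * r y) x
        = (LINT y:K|lborel. iter_partial (map (\<lambda>b. (b, 0)) ws) w (x, y) * r y)"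
    and "\<And>vs x. x \<in> V \<Longrightarrow> continuous_on K (\<lambda>y. iter_partial vs w (x, y) * r y)"
proof -
  have sl: "smooth_on (\<lambda>x. w (x, y)) V" if "y \<in> K" for y
    using smooth_on_slice_fst[OF assms(1,2,5)] that assms(4) by blast
  have s: "smooth_on (\<lambda>x. w (x, y) * r y) V" if "y \<in> K" for y
    using smooth_on_linear[OF assms(1) sl[OF that] bounded_linear_mult_left] .
  have eq: "iter_partial ws (\<lambda>x. w (x, y) * r y) x = iter_partial (map (\<lambda>b. (b, 0)) ws) w (x, y) * r y"
    if "x \<in> V" "y \<in> K" for ws x y
    using iter_partial_linear[OF assms(1) sl[OF that(2)] bounded_linear_mult_left that(1)]
      iter_partial_slice_fst[OF assms(1,2,5) that(1)] that(2) assms(4) by auto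
  have ct: "continuous_on (V \<times> K) (\<lambda>(x, y). iter_partial vs w (x, y) * r y)" for vs
  proof -
    have "continuous_on (V \<times> W) (iter_partial vs w)"
      using assms by (intro smooth_on_continuous smooth_on_iter_partial open_Times)
    then have "continuous_on (V \<times> K) (iter_partial vs w)"
      by (rule continuous_on_subset) (use assms(4) in auto)
    moreover have "continuous_on (V \<times> K) (\<lambda>z. r (snd z))"
      by (rule continuous_on_compose2[OF assms(6) continuous_on_snd[OF continuous_on_id]]) auto
    ultimately show ?thesis by (auto simp: case_prod_beta intro: continuous_on_mult)
  qed
  have c: "continuous_on (V \<times> K) (\<lambda>(x, y). iter_partial ws (\<lambda>x. w (x, y) * r y) x)" for ws
    by (rule continuous_on_eq[OF ct[of "map (\<lambda>b. (b, 0)) ws"]]) (auto simp: eq)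
  show "smooth_on (\<lambda>x. LINT y:K|lborel. w (x, y) * r y) V"
    by (rule iter_partial_set_integral(1)[OF assms(1,3) s c])
  show "iter_partial ws (\<lambda>x. LINT y:K|lborel. w (x, y) * r y) x
      = (LINT y:K|lborel. iter_partial (map (\<lambda>b. (b, 0)) ws) w (x, y) * r y)"
    if "set ws \<subseteq> Basis" "x \<in> V" for ws x
  proof -
    have "iter_partial ws (\<lambda>x. LINT y:K|lborel. w (x, y) * r y) x
        = (LINT y:K|lborel. iter_partial ws (\<lambda>x. w (x, y) * r y) x)"
      by (rule iter_partial_set_integral(2)[OF assms(1,3) s c that])
    also have "\<dots> = (LINT y:K|lborel. iter_partial (map (\<lambda>b. (b, 0)) ws) w (x, y) * r y)"
      by (rule set_lebesgue_integral_cong) (use eq that(2) assms(3) in \<open>auto simp: compact_imp_closed\<close>)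
    finally show ?thesis .
  qed
  show "continuous_on K (\<lambda>y. iter_partial vs w (x, y) * r y)" if "x \<in> V" for vs x
    using continuous_on_slice[OF ct that] .
qed

abbreviation kernel_net ::
    "'b::euclidean_space set \<Rightarrow> ('a::euclidean_space \<times> 'b, 'k::{real_normed_field, euclidean_space}) net \<Rightarrow>
     ('b, 'k) net \<Rightarrow> ('a, 'k) net"
  where "kernel_net K w r \<equiv> (\<lambda>e x. LINT y:K|lborel. w e (x, y) * r e y)"

lemma continuous_on_smooth_net:
  "r \<in> smooth_nets W \<Longrightarrow> K \<subseteq> W \<Longrightarrow> e \<in> {0<..1} \<Longrightarrow> continuous_on K (r e)"
  using smooth_on_continuous continuous_on_subset unfolding smooth_nets_def by blast

lemma smooth_nets_kernel_integral:
  fixes w :: "('a::euclidean_space \<times> 'b::euclidean_space, 'k::{real_normed_field, euclidean_space}) net"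
  assumes "open V" "open W" "compact K" "K \<subseteq> W" "w \<in> smooth_nets (V \<times> W)" "r \<in> smooth_nets W"
  shows "kernel_net K w r \<in> smooth_nets V"
  unfolding smooth_nets_def
proof (intro CollectI ballI)
  fix e :: real assume "e \<in> {0<..1}"
  then have "smooth_on (w e) (V \<times> W)" "continuous_on K (r e)"
    using assms(5) continuous_on_smooth_net[OF assms(6,4)] by (auto simp: smooth_nets_def)
  then show "smooth_on (\<lambda>x. LINT y:K|lborel. w e (x, y) * r e y) V"
    using kernel_integral(1)[OF assms(1-4)] by blast
qed

lemma net_bound_kernel_integral:
  fixes w :: "('a::euclidean_space \<times> 'b::euclidean_space, 'k::{real_normed_field, euclidean_space}) net"
  assumes "open V" "open W" "compact K" "K \<subseteq> W" "w \<in> smooth_nets (V \<times> W)" "r \<in> smooth_nets W"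
    and "C \<subseteq> V" "set ws \<subseteq> Basis"
    and w: "net_bound (C \<times> K) (map (\<lambda>b. (b, 0)) ws) w g" "\<And>e. 0 < e \<Longrightarrow> 0 \<le> g e"
    and r: "net_bound K [] r h" "\<And>e. 0 < e \<Longrightarrow> 0 \<le> h e"
  shows "net_bound C ws (kernel_net K w r) (\<lambda>e. g e * h e)"
proof -
  obtain A where A: "A \<ge> 0" "\<forall>\<^sub>F e in at_right 0. e \<in> {0<..1} \<and>
      (\<forall>z\<in>C \<times> K. norm (iter_partial (map (\<lambda>b. (b, 0)) ws) (w e) z) \<le> A * g e)"
    by (rule net_boundE[OF w(1)]) (use w(2) in blast)+
  obtain B where B: "B \<ge> 0" "\<forall>\<^sub>F e in at_right 0. e \<in> {0<..1} \<and> (\<forall>y\<in>K. norm (iter_partial [] (r e) y) \<le> B * h e)"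
    by (rule net_boundE[OF r(1)]) (use r(2) in blast)+
  from A(2) B(2) have "\<forall>\<^sub>F e in at_right 0. \<forall>x\<in>C.
      norm (iter_partial ws (\<lambda>x. LINT y:K|lborel. w e (x, y) * r e y) x) \<le> (A * B * measure lborel K) * (g e * h e)"
  proof eventually_elim
    case (elim e)
    then have s: "smooth_on (w e) (V \<times> W)" "continuous_on K (r e)"
      using assms(5) continuous_on_smooth_net[OF assms(6,4)] by (auto simp: smooth_nets_def)
    show ?case
    proof
      fix x assume x: "x \<in> C"
      then have xV: "x \<in> V" using assms(7) by blast
      have "norm (LINT y:K|lborel. iter_partial (map (\<lambda>b. (b, 0)) ws) (w e) (x, y) * r e y)
          \<le> (A * g e) * (B * h e) * measure lborel K"
      proof (rule norm_set_integral_compact_le[OF assms(3) kernel_integral(3)[OF assms(1-4) s xV]])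
        fix y assume "y \<in> K"
        with elim x have "norm (iter_partial (map (\<lambda>b. (b, 0)) ws) (w e) (x, y)) \<le> A * g e"
          "norm (r e y) \<le> B * h e" by auto
        then show "norm (iter_partial (map (\<lambda>b. (b, 0)) ws) (w e) (x, y) * r e y) \<le> (A * g e) * (B * h e)"
          using A(1) w(2)[of e] elim unfolding norm_mult by (intro mult_mono) auto
      qed
      then show "norm (iter_partial ws (\<lambda>x. LINT y:K|lborel. w e (x, y) * r e y) x)
          \<le> (A * B * measure lborel K) * (g e * h e)"
        unfolding kernel_integral(2)[OF assms(1-4) s assms(8) xV] by (simp add: mult_ac)
    qed
  qed
  then show ?thesis unfolding net_bound_def by blast
qed

text \<open>The reason that the class of the integral does not depend on the representative of the
  kernel.\<close>

lemma negligible_kernel_integral: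
  fixes w :: "('a::euclidean_space \<times> 'b::euclidean_space, 'k::{real_normed_field, euclidean_space}) net"
  assumes "open V" "open W" "compact K" "K \<subseteq> W" "w \<in> negligible_nets (V \<times> W)" "r \<in> moderate_nets W"
  shows "kernel_net K w r \<in> negligible_nets V"
proof -
  have s: "w \<in> smooth_nets (V \<times> W)" "r \<in> smooth_nets W"
    using assms by (auto simp: negligible_nets_def moderate_nets_def)
  have VW: "open (V \<times> W)" using assms by (simp add: open_Times)
  obtain N :: nat where N: "net_bound K [] r (\<lambda>e. e powr (- real N))"
    using assms(6)[unfolded moderate_nets_iff[OF assms(2)], THEN conjunct2, rule_format, of K "[]"] assms(3,4)
    by auto
  have "net_bound C ws (kernel_net K w r) (\<lambda>e. e ^ q)"
    if "compact C" "C \<subseteq> V" "set ws \<subseteq> Basis" for C ws q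
  proof (rule net_bound_mono)
    have CK: "compact (C \<times> K)" "C \<times> K \<subseteq> V \<times> W" using that assms(3,4) by (auto intro: compact_Times)
    \<comment> \<open>The N extra powers absorb the growth of r on K.\<close>
    have "net_bound (C \<times> K) (map (\<lambda>b. (b, 0)) ws) w (\<lambda>e. e ^ (q + N))"
      using assms(5)[unfolded negligible_nets_iff[OF VW], THEN conjunct2, rule_format,
          of "C \<times> K" "map (\<lambda>b. (b, 0)) ws"] CK set_map_Pair_Basis(2)[OF that(3)] by simp
    then show "net_bound C ws (kernel_net K w r) (\<lambda>e. e ^ (q + N) * e powr (- real N))"
      by (intro net_bound_kernel_integral[OF assms(1-4) s that(2,3) _ _ N]) auto
    show "0 \<le> e ^ (q + N) * e powr (- real N) \<and> e ^ (q + N) * e powr (- real N) \<le> e ^ q"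
      if "e \<in> {0<..1}" for e :: real
      using that by (simp add: powr_minus powr_realpow power_add)
  qed
  then show ?thesis
    using smooth_nets_kernel_integral[OF assms(1-4) s] unfolding negligible_nets_iff[OF assms(1)] by simp
qed

text \<open>Replacing v0 by an equivalent w changes the integral by one against
  \<open>w - v0\<close>, which is negligible. The class of the integral is therefore determined once
  v0 itself reproduces every net r equivalent to r0.\<close>

lemma gen_integral_class:
  fixes v0 :: "('a::euclidean_space \<times> 'a, 'k::{real_normed_field, euclidean_space}) net"
  assumes "open V" "open W" "V \<subseteq> W" "compact K" "K \<subseteq> W"
    and v0: "v0 \<in> moderate_nets (V \<times> W)" and r0: "r0 \<in> moderate_nets W"
    and repro: "\<And>r. (r0, r) \<in> net_rel W \<Longrightarrow>
      (\<lambda>e x. kernel_net K v0 r e x - r e x) \<in> negligible_nets V"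
  shows "gen_integral V K (net_rel (V \<times> W) `` {v0}) (net_rel W `` {r0}) = net_rel V `` {r0}"
  unfolding gen_integral_def
proof (rule net_rel_Image_eq[OF assms(1)])
  show "{\<lambda>e x. LINT y:K|lborel. w e (x, y) * r e y |w r.
      w \<in> net_rel (V \<times> W) `` {v0} \<and> r \<in> net_rel W `` {r0}} \<noteq> {}"
    using net_rel_refl[OF v0] net_rel_refl[OF r0] by blast
  have VW: "open (V \<times> W)" using assms by (simp add: open_Times)
  fix I assume "I \<in> {\<lambda>e x. LINT y:K|lborel. w e (x, y) * r e y |w r.
      w \<in> net_rel (V \<times> W) `` {v0} \<and> r \<in> net_rel W `` {r0}}"
  then obtain w r where w: "(v0, w) \<in> net_rel (V \<times> W)" and r: "(r0, r) \<in> net_rel W"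
    and I: "I = (kernel_net K w r)" by blast
  have rm: "r \<in> moderate_nets W" using r by (simp add: net_rel_def)
  have "(\<lambda>e z. w e z - v0 e z) \<in> negligible_nets (V \<times> W)"
    using net_rel_sym[OF VW w] by (simp add: net_rel_def)
  from negligible_kernel_integral[OF assms(1,2,4,5) this rm]
  have "(\<lambda>e x. (LINT y:K|lborel. (w e (x, y) - v0 e (x, y)) * r e y)
      + (kernel_net K v0 r e x - r e x)) \<in> negligible_nets V" (is "?n \<in> _")
    using negligible_nets_add[OF assms(1) _ repro[OF r]] by blast
  moreover have eq: "I e x - r e x = ?n e x" if "e \<in> {0<..1}" "x \<in> V" for e x
  proof -
    have s: "smooth_on (w e) (V \<times> W)" "smooth_on (v0 e) (V \<times> W)" "continuous_on K (r e)"
      using w v0 that(1) continuous_on_smooth_net[OF _ assms(5) that(1), of r] rm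
      by (auto simp: net_rel_def moderate_nets_def smooth_nets_def)
    have "(LINT y:K|lborel. (w e (x, y) - v0 e (x, y)) * r e y)
        = kernel_net K w r e x - kernel_net K v0 r e x"
      using set_integral_diff_compact[OF assms(4)
          kernel_integral(3)[OF assms(1,2,4,5) s(1,3) that(2), of "[]", simplified]
          kernel_integral(3)[OF assms(1,2,4,5) s(2,3) that(2), of "[]", simplified]]
      by (simp add: left_diff_distrib)
    then show ?thesis by (simp add: I)
  qed
  ultimately have "(\<lambda>e x. I e x - r e x) \<in> negligible_nets V"
    using negligible_nets_cong[where u = "\<lambda>e x. I e x - r e x" and v = ?n, OF assms(1)] by blast
  then have "(r, I) \<in> net_rel V"
    using net_relI[OF assms(1)] moderate_nets_subset[OF assms(1,3) rm] by blast
  then show "(r0, I) \<in> net_rel V"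
    using net_rel_trans[OF assms(1) net_rel_subset[OF assms(1,3) r]] by blast
qed

text \<open>Substitution y = x + h z. As \<open>cball x h\<close> lies in K, the domain K leaves no
  trace and the integral is over the unit ball.\<close>

lemma set_integral_mollifier:
  fixes f :: "'a::euclidean_space \<Rightarrow> 'k::euclidean_space"
  assumes "compact K" "continuous_on K f" "0 < h" "cball x h \<subseteq> K"
  shows "(LINT y:K|lborel. mollifier ((y - x) /\<^sub>R h) *\<^sub>R f y)
    = h ^ DIM('a) *\<^sub>R (LINT z:cball 0 1|lborel. mollifier z *\<^sub>R f (x + h *\<^sub>R z))"
proof -
  \<comment> \<open>Extended by 0 outside K, where f is arbitrary, so that the affine change of
    variables can be made for Lebesgue measure on the whole space.\<close>
  define G where "G = (\<lambda>y. indicator K y *\<^sub>R (mollifier ((y - x) /\<^sub>R h) *\<^sub>R f y))"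
  have cm: "continuous_on S (\<lambda>y. mollifier ((y - x) /\<^sub>R h))" for S
    by (rule continuous_on_compose2[OF smooth_on_continuous[OF smooth_on_mollifier]])
      (auto intro!: continuous_intros)
  have [measurable]: "G \<in> borel_measurable borel"
    unfolding G_def using assms
    by (intro borel_measurable_continuous_on_indicator continuous_on_scaleR cm) (auto simp: compact_imp_closed)
  have T [measurable]: "(\<lambda>z. x + h *\<^sub>R z) \<in> measurable lborel borel" by measurable
  have "(LINT y|lborel. G y) = (LINT y|density (distr lborel borel (\<lambda>z. x + h *\<^sub>R z)) (\<lambda>_. ennreal (h ^ DIM('a))). G y)"
    using lborel_affine[of h x] assms(3) by simp
  also have "\<dots> = (LINT y|distr lborel borel (\<lambda>z. x + h *\<^sub>R z). h ^ DIM('a) *\<^sub>R G y)"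
    using assms(3) by (subst integral_density) auto
  also have "\<dots> = (LINT z|lborel. h ^ DIM('a) *\<^sub>R G (x + h *\<^sub>R z))"
    by (subst integral_distr) auto
  also have "\<dots> = h ^ DIM('a) *\<^sub>R (LINT z|lborel. G (x + h *\<^sub>R z))" by simp
  also have "(\<lambda>z. G (x + h *\<^sub>R z)) = (\<lambda>z. indicator (cball 0 1) z *\<^sub>R (mollifier z *\<^sub>R f (x + h *\<^sub>R z)))"
  proof
    fix z
    show "G (x + h *\<^sub>R z) = indicator (cball 0 1) z *\<^sub>R (mollifier z *\<^sub>R f (x + h *\<^sub>R z))"
    proof (cases "norm z \<le> 1")
      case True
      then have "x + h *\<^sub>R z \<in> cball x h" using assms(3) by (simp add: dist_norm mult_le_cancel_left1)
      with True assms show ?thesis by (auto simp: G_def indicator_def)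
    next
      case False
      with assms(3) show ?thesis by (simp add: G_def mollifier_eq_0)
    qed
  qed
  finally show ?thesis by (simp add: G_def set_lebesgue_integral_def)
qed

section \<open>The reproducing kernel and the annihilating kernel\<close>

text \<open>Base 4 gives \<open>2 ^ m \<le> 1 / e\<close> and \<open>m * e \<le> sqrt e\<close> at the same time, where \<open>m = ord_of e\<close>.\<close>

definition ord_of :: "real \<Rightarrow> nat"
  where "ord_of e = nat \<lfloor>log 4 (1 / e)\<rfloor>"

lemma four_power_ord_of:
  assumes "e \<in> {0<..1}" shows "4 ^ ord_of e \<le> 1 / e"
proof -
  have l: "log 4 (1 / e) \<ge> 0" using assms by (intro zero_le_log_cancel_iff[THEN iffD2]) auto
  have "4 ^ ord_of e = (4::real) powr real (ord_of e)" by (simp add: powr_realpow)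
  also have "\<dots> \<le> 4 powr (log 4 (1 / e))"
    using l by (intro powr_mono) (simp_all add: ord_of_def)
  also have "\<dots> = 1 / e" using assms by simp
  finally show ?thesis .
qed

lemma two_power_ord_of:
  assumes "e \<in> {0<..1}" shows "2 ^ ord_of e \<le> 1 / e"
  using power_mono[of "2::real" 4 "ord_of e"] four_power_ord_of[OF assms] by linarith

text \<open>From m \<le> 2^m follows m^2 \<le> 4^m \<le> 1/e, hence (m e)^2 \<le> e.\<close>

lemma ord_of_mult_le_sqrt:
  assumes "e \<in> {0<..1}" shows "real (ord_of e) * e \<le> sqrt e"
proof (rule real_le_rsqrt)
  have "real (ord_of e) \<le> 2 ^ ord_of e" using of_nat_less_two_power[of "ord_of e"] by simp
  then have "real (ord_of e) ^ 2 \<le> (2 ^ ord_of e) ^ 2" by (intro power_mono) auto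
  also have "\<dots> = 4 ^ ord_of e" by (simp add: power2_eq_square power_mult_distrib[symmetric])
  also have "\<dots> \<le> 1 / e" by (rule four_power_ord_of[OF assms])
  finally have "real (ord_of e) ^ 2 * e ^ 2 \<le> 1 / e * e ^ 2" by (rule mult_right_mono) simp
  then show "(real (ord_of e) * e)\<^sup>2 \<le> e" using assms by (simp add: power_mult_distrib power2_eq_square)
qed

lemma eventually_ord_of_ge: "\<forall>\<^sub>F e in at_right 0. q \<le> ord_of e"
proof -
  have "\<forall>\<^sub>F e::real in at_right 0. e \<in> {0<..<1 / 4 ^ q}" by (rule eventually_at_right_real) simp
  then show ?thesis
  proof (rule eventually_mono)
    fix e :: real assume e: "e \<in> {0<..<1 / 4 ^ q}"
    then have "(4::real) powr real q \<le> 1 / e" by (simp add: powr_realpow field_simps)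
    then have "real q \<le> log 4 (1 / e)" using e by (subst le_log_iff) auto
    then show "q \<le> ord_of e" unfolding ord_of_def by linarith
  qed
qed

text \<open>The two kernels reach no farther than m e from x and m e + e^2 from p e, respectively,
  so a single expression controls both.\<close>

lemma eventually_small:
  assumes "\<delta> > 0"
  shows "\<forall>\<^sub>F e in at_right 0. real (ord_of e) * e + e\<^sup>2 < \<delta>"
proof -
  have "((\<lambda>e. sqrt e + e\<^sup>2) \<longlongrightarrow> sqrt 0 + 0\<^sup>2) (at_right 0)"
    by (intro tendsto_intros)
  then have "\<forall>\<^sub>F e in at_right 0. sqrt e + e\<^sup>2 < \<delta>"
    using assms by (intro order_tendstoD(2)[where y = "sqrt 0 + 0\<^sup>2"]) auto
  then show ?thesis
    using eventually_unit_interval by eventually_elim (use ord_of_mult_le_sqrt in force)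
qed

section \<open>Sums of rescaled mollifiers\<close>

definition kmoll :: "'a::euclidean_space \<Rightarrow> 'k::{real_normed_field, euclidean_space}"
  where "kmoll z = of_real (mollifier z)"

lemma smooth_on_kmoll: "smooth_on kmoll UNIV"
  using smooth_on_linear[OF open_UNIV smooth_on_mollifier bounded_linear_of_real]
  by (simp add: kmoll_def[abs_def])

lemma kmoll_eq_0: "norm z \<ge> 1 \<Longrightarrow> kmoll z = 0"
  by (simp add: kmoll_def mollifier_eq_0)

text \<open>The words consist of arbitrary vectors because the projections used below turn basis
  vectors of the product into letters such as -b or 0.\<close>

lemma iter_partial_kmoll_bounded:
  fixes ws :: "'a::euclidean_space list"
  obtains C where "C \<ge> 0" "\<And>z. norm (iter_partial ws kmoll z :: 'k::{real_normed_field, euclidean_space}) \<le> C"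
proof -
  have "continuous_on (cball 0 1) (\<lambda>z. norm (iter_partial ws kmoll z :: 'k))"
    using smooth_on_continuous[OF smooth_on_iter_partial[OF open_UNIV smooth_on_kmoll]]
    by (intro continuous_on_norm) (rule continuous_on_subset, auto)
  then have "bounded ((\<lambda>z. norm (iter_partial ws kmoll z :: 'k)) ` cball 0 1)"
    by (intro compact_imp_bounded compact_continuous_image compact_cball)
  then obtain C where C: "\<And>z. z \<in> cball 0 1 \<Longrightarrow> norm (iter_partial ws kmoll z :: 'k) \<le> C"
    unfolding bounded_iff by (metis imageI real_norm_def abs_norm_cancel)
  have "norm (iter_partial ws kmoll z :: 'k) \<le> max C 0" for z
  proof (cases "norm z \<le> 1")
    case True
    with C[of z] show ?thesis by simp
  next
    case False
    \<comment> \<open>The complement of the closed ball is an open set on which \<open>kmoll\<close>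
      is 0, so its derivatives vanish there as well.\<close>
    have "iter_partial ws kmoll z = iter_partial ws (\<lambda>_. 0 :: 'k) z"
      by (rule iter_partial_cong[of "- cball 0 1"]) (use False in \<open>auto simp: open_Compl kmoll_eq_0\<close>)
    then show ?thesis by (simp add: iter_partial_zero)
  qed
  then show thesis using that[of "max C 0"] by simp
qed

lemma mollifier_bounded:
  obtains M where "M \<ge> 0" "\<And>z :: 'a::euclidean_space. mollifier z \<le> M"
proof -
  obtain C where "C \<ge> 0" "\<And>z :: 'a. norm (iter_partial [] kmoll z :: real) \<le> C"
    using iter_partial_kmoll_bounded[where 'k = real] by blast
  then show thesis using that[of C] abs_le_D1 by (auto simp: kmoll_def)
qed

lemma smooth_on_kmoll_sum:
  fixes P :: "'b::euclidean_space \<Rightarrow> 'a::euclidean_space"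
  assumes "bounded_linear P" "open W"
  shows "smooth_on (\<lambda>z. \<Sum>j\<in>J. c j *\<^sub>R kmoll (s j *\<^sub>R P z + d j)) W"
  by (intro smooth_on_sum smooth_on_scaleR assms(2) smooth_on_affine[where M = "\<lambda>z. s _ *\<^sub>R P z" and U = UNIV]
      smooth_on_kmoll bounded_linear_compose[OF bounded_linear_scaleR_right assms(1)] open_UNIV UNIV_I)

lemma iter_partial_kmoll_sum:
  fixes P :: "'b::euclidean_space \<Rightarrow> 'a::euclidean_space"
  assumes P: "bounded_linear P"
  shows "iter_partial ws (\<lambda>z. \<Sum>j\<in>J. c j *\<^sub>R kmoll (s j *\<^sub>R P z + d j)) z
    = (\<Sum>j\<in>J. (c j * s j ^ length ws) *\<^sub>R (iter_partial (map P ws) kmoll (s j *\<^sub>R P z + d j) :: 'k::{real_normed_field, euclidean_space}))"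
proof -
  have B: "bounded_linear (\<lambda>z. s j *\<^sub>R P z)" for j
    using bounded_linear_compose[OF bounded_linear_scaleR_right P] .
  have sm: "smooth_on (\<lambda>z. kmoll (s j *\<^sub>R P z + d j) :: 'k) UNIV" for j
    by (rule smooth_on_affine[OF B open_UNIV open_UNIV UNIV_I smooth_on_kmoll])
  have "iter_partial ws (\<lambda>z. \<Sum>j\<in>J. c j *\<^sub>R (kmoll (s j *\<^sub>R P z + d j) :: 'k)) z
      = (\<Sum>j\<in>J. iter_partial ws (\<lambda>z. c j *\<^sub>R (kmoll (s j *\<^sub>R P z + d j) :: 'k)) z)"
    by (rule iter_partial_sum[OF open_UNIV smooth_on_scaleR[OF open_UNIV sm] UNIV_I])
  also have "\<dots> = (\<Sum>j\<in>J. c j *\<^sub>R iter_partial ws (\<lambda>z. kmoll (s j *\<^sub>R P z + d j) :: 'k) z)"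
    by (intro sum.cong refl iter_partial_scaleR[OF open_UNIV sm UNIV_I])
  also have "\<dots> = (\<Sum>j\<in>J. (c j * s j ^ length ws) *\<^sub>R (iter_partial (map P ws) kmoll (s j *\<^sub>R P z + d j) :: 'k))"
  proof (rule sum.cong[OF refl])
    fix j
    have "iter_partial ws (\<lambda>z. kmoll (s j *\<^sub>R P z + d j) :: 'k) z
        = iter_partial (map (\<lambda>w. s j *\<^sub>R w) (map P ws)) (kmoll :: 'a \<Rightarrow> 'k) (s j *\<^sub>R P z + d j)"
      using iter_partial_affine[OF B open_UNIV open_UNIV UNIV_I smooth_on_kmoll UNIV_I]
      by (simp add: o_def)
    also have "\<dots> = s j ^ length ws *\<^sub>R iter_partial (map P ws) (kmoll :: 'a \<Rightarrow> 'k) (s j *\<^sub>R P z + d j)"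
      using iter_partial_scaleR_dir[OF open_UNIV smooth_on_kmoll UNIV_I, of "s j" "map P ws"] by simp
    finally show "c j *\<^sub>R iter_partial ws (\<lambda>z. kmoll (s j *\<^sub>R P z + d j) :: 'k) z
        = (c j * s j ^ length ws) *\<^sub>R iter_partial (map P ws) kmoll (s j *\<^sub>R P z + d j)" by simp
  qed
  finally show ?thesis .
qed

text \<open>The common shape of both kernels: P extracts the variable that a kernel depends on, y -
  x or y. Each derivative costs a factor (1/e)^B from the scaling. The weights enter only through
  their sum, so it does no harm that the number of terms is unbounded as e tends to 0.\<close>

lemma moderate_nets_kmoll_sum:
  fixes P :: "'b::euclidean_space \<Rightarrow> 'a::euclidean_space"
    and u :: "('b, 'k::{real_normed_field, euclidean_space}) net"
  assumes P: "bounded_linear P" and W: "open W"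
    and u: "\<And>e. e \<in> {0<..1} \<Longrightarrow> u e = (\<lambda>z. \<Sum>j\<in>J e. c e j *\<^sub>R kmoll (s e j *\<^sub>R P z + d e j))"
    and c: "\<And>e. e \<in> {0<..1} \<Longrightarrow> (\<Sum>j\<in>J e. \<bar>c e j\<bar>) \<le> (1 / e) ^ A"
    and s: "\<And>e j. e \<in> {0<..1} \<Longrightarrow> j \<in> J e \<Longrightarrow> \<bar>s e j\<bar> \<le> (1 / e) ^ B"
  shows "u \<in> moderate_nets W"
proof -
  have "u \<in> smooth_nets W"
    using smooth_on_kmoll_sum[OF P W] u by (auto simp: smooth_nets_def)
  moreover have "\<exists>N::nat. net_bound K ws u (\<lambda>e. e powr (- real N))" for K ws
  proof -
    obtain C where C: "C \<ge> 0" "\<And>z. norm (iter_partial (map P ws) kmoll z :: 'k) \<le> C"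
      using iter_partial_kmoll_bounded by blast
    define N where "N = A + B * length ws"
    have "\<forall>\<^sub>F e in at_right 0. \<forall>z\<in>K. norm (iter_partial ws (u e) z) \<le> C * e powr (- real N)"
      using eventually_unit_interval
    proof eventually_elim
      case (elim e)
      have "norm (iter_partial ws (u e) z) \<le> C * e powr (- real N)" for z
      proof -
        have "norm (iter_partial ws (u e) z) \<le> (\<Sum>j\<in>J e. \<bar>c e j\<bar> * (((1 / e) ^ B) ^ length ws * C))"
          unfolding u[OF elim] iter_partial_kmoll_sum[OF P]
        proof (rule sum_norm_le)
          fix j assume "j \<in> J e"
          then have "\<bar>s e j\<bar> ^ length ws \<le> ((1 / e) ^ B) ^ length ws"
            using s[OF elim] by (intro power_mono) auto
          then show "norm ((c e j * s e j ^ length ws) *\<^sub>R iter_partial (map P ws) kmoll (s e j *\<^sub>R P z + d e j) :: 'k)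
              \<le> \<bar>c e j\<bar> * (((1 / e) ^ B) ^ length ws * C)"
            using C elim by (simp add: abs_mult power_abs mult.assoc mult_left_mono mult_mono)
        qed
        also have "\<dots> = (\<Sum>j\<in>J e. \<bar>c e j\<bar>) * (((1 / e) ^ B) ^ length ws * C)"
          by (simp add: sum_distrib_right)
        also have "\<dots> \<le> (1 / e) ^ A * (((1 / e) ^ B) ^ length ws * C)"
          using c[OF elim] C(1) elim by (intro mult_right_mono) auto
        also have "\<dots> = C * (1 / e) ^ N"
          by (simp add: N_def power_add power_mult)
        also have "(1 / e) ^ N = e powr (- real N)"
          using elim by (simp add: powr_minus powr_realpow power_one_over inverse_eq_divide)
        finally show ?thesis .
      qed
      then show ?case by blast
    qed
    then show ?thesis unfolding net_bound_def by blast
  qed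
  ultimately show ?thesis unfolding moderate_nets_iff[OF W] by blast
qed

text \<open>The power of \<open>real j * e\<close> gives each bump integral 1. The remaining weights
  sum to 1 when m \<ge> 1, because the alternating sum over all j \<ge> 0 vanishes; for e > 1/4 one
  has m = 0 and the kernel is 0.\<close>

definition delta_net :: "('a::euclidean_space \<times> 'a, 'k::{real_normed_field, euclidean_space}) net"
  where "delta_net e z = (\<Sum>j\<in>{1..ord_of e}. (- alt_binom (ord_of e) j / (real j * e) ^ DIM('a)) *\<^sub>R
    kmoll ((snd z - fst z) /\<^sub>R (real j * e)))"

text \<open>The bumps are not normalised: the value at the centre, not the mass, has to persist as e
  tends to 0. Since \<open>fst z\<close> is absent, all slices are equal and integration against a
  net gives a function constant in x.\<close>

definition wave_net ::
    "(real \<Rightarrow> 'a) \<Rightarrow> 'a \<Rightarrow> ('c::euclidean_space \<times> 'a::euclidean_space, 'k::{real_normed_field, euclidean_space}) net"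
  where "wave_net p b e z = (\<Sum>j\<le>ord_of e. alt_binom (ord_of e) j *\<^sub>R
    kmoll ((snd z - (p e + real j *\<^sub>R (e *\<^sub>R b))) /\<^sub>R e\<^sup>2))"

text \<open>One power in A pays for the total weight 2^m \<le> 1/e and \<open>DIM('a)\<close> powers
  for the normalising factors, which are largest at j = 1. The scale 1/(j e) gives B = 1.\<close>

lemma moderate_delta_net:
  fixes W :: "('a::euclidean_space \<times> 'a) set"
  assumes "open W"
  shows "(delta_net :: ('a \<times> 'a, 'k::{real_normed_field, euclidean_space}) net) \<in> moderate_nets W"
proof (rule moderate_nets_kmoll_sum[where P = "\<lambda>z. snd z - fst z" and J = "\<lambda>e. {1..ord_of e}"
      and s = "\<lambda>e j. inverse (real j * e)" and d = "\<lambda>_ _. 0"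
      and c = "\<lambda>e j. - alt_binom (ord_of e) j / (real j * e) ^ DIM('a)" and A = "1 + DIM('a)" and B = 1])
  show "bounded_linear (\<lambda>z::'a \<times> 'a. snd z - fst z)"
    by (intro bounded_linear_sub bounded_linear_snd bounded_linear_fst)
  fix e :: real assume e: "e \<in> {0<..1}"
  show "(delta_net e :: 'a \<times> 'a \<Rightarrow> 'k) = (\<lambda>z. \<Sum>j\<in>{1..ord_of e}. (- alt_binom (ord_of e) j / (real j * e) ^ DIM('a)) *\<^sub>R
      kmoll (inverse (real j * e) *\<^sub>R (snd z - fst z) + 0))"
    by (simp add: delta_net_def fun_eq_iff)
  have je: "1 / (real j * e) \<le> 1 / e" if "j \<in> {1..ord_of e}" for j
    using e that by (intro divide_left_mono) auto
  show "\<bar>inverse (real j * e)\<bar> \<le> (1 / e) ^ 1" if "j \<in> {1..ord_of e}" for j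
    using je[OF that] e by (simp add: inverse_eq_divide)
  have "(\<Sum>j\<in>{1..ord_of e}. \<bar>- alt_binom (ord_of e) j / (real j * e) ^ DIM('a)\<bar>)
      \<le> (\<Sum>j\<in>{1..ord_of e}. \<bar>alt_binom (ord_of e) j\<bar> * (1 / e) ^ DIM('a))"
  proof (rule sum_mono)
    fix j assume j: "j \<in> {1..ord_of e}"
    have "(1 / (real j * e)) ^ DIM('a) \<le> (1 / e) ^ DIM('a)"
      using je[OF j] e by (intro power_mono) auto
    from mult_left_mono[OF this, of "\<bar>alt_binom (ord_of e) j\<bar>"]
    show "\<bar>- alt_binom (ord_of e) j / (real j * e) ^ DIM('a)\<bar> \<le> \<bar>alt_binom (ord_of e) j\<bar> * (1 / e) ^ DIM('a)"
      using e by (simp add: power_one_over abs_mult)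
  qed
  also have "\<dots> = (\<Sum>j\<in>{1..ord_of e}. \<bar>alt_binom (ord_of e) j\<bar>) * (1 / e) ^ DIM('a)"
    by (simp add: sum_distrib_right)
  also have "\<dots> \<le> 1 / e * (1 / e) ^ DIM('a)"
  proof (rule mult_right_mono)
    have "(\<Sum>j\<in>{1..ord_of e}. \<bar>alt_binom (ord_of e) j\<bar>) \<le> (\<Sum>j\<le>ord_of e. \<bar>alt_binom (ord_of e) j\<bar>)"
      by (rule sum_mono2) auto
    then show "(\<Sum>j\<in>{1..ord_of e}. \<bar>alt_binom (ord_of e) j\<bar>) \<le> 1 / e"
      using two_power_ord_of[OF e] by (simp add: sum_abs_alt_binom)
  qed (use e in auto)
  finally show "(\<Sum>j\<in>{1..ord_of e}. \<bar>- alt_binom (ord_of e) j / (real j * e) ^ DIM('a)\<bar>) \<le> (1 / e) ^ (1 + DIM('a))"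
    by simp
qed (rule assms)

text \<open>The total weight 2^m \<le> 1/e gives A = 1 and the width e^2 gives B = 2. The centres
  enter only as translations and may vary with e in any way.\<close>

lemma moderate_wave_net:
  fixes W :: "('c::euclidean_space \<times> 'a::euclidean_space) set"
  assumes "open W"
  shows "(wave_net p b :: ('c \<times> 'a, 'k::{real_normed_field, euclidean_space}) net) \<in> moderate_nets W"
proof (rule moderate_nets_kmoll_sum[where P = snd and J = "\<lambda>e. {..ord_of e}"
      and s = "\<lambda>e j. inverse (e\<^sup>2)" and d = "\<lambda>e j. - ((p e + real j *\<^sub>R (e *\<^sub>R b)) /\<^sub>R e\<^sup>2)"
      and c = "\<lambda>e j. alt_binom (ord_of e) j" and A = 1 and B = 2])
  fix e :: real assume e: "e \<in> {0<..1}"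
  show "(wave_net p b e :: 'c \<times> 'a \<Rightarrow> 'k) = (\<lambda>z. \<Sum>j\<in>{..ord_of e}. alt_binom (ord_of e) j *\<^sub>R
      kmoll (inverse (e\<^sup>2) *\<^sub>R snd z + - ((p e + real j *\<^sub>R (e *\<^sub>R b)) /\<^sub>R e\<^sup>2)))"
    by (simp add: wave_net_def fun_eq_iff scaleR_right_diff_distrib)
  show "(\<Sum>j\<in>{..ord_of e}. \<bar>alt_binom (ord_of e) j\<bar>) \<le> (1 / e) ^ 1"
    using two_power_ord_of[OF e] by (simp add: sum_abs_alt_binom)
  show "\<bar>inverse (e\<^sup>2)\<bar> \<le> (1 / e) ^ 2" for j :: nat
    by (simp add: power_one_over inverse_eq_divide)
qed (rule assms bounded_linear_snd)+

lemma delta_net_eq_0: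
  assumes "e \<in> {0<..1}" "real (ord_of e) * e \<le> norm (y - x)"
  shows "delta_net e (x, y) = (0 :: 'k::{real_normed_field, euclidean_space})"
proof -
  have "kmoll ((y - x) /\<^sub>R (real j * e)) = (0 :: 'k)" if "j \<in> {1..ord_of e}" for j
  proof (rule kmoll_eq_0)
    have "real j * e \<le> real (ord_of e) * e" using that assms(1) by (intro mult_right_mono) auto
    with assms(2) have "real j * e \<le> norm (y - x)" by linarith
    then show "norm ((y - x) /\<^sub>R (real j * e)) \<ge> 1" using that assms(1)
      unfolding norm_scaleR abs_inverse by (simp add: divide_inverse[symmetric] mult.commute[of "inverse _"])
  qed
  then show ?thesis by (simp add: delta_net_def del: inverse_mult_distrib scaleR_minus_left)
qed

text \<open>The farthest bump is centred at distance m e from p e and has radius e^2.\<close>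

lemma wave_net_eq_0:
  assumes "e \<in> {0<..1}" "norm b = 1" "real (ord_of e) * e + e\<^sup>2 \<le> norm (y - p e)"
  shows "wave_net p b e (x, y) = (0 :: 'k::{real_normed_field, euclidean_space})"
proof -
  have "kmoll ((y - (p e + real j *\<^sub>R (e *\<^sub>R b))) /\<^sub>R e\<^sup>2) = (0 :: 'k)" if "j \<le> ord_of e" for j
  proof (rule kmoll_eq_0)
    have "real j * e \<le> real (ord_of e) * e" using that assms(1) by (intro mult_right_mono) auto
    moreover have "norm (y - p e) - norm (real j *\<^sub>R (e *\<^sub>R b)) \<le> norm (y - p e - real j *\<^sub>R (e *\<^sub>R b))"
      by (rule norm_triangle_ineq2)
    moreover have "norm (real j *\<^sub>R (e *\<^sub>R b)) = real j * e" using assms by simp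
    ultimately have "e\<^sup>2 \<le> norm (y - (p e + real j *\<^sub>R (e *\<^sub>R b)))"
      using assms(3) unfolding diff_diff_eq by linarith
    then show "norm ((y - (p e + real j *\<^sub>R (e *\<^sub>R b))) /\<^sub>R e\<^sup>2) \<ge> 1" using assms(1)
      unfolding norm_scaleR abs_inverse by (simp add: divide_inverse[symmetric] mult.commute[of "inverse _"])
  qed
  then show ?thesis by (simp add: wave_net_def)
qed

text \<open>The bumps with j \<ge> 1 are centred at distance j e \<ge> e^2 from p e, so only j = 0
  contributes. The mollifier vanishes on the unit sphere too, which covers e = 1.\<close>

lemma wave_net_at_center:
  fixes p :: "real \<Rightarrow> 'a::euclidean_space"
  assumes "e \<in> {0<..1}" "norm b = 1"
  shows "wave_net p b e (x, p e) = (kmoll (0 :: 'a) :: 'k::{real_normed_field, euclidean_space})"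
proof -
  have "kmoll ((p e - (p e + real j *\<^sub>R (e *\<^sub>R b))) /\<^sub>R e\<^sup>2) = (if j = 0 then kmoll (0 :: 'a) else 0 :: 'k)" for j
  proof (cases "j = 0")
    case False
    have "e * e \<le> real j * e" using False assms(1) by (intro mult_right_mono) auto
    moreover have "norm (p e - (p e + real j *\<^sub>R (e *\<^sub>R b))) = real j * e" using assms by simp
    ultimately have "norm ((p e - (p e + real j *\<^sub>R (e *\<^sub>R b))) /\<^sub>R e\<^sup>2) \<ge> 1"
      using assms(1) unfolding norm_scaleR abs_inverse
      by (simp add: divide_inverse[symmetric] mult.commute[of "inverse _"] power2_eq_square)
    then have "kmoll ((p e - (p e + real j *\<^sub>R (e *\<^sub>R b))) /\<^sub>R e\<^sup>2) = (0::'k)" by (rule kmoll_eq_0)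
    with False show ?thesis by simp
  qed simp
  then show ?thesis by (simp add: wave_net_def if_distrib[of "\<lambda>x. _ *\<^sub>R x"] cong: if_cong)
qed

section \<open>Estimates for the two kernels\<close>

lemma continuous_on_kmoll_affine: "continuous_on S (\<lambda>y. kmoll ((y - x) /\<^sub>R h))"
  by (rule continuous_on_compose2[OF smooth_on_continuous[OF smooth_on_kmoll]])
    (auto intro!: continuous_intros)

lemma set_integral_kmoll:
  fixes f :: "'a::euclidean_space \<Rightarrow> 'k::{real_normed_field, euclidean_space}"
  assumes "compact K" "continuous_on K f" "0 < h" "cball x h \<subseteq> K"
  shows "(LINT y:K|lborel. (c *\<^sub>R kmoll ((y - x) /\<^sub>R h)) * f y)
    = (c * h ^ DIM('a)) *\<^sub>R (LINT z:cball 0 1|lborel. mollifier z *\<^sub>R f (x + h *\<^sub>R z))"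
proof -
  have "(LINT y:K|lborel. (c *\<^sub>R kmoll ((y - x) /\<^sub>R h)) * f y)
      = (LINT y:K|lborel. c *\<^sub>R (mollifier ((y - x) /\<^sub>R h) *\<^sub>R f y))"
    by (simp add: kmoll_def scaleR_conv_of_real mult_ac)
  also have "\<dots> = c *\<^sub>R (LINT y:K|lborel. mollifier ((y - x) /\<^sub>R h) *\<^sub>R f y)"
    by (rule set_integral_scaleR_right)
  finally show ?thesis using set_integral_mollifier[OF assms] by simp
qed

lemma continuous_on_mollifier_comp:
  fixes f :: "'a::euclidean_space \<Rightarrow> 'k::euclidean_space" and g :: "'a \<Rightarrow> 'a"
  assumes "continuous_on K f" "continuous_on (cball 0 1) g" "\<And>z. norm z \<le> 1 \<Longrightarrow> g z \<in> K"
  shows "continuous_on (cball 0 1) (\<lambda>z. mollifier z *\<^sub>R f (g z))"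
proof (rule continuous_on_scaleR)
  show "continuous_on (cball 0 1) (mollifier :: 'a \<Rightarrow> real)"
    using smooth_on_continuous[OF smooth_on_mollifier] continuous_on_subset by blast
  show "continuous_on (cball 0 1) (\<lambda>z. f (g z))"
    by (rule continuous_on_compose2[OF assms(1,2)]) (use assms(3) in auto)
qed

lemma fin_diff_split:
  "fin_diff m f h x = f x + (\<Sum>j\<in>{1..m}. alt_binom m j *\<^sub>R f (x + real j *\<^sub>R h))"
proof -
  have "{..m} = insert 0 {1..m}" by auto
  then show ?thesis by (simp add: fin_diff_def)
qed

text \<open>In the j-th term y = P j + h j z carries the bump to the unit ball, so all terms combine
  into one integral over the same ball. Continuity of S is recorded because splitting or bounding
  that integral requires it.\<close>

lemma set_integral_kmoll_sum:
  fixes f :: "'a::euclidean_space \<Rightarrow> 'k::{real_normed_field, euclidean_space}" and P :: "'i \<Rightarrow> 'a" and c :: "'i \<Rightarrow> real"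
  assumes K: "compact K" "continuous_on K f"
    and h: "\<And>j. j \<in> J \<Longrightarrow> 0 < h j" "\<And>j. j \<in> J \<Longrightarrow> cball (P j) (h j) \<subseteq> K"
  defines "S \<equiv> (\<lambda>z. \<Sum>j\<in>J. (c j * h j ^ DIM('a)) *\<^sub>R (mollifier z *\<^sub>R f (P j + h j *\<^sub>R z)))"
  shows "(LINT y:K|lborel. (\<Sum>j\<in>J. c j *\<^sub>R kmoll ((y - P j) /\<^sub>R h j)) * f y) = (LINT z:cball 0 1|lborel. S z)"
    and "continuous_on (cball 0 1) S"
proof -
  have ct: "continuous_on (cball 0 1) (\<lambda>z. (c j * h j ^ DIM('a)) *\<^sub>R (mollifier z *\<^sub>R f (P j + h j *\<^sub>R z)))"
    if j: "j \<in> J" for j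
  proof (rule continuous_on_scaleR[OF continuous_on_const continuous_on_mollifier_comp[OF K(2)]])
    show "continuous_on (cball 0 1) (\<lambda>z. P j + h j *\<^sub>R z)" by (intro continuous_intros)
    fix z :: 'a assume "norm z \<le> 1"
    then have "P j + h j *\<^sub>R z \<in> cball (P j) (h j)" using h(1)[OF j] by (simp add: dist_norm mult_left_le)
    then show "P j + h j *\<^sub>R z \<in> K" using h(2)[OF j] by blast
  qed
  show "continuous_on (cball 0 1) S" unfolding S_def by (rule continuous_on_sum[OF ct])
  have "(LINT y:K|lborel. (\<Sum>j\<in>J. c j *\<^sub>R kmoll ((y - P j) /\<^sub>R h j)) * f y)
      = (\<Sum>j\<in>J. LINT y:K|lborel. (c j *\<^sub>R kmoll ((y - P j) /\<^sub>R h j)) * f y)"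
    unfolding sum_distrib_right
    by (intro set_integral_sum_compact K(1) continuous_on_mult K(2) continuous_on_scaleR
        continuous_on_const continuous_on_kmoll_affine)
  also have "\<dots> = (\<Sum>j\<in>J. LINT z:cball 0 1|lborel. (c j * h j ^ DIM('a)) *\<^sub>R (mollifier z *\<^sub>R f (P j + h j *\<^sub>R z)))"
    unfolding set_integral_scaleR_right by (intro sum.cong refl set_integral_kmoll K h)
  also have "\<dots> = (LINT z:cball 0 1|lborel. S z)"
    unfolding S_def by (rule set_integral_sum_compact[OF compact_cball ct, symmetric])
  finally show "(LINT y:K|lborel. (\<Sum>j\<in>J. c j *\<^sub>R kmoll ((y - P j) /\<^sub>R h j)) * f y) = (LINT z:cball 0 1|lborel. S z)" .
qed

text \<open>The finite difference has the term f x at j = 0, and the kernel carries the other terms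
  with opposite sign. So the average against the kernel is f x, the mollifier having integral 1,
  minus the average of the full finite difference.\<close>

lemma delta_net_integral:
  fixes f :: "'a::euclidean_space \<Rightarrow> 'k::{real_normed_field, euclidean_space}"
  assumes e: "e \<in> {0<..1}" and K: "compact K" "continuous_on K f" "cball x (real (ord_of e) * e) \<subseteq> K"
  shows "(LINT y:K|lborel. delta_net e (x, y) * f y)
    = f x - (LINT z:cball 0 1|lborel. mollifier z *\<^sub>R fin_diff (ord_of e) f (e *\<^sub>R z) x)"
proof -
  define m where "m = ord_of e"
  define S where "S = (\<lambda>z. \<Sum>j\<in>{1..m}. (- alt_binom m j / (real j * e) ^ DIM('a) * (real j * e) ^ DIM('a)) *\<^sub>R
    (mollifier z *\<^sub>R f (x + (real j * e) *\<^sub>R z)))"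
  have h: "0 < real j * e" if "j \<in> {1..m}" for j using that e by simp
  have sub: "cball x (real j * e) \<subseteq> K" if "j \<in> {1..m}" for j
  proof -
    have "real j * e \<le> real m * e" using that e by (intro mult_right_mono) auto
    then show ?thesis using K(3) subset_cball[of "real j * e" "real m * e" x] by (auto simp: m_def)
  qed
  note S = set_integral_kmoll_sum[where J = "{1..m}" and h = "\<lambda>j. real j * e" and P = "\<lambda>j. x"
      and c = "\<lambda>j. - alt_binom m j / (real j * e) ^ DIM('a)", OF K(1,2), folded S_def]
  have eq: "mollifier z *\<^sub>R fin_diff m f (e *\<^sub>R z) x = mollifier z *\<^sub>R f x - S z" for z
  proof -
    \<comment> \<open>The normalising factor of the bump cancels the Jacobian
      \<open>(real j * e) ^ DIM('a)\<close>.\<close>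
    have "S z = (\<Sum>j\<in>{1..m}. - (mollifier z *\<^sub>R alt_binom m j *\<^sub>R f (x + real j *\<^sub>R (e *\<^sub>R z))))"
      unfolding S_def using e by (intro sum.cong refl) (auto simp: mult.commute)
    then show ?thesis by (simp only: fin_diff_split scaleR_right_distrib scaleR_sum_right sum_negf) simp
  qed
  have c: "continuous_on (cball 0 1) (\<lambda>z::'a. mollifier z *\<^sub>R f x)"
    by (intro continuous_on_scaleR continuous_on_const
        continuous_on_subset[OF smooth_on_continuous[OF smooth_on_mollifier] subset_UNIV])
  have "(LINT z:cball 0 1|lborel. mollifier z *\<^sub>R fin_diff m f (e *\<^sub>R z) x)
      = (LINT z:cball (0::'a) 1|lborel. mollifier z *\<^sub>R f x) - (LINT z:cball 0 1|lborel. S z)"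
    unfolding eq by (rule set_integral_diff_compact[OF compact_cball c S(2)]) (use h sub in auto)
  also have "(LINT z:cball (0::'a) 1|lborel. mollifier z *\<^sub>R f x) = f x"
    using set_integral_scaleR_left[of "cball (0::'a) 1" lborel "f x" mollifier] integrable_bump[where 'a='a]
      integral_mollifier[where 'a='a] by (simp add: mollifier_def[abs_def])
  also have "(LINT z:cball 0 1|lborel. S z) = (LINT y:K|lborel. delta_net e (x, y) * f y)"
    using S(1) h sub unfolding delta_net_def m_def[symmetric] fst_conv snd_conv by simp
  finally show ?thesis by (simp add: m_def)
qed

text \<open>All bumps have the same radius, so the Jacobian comes out of the sum and what remains is
  a finite difference with step e b, based at p e + e^2 z.\<close>

lemma wave_net_integral:
  fixes f :: "'a::euclidean_space \<Rightarrow> 'k::{real_normed_field, euclidean_space}"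
  assumes e: "e \<in> {0<..1}" "norm b = 1"
    and K: "compact K" "continuous_on K f" "cball (p e) (real (ord_of e) * e + e\<^sup>2) \<subseteq> K"
  defines "D \<equiv> (\<lambda>z. mollifier z *\<^sub>R fin_diff (ord_of e) f (e *\<^sub>R b) (p e + e\<^sup>2 *\<^sub>R z))"
  shows "(LINT y:K|lborel. wave_net p b e (x, y) * f y) = (e\<^sup>2) ^ DIM('a) *\<^sub>R (LINT z:cball 0 1|lborel. D z)"
    and "continuous_on (cball 0 1) D"
proof -
  define m where "m = ord_of e"
  define P where "P = (\<lambda>j. p e + real j *\<^sub>R (e *\<^sub>R b))"
  have sub: "cball (P j) (e\<^sup>2) \<subseteq> K" if "j \<in> {..m}" for j
  proof -
    have "real j * e \<le> real m * e" using that e by (intro mult_right_mono) auto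
    moreover have "dist (P j) (p e) = real j * e" using e by (simp add: P_def dist_norm)
    ultimately have "cball (P j) (e\<^sup>2) \<subseteq> cball (p e) (real m * e + e\<^sup>2)"
      by (simp add: cball_subset_cball_iff)
    then show ?thesis using K(3) by (simp add: m_def)
  qed
  have h: "0 < e\<^sup>2" using e by simp
  have D: "(\<Sum>j\<in>{..m}. (alt_binom m j * a) *\<^sub>R (mollifier z *\<^sub>R f (P j + e\<^sup>2 *\<^sub>R z))) = a *\<^sub>R D z" for z a
    by (simp add: D_def P_def m_def fin_diff_def scaleR_sum_right algebra_simps)
  note S = set_integral_kmoll_sum[where J = "{..m}" and P = P and h = "\<lambda>j. e\<^sup>2", OF K(1,2) h sub]
  show "(LINT y:K|lborel. wave_net p b e (x, y) * f y) = (e\<^sup>2) ^ DIM('a) *\<^sub>R (LINT z:cball 0 1|lborel. D z)"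
    using S(1)[of "alt_binom m"] unfolding D set_integral_scaleR_right by (simp add: wave_net_def m_def P_def)
  have "continuous_on (cball 0 1) (\<lambda>z. (e\<^sup>2) ^ DIM('a) *\<^sub>R D z)"
    using S(2)[of "alt_binom m"] unfolding D by simp
  from continuous_on_scaleR[OF continuous_on_const[of _ "inverse ((e\<^sup>2) ^ DIM('a))"] this]
  show "continuous_on (cball 0 1) D" using e by simp
qed

text \<open>F is the reproduction error of the first kernel. Differentiation in x commutes with the
  integral and with translations, so a derivative of F is the same average for a derivative of r,
  and \<open>norm_fin_diff_le\<close> applies to \<open>iter_partial ws r\<close>. U has to contain
  the whole segments x + t e z, not only their points with integer t.\<close>

lemma mollified_fin_diff:
  fixes r :: "'a::euclidean_space \<Rightarrow> 'k::euclidean_space"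
  assumes "open V" "open U" "smooth_on r U" "e > 0"
    and inU: "\<And>x z t. x \<in> V \<Longrightarrow> norm z \<le> 1 \<Longrightarrow> t \<in> {0..real m} \<Longrightarrow> x + t *\<^sub>R (e *\<^sub>R z) \<in> U"
  defines "F \<equiv> (\<lambda>x. LINT z:cball 0 1|lborel. mollifier z *\<^sub>R fin_diff m r (e *\<^sub>R z) x)"
  shows "smooth_on F V"
    and "\<And>ws x B M q. \<lbrakk>set ws \<subseteq> Basis; x \<in> V; q \<le> m;
      \<And>us y. set us \<subseteq> Basis \<Longrightarrow> length us = q \<Longrightarrow> y \<in> U \<Longrightarrow> norm (iter_partial (us @ ws) r y) \<le> B;
      \<And>z::'a. mollifier z \<le> M\<rbrakk> \<Longrightarrow>
      norm (iter_partial ws F x) \<le> M * (2 ^ (m - q) * ((real DIM('a) * e) ^ q * B)) * measure lborel (cball (0::'a) 1)"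
proof -
  have inU': "x + real j *\<^sub>R (e *\<^sub>R z) \<in> U" if "x \<in> V" "norm z \<le> 1" "j \<le> m" for x z j
    using inU[OF that(1,2), of "real j"] that(3) by simp
  have bl: "bounded_linear (\<lambda>x::'a. x)" by (rule bounded_linear_ident)
  have st: "smooth_on (\<lambda>x. r (x + real j *\<^sub>R (e *\<^sub>R z))) V" if "norm z \<le> 1" "j \<le> m" for j z
    by (rule smooth_on_affine[OF bl assms(2,1) inU'[OF _ that] assms(3)])
  have sf: "smooth_on (\<lambda>x. fin_diff m r (e *\<^sub>R z) x) V" if "norm z \<le> 1" for z
    unfolding fin_diff_def using st[OF that] by (intro smooth_on_sum smooth_on_scaleR assms(1)) auto
  have ip: "iter_partial ws (\<lambda>x. mollifier z *\<^sub>R fin_diff m r (e *\<^sub>R z) x) x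
      = mollifier z *\<^sub>R fin_diff m (iter_partial ws r) (e *\<^sub>R z) x"
    if "norm z \<le> 1" "x \<in> V" for ws z x
  proof -
    have "iter_partial ws (\<lambda>x. fin_diff m r (e *\<^sub>R z) x) x
        = (\<Sum>j\<le>m. iter_partial ws (\<lambda>x. alt_binom m j *\<^sub>R r (x + real j *\<^sub>R (e *\<^sub>R z))) x)"
      unfolding fin_diff_def
      by (rule iter_partial_sum[OF assms(1) smooth_on_scaleR[OF assms(1) st[OF that(1)]] that(2)]) auto
    also have "\<dots> = (\<Sum>j\<le>m. alt_binom m j *\<^sub>R iter_partial ws r (x + real j *\<^sub>R (e *\<^sub>R z)))"
    proof (rule sum.cong[OF refl])
      fix j assume "j \<in> {..m}"
      then have j: "j \<le> m" by simp
      have "iter_partial ws (\<lambda>x. r (x + real j *\<^sub>R (e *\<^sub>R z))) x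
          = iter_partial (map (\<lambda>x. x) ws) r (x + real j *\<^sub>R (e *\<^sub>R z))"
        by (rule iter_partial_affine[OF bl assms(2,1) inU'[OF _ that(1) j] assms(3) that(2)])
      then show "iter_partial ws (\<lambda>x. alt_binom m j *\<^sub>R r (x + real j *\<^sub>R (e *\<^sub>R z))) x
          = alt_binom m j *\<^sub>R iter_partial ws r (x + real j *\<^sub>R (e *\<^sub>R z))"
        using iter_partial_scaleR[OF assms(1) st[OF that(1) j] that(2)] by simp
    qed
    finally show ?thesis
      using iter_partial_scaleR[OF assms(1) sf[OF that(1)] that(2)] by (simp add: fin_diff_def)
  qed
  have cm: "continuous_on S (mollifier :: 'a \<Rightarrow> real)" for S
    using smooth_on_continuous[OF smooth_on_mollifier] continuous_on_subset by blast
  have cj: "continuous_on (V \<times> cball 0 1)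
      (\<lambda>(x, z). mollifier z *\<^sub>R fin_diff m (iter_partial ws r) (e *\<^sub>R z) x)" for ws
  proof -
    have c: "continuous_on U (iter_partial ws r)"
      using smooth_on_continuous[OF smooth_on_iter_partial] assms by blast
    have "continuous_on (V \<times> cball 0 1) (\<lambda>w. mollifier (snd w) *\<^sub>R
        (\<Sum>j\<le>m. alt_binom m j *\<^sub>R iter_partial ws r (fst w + real j *\<^sub>R (e *\<^sub>R snd w))))"
    proof (intro continuous_on_scaleR continuous_on_sum continuous_on_const)
      show "continuous_on (V \<times> cball (0 :: 'a) 1) (\<lambda>w. mollifier (snd w) :: real)"
        by (rule continuous_on_compose2[OF cm[of UNIV] continuous_on_snd[OF continuous_on_id]]) auto
      fix j assume "j \<in> {..m}"
      then show "continuous_on (V \<times> cball 0 1) (\<lambda>w. iter_partial ws r (fst w + real j *\<^sub>R (e *\<^sub>R snd w)))"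
        by (intro continuous_on_compose2[OF c]) (auto intro!: continuous_intros inU' simp del: scaleR_scaleR)
    qed
    then show ?thesis by (simp add: fin_diff_def case_prod_beta)
  qed
  have ss: "smooth_on (\<lambda>x. mollifier z *\<^sub>R fin_diff m r (e *\<^sub>R z) x) V" if "z \<in> cball 0 1" for z
    using smooth_on_scaleR[OF assms(1) sf] that by simp
  have sc: "continuous_on (V \<times> cball 0 1)
      (\<lambda>(x, z). iter_partial ws (\<lambda>x. mollifier z *\<^sub>R fin_diff m r (e *\<^sub>R z) x) x)" for ws
    by (rule continuous_on_eq[OF cj[of ws]]) (auto simp: ip)
  show "smooth_on F V" unfolding F_def
    by (rule iter_partial_set_integral(1)[OF assms(1) compact_cball ss sc])
  fix ws :: "'a list" and x B M q
  assume ws: "set ws \<subseteq> Basis" and x: "x \<in> V" and q: "q \<le> m"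
    and B: "\<And>us y. set us \<subseteq> Basis \<Longrightarrow> length us = q \<Longrightarrow> y \<in> U \<Longrightarrow> norm (iter_partial (us @ ws) r y) \<le> B"
    and M: "\<And>z::'a. mollifier z \<le> M"
  have F_eq: "iter_partial ws F x
      = (LINT z:cball 0 1|lborel. iter_partial ws (\<lambda>x. mollifier z *\<^sub>R fin_diff m r (e *\<^sub>R z) x) x)"
    unfolding F_def by (rule iter_partial_set_integral(2)[OF assms(1) compact_cball ss sc ws x])
  show "norm (iter_partial ws F x) \<le> M * (2 ^ (m - q) * ((real DIM('a) * e) ^ q * B)) * measure lborel (cball (0::'a) 1)"
    unfolding F_eq
  proof (rule norm_set_integral_compact_le[OF compact_cball])
    show "continuous_on (cball 0 1) (\<lambda>z. iter_partial ws (\<lambda>x. mollifier z *\<^sub>R fin_diff m r (e *\<^sub>R z) x) x)"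
      using continuous_on_slice[OF sc x] .
    fix z :: 'a assume "z \<in> cball 0 1"
    then have z: "norm z \<le> 1" by simp
    have "norm (fin_diff m (iter_partial ws r) (e *\<^sub>R z) x) \<le> 2 ^ (m - q) * ((real DIM('a) * norm (e *\<^sub>R z)) ^ q * B)"
    proof (rule norm_fin_diff_le[OF assms(2) _ q inU[OF x z]])
      show "smooth_on (iter_partial ws r) U" using assms smooth_on_iter_partial by blast
      show "norm (iter_partial us (iter_partial ws r) (x + t *\<^sub>R (e *\<^sub>R z))) \<le> B"
        if "t \<in> {0..real m}" "set us \<subseteq> Basis" "length us = q" for t us
        using B[OF that(2,3) inU[OF x z that(1)]] by (simp add: iter_partial_append)
    qed
    also have "\<dots> \<le> 2 ^ (m - q) * ((real DIM('a) * e) ^ q * B)"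
    proof -
      \<comment> \<open>B bounds at least one norm: a basis word of length q exists, and x itself
        lies in U as the starting point of a segment.\<close>
      have "B \<ge> 0"
      proof -
        obtain b :: 'a where "b \<in> Basis" using nonempty_Basis by blast
        then have "norm (iter_partial (replicate q b @ ws) r x) \<le> B"
          using inU[OF x z, of 0] by (intro B) (auto simp: subset_iff)
        then show ?thesis using norm_ge_zero order_trans by blast
      qed
      moreover have "(real DIM('a) * norm (e *\<^sub>R z)) ^ q \<le> (real DIM('a) * e) ^ q"
        using z assms(4) by (intro power_mono mult_left_mono) (auto simp: mult_left_le)
      ultimately show ?thesis by (intro mult_left_mono mult_right_mono) auto
    qed
    finally have "\<bar>mollifier z\<bar> * norm (fin_diff m (iter_partial ws r) (e *\<^sub>R z) x)
        \<le> M * (2 ^ (m - q) * ((real DIM('a) * e) ^ q * B))"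
      using M[of z] mollifier_nonneg[of z] by (intro mult_mono) auto
    then show "norm (iter_partial ws (\<lambda>x. mollifier z *\<^sub>R fin_diff m r (e *\<^sub>R z) x) x)
        \<le> M * (2 ^ (m - q) * ((real DIM('a) * e) ^ q * B))"
      unfolding ip[OF z x] by simp
  qed
qed

text \<open>There are finitely many basis words of length q, so one threshold for e and one
  constant, the sum of the individual ones, serve all of them.\<close>

lemma net_bound_words:
  fixes r :: "('a::euclidean_space, 'k::real_normed_vector) net"
  assumes "\<And>vs. set vs \<subseteq> Basis \<Longrightarrow> net_bound K vs r g" "\<And>e. 0 < e \<Longrightarrow> 0 \<le> g e" "set ws \<subseteq> Basis"
  obtains D where "D \<ge> 0" "\<forall>\<^sub>F e in at_right 0. \<forall>us y. set us \<subseteq> Basis \<longrightarrow> length us = q \<longrightarrow> y \<in> K \<longrightarrow>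
    norm (iter_partial (us @ ws) (r e) y) \<le> D * g e"
proof -
  define X where "X = {us :: 'a list. set us \<subseteq> Basis \<and> length us = q}"
  have X: "finite X" unfolding X_def by (rule finite_lists_length_eq[OF finite_Basis])
  define P where "P = (\<lambda>us C. C \<ge> 0 \<and>
    (\<forall>\<^sub>F e in at_right 0. e \<in> {0<..1} \<and> (\<forall>y\<in>K. norm (iter_partial (us @ ws) (r e) y) \<le> C * g e)))"
  have ex: "\<forall>us\<in>X. \<exists>C. P us C"
  proof
    fix us assume that: "us \<in> X"
    have "net_bound K (us @ ws) r g" using that assms(3) by (intro assms(1)) (auto simp: X_def)
    obtain C where "C \<ge> 0"
      "\<forall>\<^sub>F e in at_right 0. e \<in> {0<..1} \<and> (\<forall>y\<in>K. norm (iter_partial (us @ ws) (r e) y) \<le> C * g e)"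
      by (rule net_boundE[OF \<open>net_bound K (us @ ws) r g\<close> assms(2)])
    then show "\<exists>C. P us C" unfolding P_def by blast
  qed
  obtain C where "\<forall>us\<in>X. P us (C us)" using bchoice[OF ex] by blast
  then have C: "\<And>us. us \<in> X \<Longrightarrow> C us \<ge> 0"
    "\<And>us. us \<in> X \<Longrightarrow> \<forall>\<^sub>F e in at_right 0. e \<in> {0<..1} \<and> (\<forall>y\<in>K. norm (iter_partial (us @ ws) (r e) y) \<le> C us * g e)"
    by (simp_all add: P_def)
  have "\<forall>\<^sub>F e in at_right 0. \<forall>us\<in>X. e \<in> {0<..1} \<and> (\<forall>y\<in>K. norm (iter_partial (us @ ws) (r e) y) \<le> C us * g e)"
    by (rule eventually_ball_finite[OF X]) (rule ballI, rule C(2))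
  then have "\<forall>\<^sub>F e in at_right 0. \<forall>us y. set us \<subseteq> Basis \<longrightarrow> length us = q \<longrightarrow> y \<in> K \<longrightarrow>
      norm (iter_partial (us @ ws) (r e) y) \<le> sum C X * g e"
  proof (rule eventually_mono)
    fix e assume h: "\<forall>us\<in>X. e \<in> {0<..1} \<and> (\<forall>y\<in>K. norm (iter_partial (us @ ws) (r e) y) \<le> C us * g e)"
    have "norm (iter_partial (us @ ws) (r e) y) \<le> sum C X * g e" if "us \<in> X" "y \<in> K" for us y
    proof -
      have "C us \<le> sum C X" using C(1) X that by (intro member_le_sum) auto
      then have "C us * g e \<le> sum C X * g e" using assms(2)[of e] h that(1) by (intro mult_right_mono) auto
      then show ?thesis using h that by force
    qed
    then show "\<forall>us y. set us \<subseteq> Basis \<longrightarrow> length us = q \<longrightarrow> y \<in> K \<longrightarrow>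
      norm (iter_partial (us @ ws) (r e) y) \<le> sum C X * g e" by (simp add: X_def)
  qed
  moreover have "sum C X \<ge> 0" using C(1) by (intro sum_nonneg)
  ultimately show thesis using that by blast
qed

text \<open>The bookkeeping behind q = Q + N + 1: the factor 2^(m - q) \<le> 1/e uses up one power
  of e, the growth of the net uses up N, and Q are left.\<close>

lemma fin_diff_rate:
  assumes e: "e \<in> {0<..1}" and q: "q = Q + N + 1" and "M \<ge> 0" "D \<ge> 0" "v \<ge> 0" "n \<ge> 0"
  shows "M * (2 ^ (ord_of e - q) * ((n * e) ^ q * (D * e powr (- real N)))) * v \<le> (M * n ^ q * D * v) * e ^ Q"
proof -
  have "(2::real) ^ (ord_of e - q) \<le> 2 ^ ord_of e" by (rule power_increasing) auto
  then have "(2::real) ^ (ord_of e - q) \<le> 1 / e" using two_power_ord_of[OF e] by linarith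
  then have "2 ^ (ord_of e - q) * (e ^ q * e powr (- real N)) \<le> 1 / e * (e ^ q * e powr (- real N))"
    using e by (intro mult_right_mono) auto
  also have "\<dots> = e ^ Q" using e by (simp add: q power_add powr_minus powr_realpow)
  finally have "(M * n ^ q * D * v) * (2 ^ (ord_of e - q) * (e ^ q * e powr (- real N))) \<le> (M * n ^ q * D * v) * e ^ Q"
    using assms by (intro mult_left_mono) auto
  then show ?thesis by (simp add: power_mult_distrib mult_ac)
qed

text \<open>For x in the interior of K the ball of radius m e eventually lies in K; the cut-off is
  then invisible and the error is a mollified finite difference.\<close>

lemma net_bound_delta_reproduces:
  fixes r :: "('a::euclidean_space, 'k::{real_normed_field, euclidean_space}) net"
  assumes r: "r \<in> smooth_nets W" and C: "compact C" "C \<subseteq> interior K" and K: "compact K" "K \<subseteq> W"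
    and N: "\<And>vs. set vs \<subseteq> Basis \<Longrightarrow> net_bound K vs r (\<lambda>e. e powr (- real N))" and ws: "set ws \<subseteq> Basis"
  shows "net_bound C ws (\<lambda>e x. kernel_net K delta_net r e x - r e x) (\<lambda>e. e ^ Q)"
proof -
  obtain d where d: "d > 0" "(\<Union>x\<in>C. cball x d) \<subseteq> interior K"
    using compact_subset_open_imp_cball_epsilon_subset[OF C(1) open_interior C(2)] by blast
  \<comment> \<open>Derivatives on C require the error formula on an open neighbourhood. Half of the
    margin d is spent on V, the other half on m e.\<close>
  define V where "V = (\<Union>x\<in>C. ball x (d / 2))"
  have V: "open V" "C \<subseteq> V" using d(1) by (auto simp: V_def)
  obtain M where M: "M \<ge> 0" "\<And>z :: 'a. mollifier z \<le> M" using mollifier_bounded by blast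
  define q where "q = Q + N + 1"
  obtain D where D: "D \<ge> 0" "\<forall>\<^sub>F e in at_right 0. \<forall>us y. set us \<subseteq> Basis \<longrightarrow> length us = q \<longrightarrow> y \<in> K \<longrightarrow>
      norm (iter_partial (us @ ws) (r e) y) \<le> D * e powr (- real N)"
    by (rule net_bound_words[OF N _ ws, where q = q]) auto
  define c where "c = M * real DIM('a) ^ q * D * measure lborel (cball (0::'a) 1)"
  have d2: "d / 2 > 0" using d(1) by simp
  have "\<forall>\<^sub>F e in at_right 0. \<forall>x\<in>C.
      norm (iter_partial ws (\<lambda>x. kernel_net K delta_net r e x - r e x) x) \<le> c * e ^ Q"
    using D(2) eventually_unit_interval eventually_ord_of_ge[of q] eventually_small[OF d2]
  proof eventually_elim
    case (elim e)
    define m where "m = ord_of e"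
    define F where "F = (\<lambda>x. LINT z:cball 0 1|lborel. mollifier z *\<^sub>R fin_diff m (r e) (e *\<^sub>R z) x)"
    have "interior K \<subseteq> W" using interior_subset[of K] K(2) by blast
    from smooth_on_subset[OF open_interior this, of "r e"] have s: "smooth_on (r e) (interior K)"
      using r elim(2) by (simp add: smooth_nets_def)
    have ballK: "cball x (real m * e) \<subseteq> interior K" if x: "x \<in> V" for x
    proof -
      obtain x0 where x0: "x0 \<in> C" "dist x0 x < d / 2" using x by (auto simp: V_def)
      have "real m * e < d / 2" using elim(4) zero_le_power2[of e] unfolding m_def by linarith
      then have "cball x (real m * e) \<subseteq> cball x0 d"
        using x0(2) by (auto simp: cball_subset_cball_iff dist_commute)
      then show ?thesis using d(2) x0(1) by blast
    qed
    have inU: "x + t *\<^sub>R (e *\<^sub>R z) \<in> interior K" if "x \<in> V" "norm z \<le> 1" "t \<in> {0..real m}" for x z t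
    proof -
      have "norm (t *\<^sub>R (e *\<^sub>R z)) \<le> t * e" using that elim(2) by (simp add: mult_left_le)
      also have "\<dots> \<le> real m * e" using that elim(2) by (intro mult_right_mono) auto
      finally have "x + t *\<^sub>R (e *\<^sub>R z) \<in> cball x (real m * e)" by (simp add: dist_norm)
      then show ?thesis using ballK[OF that(1)] by blast
    qed
    have e0: "e > 0" using elim(2) by simp
    have F1: "smooth_on F V"
      unfolding F_def by (rule mollified_fin_diff(1)[OF V(1) open_interior s e0 inU])
    show ?case
    proof
      fix x assume "x \<in> C"
      then have x: "x \<in> V" using V by blast
      have "iter_partial ws (\<lambda>x. kernel_net K delta_net r e x - r e x) x
          = iter_partial ws (\<lambda>x. (-1) *\<^sub>R F x) x"
      proof (rule iter_partial_cong[OF V(1) _ x])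
        fix y assume y: "y \<in> V"
        show "(LINT u:K|lborel. delta_net e (y, u) * r e u) - r e y = (-1) *\<^sub>R F y"
          using delta_net_integral[OF elim(2) K(1) continuous_on_smooth_net[OF r K(2) elim(2)], of y]
            ballK[OF y] interior_subset[of K] by (auto simp: F_def m_def)
      qed
      also have "norm \<dots> = norm (iter_partial ws F x)"
      proof -
        have "iter_partial ws (\<lambda>x. (-1) *\<^sub>R F x) x = (-1) *\<^sub>R iter_partial ws F x"
          by (rule iter_partial_scaleR[OF V(1) F1 x])
        then show ?thesis by simp
      qed
      also have "\<dots> \<le> M * (2 ^ (m - q) * ((real DIM('a) * e) ^ q * (D * e powr (- real N)))) * measure lborel (cball (0::'a) 1)"
        unfolding F_def
      proof (rule mollified_fin_diff(2)[OF V(1) open_interior s e0 inU ws x _ _ M(2)])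
        show "q \<le> m" using elim(3) by (simp add: m_def)
        show "norm (iter_partial (us @ ws) (r e) y) \<le> D * e powr (- real N)"
          if "set us \<subseteq> Basis" "length us = q" "y \<in> interior K" for us y
          using elim(1) that interior_subset[of K] by blast
      qed
      also have "\<dots> \<le> c * e ^ Q"
        unfolding m_def c_def by (rule fin_diff_rate[OF elim(2) q_def M(1) D(1)]) auto
      finally show "norm (iter_partial ws (\<lambda>x. kernel_net K delta_net r e x - r e x) x) \<le> c * e ^ Q" .
    qed
  qed
  then show ?thesis unfolding net_bound_def by blast
qed

text \<open>The integral is a constant J in x, so nonempty words give 0 and C may be any set. The
  estimate of J is uniform in the position of p e because the compact set L leaves a fixed margin d
  inside K.\<close>

lemma net_bound_wave_annihilates:
  fixes r :: "('a::euclidean_space, 'k::{real_normed_field, euclidean_space}) net"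
  assumes r: "r \<in> smooth_nets W" and L: "compact L" "L \<subseteq> interior K" "\<And>e. p e \<in> L" and b: "norm b = 1"
    and K: "compact K" "K \<subseteq> W"
    and N: "\<And>vs. set vs \<subseteq> Basis \<Longrightarrow> net_bound K vs r (\<lambda>e. e powr (- real N))"
  shows "net_bound C ws (kernel_net K (wave_net p b) r) (\<lambda>e. e ^ Q)"
proof -
  obtain d where d: "d > 0" "(\<Union>x\<in>L. cball x d) \<subseteq> interior K"
    using compact_subset_open_imp_cball_epsilon_subset[OF L(1) open_interior L(2)] by blast
  obtain M where M: "M \<ge> 0" "\<And>z :: 'a. mollifier z \<le> M" using mollifier_bounded by blast
  define q where "q = Q + N + 1"
  have nil: "set ([] :: 'a list) \<subseteq> Basis" by simp
  obtain D where D: "D \<ge> 0" "\<forall>\<^sub>F e in at_right 0. \<forall>us y. set us \<subseteq> Basis \<longrightarrow> length us = q \<longrightarrow> y \<in> K \<longrightarrow>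
      norm (iter_partial (us @ []) (r e) y) \<le> D * e powr (- real N)"
    by (rule net_bound_words[OF N _ nil, where q = q]) auto
  define c where "c = M * real DIM('a) ^ q * D * measure lborel (cball (0::'a) 1)"
  have "\<forall>\<^sub>F e in at_right 0. \<forall>x\<in>C.
      norm (iter_partial ws (\<lambda>x. LINT y:K|lborel. wave_net p b e (x, y) * r e y) x) \<le> c * e ^ Q"
    using D(2) eventually_unit_interval eventually_ord_of_ge[of q] eventually_small[OF d(1)]
  proof eventually_elim
    case (elim e)
    define m where "m = ord_of e"
    define J where "J = (LINT y:K|lborel. wave_net p b e (0, y) * r e y)"
    have J: "kernel_net K (wave_net p b) r e x = J" for x
      by (simp add: J_def wave_net_def)
    have "interior K \<subseteq> W" using interior_subset[of K] K(2) by blast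
    from smooth_on_subset[OF open_interior this, of "r e"] have s: "smooth_on (r e) (interior K)"
      using r elim(2) by (simp add: smooth_nets_def)
    have ballK: "cball (p e) (real m * e + e\<^sup>2) \<subseteq> interior K"
    proof -
      have "cball (p e) (real m * e + e\<^sup>2) \<subseteq> cball (p e) d"
        using elim(4) by (intro subset_cball) (simp add: m_def)
      then show ?thesis using d(2) L(3)[of e] by blast
    qed
    have inU: "p e + e\<^sup>2 *\<^sub>R z + t *\<^sub>R (e *\<^sub>R b) \<in> interior K" if "norm z \<le> 1" "t \<in> {0..real m}" for z t
    proof -
      have "t * e \<le> real m * e" using that elim(2) by (intro mult_right_mono) auto
      then have "norm (t *\<^sub>R (e *\<^sub>R b)) \<le> real m * e" using that elim(2) b by simp
      moreover have "norm (e\<^sup>2 *\<^sub>R z) \<le> e\<^sup>2" using that by (simp add: mult_left_le)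
      ultimately have "norm (e\<^sup>2 *\<^sub>R z + t *\<^sub>R (e *\<^sub>R b)) \<le> real m * e + e\<^sup>2"
        using norm_triangle_ineq[of "e\<^sup>2 *\<^sub>R z" "t *\<^sub>R (e *\<^sub>R b)"] by linarith
      then have "dist (p e) (p e + (e\<^sup>2 *\<^sub>R z + t *\<^sub>R (e *\<^sub>R b))) \<le> real m * e + e\<^sup>2"
        using dist_add_cancel[of "p e" 0 "e\<^sup>2 *\<^sub>R z + t *\<^sub>R (e *\<^sub>R b)"]
        by (simp only: add_0_right dist_0_norm)
      then have "p e + e\<^sup>2 *\<^sub>R z + t *\<^sub>R (e *\<^sub>R b) \<in> cball (p e) (real m * e + e\<^sup>2)"
        by (simp only: mem_cball add.assoc)
      then show ?thesis using ballK by blast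
    qed
    have cr: "continuous_on K (r e)" by (rule continuous_on_smooth_net[OF r K(2) elim(2)])
    have "cball (p e) (real (ord_of e) * e + e\<^sup>2) \<subseteq> K" using ballK interior_subset[of K] by (auto simp: m_def)
    note WI = wave_net_integral[where p = p and e = e, OF elim(2) b K(1) cr this, folded m_def]
    have "norm (LINT z:cball 0 1|lborel. mollifier z *\<^sub>R fin_diff m (r e) (e *\<^sub>R b) (p e + e\<^sup>2 *\<^sub>R z))
        \<le> M * (2 ^ (m - q) * ((real DIM('a) * e) ^ q * (D * e powr (- real N)))) * measure lborel (cball (0::'a) 1)"
    proof (rule norm_set_integral_compact_le[OF compact_cball WI(2)])
      fix z :: 'a assume "z \<in> cball 0 1"
      then have z: "norm z \<le> 1" by simp
      have "norm (fin_diff m (r e) (e *\<^sub>R b) (p e + e\<^sup>2 *\<^sub>R z))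
          \<le> 2 ^ (m - q) * ((real DIM('a) * norm (e *\<^sub>R b)) ^ q * (D * e powr (- real N)))"
      proof (rule norm_fin_diff_le[OF open_interior s _ inU[OF z]])
        show "q \<le> m" using elim(3) by (simp add: m_def)
        show "norm (iter_partial us (r e) (p e + e\<^sup>2 *\<^sub>R z + t *\<^sub>R e *\<^sub>R b)) \<le> D * e powr (- real N)"
          if "t \<in> {0..real m}" "set us \<subseteq> Basis" "length us = q" for t us
          using elim(1) that(2,3) inU[OF z that(1)] interior_subset[of K] by auto
      qed
      then show "norm (mollifier z *\<^sub>R fin_diff m (r e) (e *\<^sub>R b) (p e + e\<^sup>2 *\<^sub>R z))
          \<le> M * (2 ^ (m - q) * ((real DIM('a) * e) ^ q * (D * e powr (- real N))))"
        using M(2)[of z] M(1) mollifier_nonneg[of z] b elim(2) unfolding norm_scaleR by (intro mult_mono) auto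
    qed
    also have "\<dots> \<le> c * e ^ Q"
      unfolding m_def c_def by (rule fin_diff_rate[OF elim(2) q_def M(1) D(1)]) auto
    finally have I: "norm (LINT z:cball 0 1|lborel. mollifier z *\<^sub>R fin_diff m (r e) (e *\<^sub>R b) (p e + e\<^sup>2 *\<^sub>R z)) \<le> c * e ^ Q" .
    have "J = (e\<^sup>2) ^ DIM('a) *\<^sub>R (LINT z:cball 0 1|lborel. mollifier z *\<^sub>R fin_diff m (r e) (e *\<^sub>R b) (p e + e\<^sup>2 *\<^sub>R z))"
      unfolding J_def by (rule WI(1))
    \<comment> \<open>The Jacobian only helps and is estimated by 1.\<close>
    moreover have "(e\<^sup>2) ^ DIM('a) \<le> 1" using elim(2) by (intro power_le_one) (auto simp: power_le_one)
    ultimately have "norm J \<le> 1 * (c * e ^ Q)"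
      using I by (simp only: norm_scaleR) (intro mult_mono, auto)
    then have "norm J \<le> c * e ^ Q" by simp
    moreover have "norm (iter_partial ws (\<lambda>x. J) x) \<le> norm J" for x
      by (cases "ws = []") (simp_all add: iter_partial_const)
    ultimately show ?case unfolding J using order_trans by blast
  qed
  then show ?thesis unfolding net_bound_def by blast
qed

text \<open>The kernel couples x \<in> C only with points y at distance below m e, which eventually
  lie within d of C and hence off S, where r is negligible. A moderate kernel against a negligible
  net gives a negligible integral.\<close>

lemma net_bound_delta_off_support:
  fixes r :: "('a::euclidean_space, 'k::{real_normed_field, euclidean_space}) net"
  assumes W: "open W" and r: "r \<in> smooth_nets W" and C: "compact C" "C \<subseteq> W" and K: "compact K" "K \<subseteq> W"
    and S: "closed S" "C \<inter> S = {}"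
    and off: "\<And>D q. compact D \<Longrightarrow> D \<subseteq> W \<Longrightarrow> D \<inter> S = {} \<Longrightarrow> net_bound D [] r (\<lambda>e. e ^ q)"
    and ws: "set ws \<subseteq> Basis"
  shows "net_bound C ws (kernel_net K delta_net r) (\<lambda>e. e ^ Q)"
proof -
  have "C \<subseteq> - S" "open (- S)" using S by auto
  then obtain d where d: "d > 0" "(\<Union>x\<in>C. cball x d) \<subseteq> - S"
    using compact_subset_open_imp_cball_epsilon_subset[OF C(1)] by blast
  \<comment> \<open>The part of K within distance d of C: disjoint from S by the choice of d, and
    compact since the sum of two compact sets is compact.\<close>
  define D where "D = K \<inter> {x + z |x z. x \<in> C \<and> z \<in> cball 0 d}"
  have Dc: "compact D" unfolding D_def
    by (intro compact_Int_closed K(1) compact_imp_closed compact_sums C(1) compact_cball)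
  have DW: "D \<subseteq> W" using K(2) by (auto simp: D_def)
  have DS: "D \<inter> S = {}"
  proof -
    have "x + z \<in> cball x d" if "z \<in> cball 0 d" for x z :: 'a using that by (simp add: dist_norm)
    then show ?thesis using d(2) unfolding D_def by blast
  qed
  have dm: "(delta_net :: ('a \<times> 'a, 'k) net) \<in> moderate_nets (W \<times> W)"
    by (rule moderate_delta_net) (simp add: open_Times W)
  have WW: "open (W \<times> W)" using W by (simp add: open_Times)
  have "C \<times> D \<subseteq> W \<times> W" "compact (C \<times> D)" using C DW Dc by (auto intro: compact_Times)
  then obtain N :: nat where N: "net_bound (C \<times> D) (map (\<lambda>b. (b, 0)) ws) (delta_net :: ('a \<times> 'a, 'k) net) (\<lambda>e. e powr (- real N))"
    using dm[unfolded moderate_nets_iff[OF WW], THEN conjunct2, rule_format, of "C \<times> D" "map (\<lambda>b. (b, 0)) ws"]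
      set_map_Pair_Basis(2)[OF ws] by auto
  have dsm: "(delta_net :: ('a \<times> 'a, 'k) net) \<in> smooth_nets (W \<times> W)" using dm by (simp add: moderate_nets_def)
  have "net_bound C ws (kernel_net D delta_net r) (\<lambda>e. e powr (- real N) * e ^ (Q + N))"
    by (rule net_bound_kernel_integral[OF W W Dc DW dsm r C(2) ws N _ off[OF Dc DW DS]]) auto
  then have "net_bound C ws (kernel_net D delta_net r) (\<lambda>e. e ^ Q)"
    by (rule net_bound_mono) (simp add: powr_minus powr_realpow power_add)
  \<comment> \<open>Replacing K by D does not change the integral for x within d/2 of C once m e <
    d/2, because the kernel vanishes on the rest of K. The identity holds on a neighbourhood of C,
    as derivatives require.\<close>
  moreover have ev: "\<forall>\<^sub>F e in at_right 0. \<exists>V. open V \<and> C \<subseteq> V \<and> (\<forall>x\<in>V.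
      kernel_net K delta_net r e x = kernel_net D delta_net r e x)"
  proof -
    have d2: "d / 2 > 0" using d(1) by simp
    show ?thesis using eventually_unit_interval eventually_small[OF d2]
    proof eventually_elim
      case (elim e)
      define V where "V = (\<Union>x\<in>C. ball x (d / 2))"
      have V: "open V" "C \<subseteq> V" using d(1) by (auto simp: V_def)
      have "kernel_net K delta_net r e x = kernel_net D delta_net r e x"
        if x: "x \<in> V" for x
      proof -
        obtain x0 where x0: "x0 \<in> C" "dist x0 x < d / 2" using x by (auto simp: V_def)
        have z: "delta_net e (x, y) = (0 :: 'k)" if "y \<in> K - D" for y
        proof (rule delta_net_eq_0[OF elim(1)])
          have "\<not> dist x0 y \<le> d"
          proof
            assume "dist x0 y \<le> d"
            then have "y - x0 \<in> cball 0 d" by (simp add: dist_norm norm_minus_commute)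
            then have "y \<in> {x + z |x z. x \<in> C \<and> z \<in> cball 0 d}" using x0(1) by force
            then show False using that by (auto simp: D_def)
          qed
          then have "dist x y \<ge> d / 2" using x0(2) dist_triangle[of x0 y x] by linarith
          then have "real (ord_of e) * e \<le> dist x y"
            using elim(2) zero_le_power2[of e] by linarith
          then show "real (ord_of e) * e \<le> norm (y - x)"
            by (simp add: dist_norm norm_minus_commute)
        qed
        have "indicator K y *\<^sub>R (delta_net e (x, y) * r e y) = indicator D y *\<^sub>R (delta_net e (x, y) * r e y)" for y
          using z[of y] by (cases "y \<in> D"; cases "y \<in> K") (auto simp: D_def)
        then show ?thesis unfolding set_lebesgue_integral_def by presburger
      qed
      with V show ?case by blast
    qed
  qed
  ultimately show ?thesis by (rule net_bound_eventually_cong[rotated])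
qed

section \<open>Reproduction of regular generalized functions\<close>

lemma moderate_nets_add:
  assumes "open W" "u \<in> moderate_nets W" "v \<in> moderate_nets W"
  shows "(\<lambda>e x. u e x + v e x) \<in> moderate_nets W"
proof -
  have s: "u \<in> smooth_nets W" "v \<in> smooth_nets W"
    using assms by (auto simp: moderate_nets_def)
  have "\<exists>N::nat. net_bound K ws (\<lambda>e x. u e x + v e x) (\<lambda>e. e powr (- real N))"
    if K: "compact K \<and> K \<subseteq> W \<and> set ws \<subseteq> Basis" for K ws
  proof -
    obtain M N :: nat where MN: "net_bound K ws u (\<lambda>e. e powr (- real M))" "net_bound K ws v (\<lambda>e. e powr (- real N))"
      using assms(2,3) K unfolding moderate_nets_iff[OF assms(1)] by blast
    have le: "0 \<le> e powr (- real n) \<and> e powr (- real n) \<le> e powr (- real (max M N))"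
      if "e \<in> {0<..1}" "n \<le> max M N" for e n
      using powr_mono'[of "- real (max M N)" "- real n" e] that by simp
    have "net_bound K ws u (\<lambda>e. e powr (- real (max M N)))"
      by (rule net_bound_mono[OF MN(1)]) (rule le, auto)
    moreover have "net_bound K ws v (\<lambda>e. e powr (- real (max M N)))"
      by (rule net_bound_mono[OF MN(2)]) (rule le, auto)
    ultimately show ?thesis using net_bound_add[OF assms(1) s] K by blast
  qed
  then show ?thesis using smooth_nets_add[OF assms(1) s] unfolding moderate_nets_iff[OF assms(1)] by blast
qed

text \<open>A negligible net is bounded by e^(-N) for every N, so the exponent that r0 has for all
  words serves each equivalent r.\<close>

lemma regular_class_bound:
  assumes "open W" "r0 \<in> regular_nets W" "(r0, r) \<in> net_rel W" "compact K" "K \<subseteq> W"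
  obtains N :: nat where "\<And>ws. set ws \<subseteq> Basis \<Longrightarrow> net_bound K ws r (\<lambda>e. e powr (- real N))"
proof -
  obtain N :: nat where N: "\<And>ws. set ws \<subseteq> Basis \<Longrightarrow> net_bound K ws r0 (\<lambda>e. e powr (- real N))"
    using regular_nets_bound[OF assms(1,2,4,5)] by blast
  have n: "(\<lambda>e x. r0 e x - r e x) \<in> negligible_nets W" and s: "r0 \<in> smooth_nets W"
    using assms(2,3) by (auto simp: net_rel_def regular_nets_def)
  then have s': "(\<lambda>e x. r0 e x - r e x) \<in> smooth_nets W" by (simp add: negligible_nets_def)
  have "net_bound K ws r (\<lambda>e. e powr (- real N))" if "set ws \<subseteq> Basis" for ws
    using net_bound_diff[OF assms(1) s s' assms(5) N[OF that] negligible_bound_powr[OF assms(1) n assms(4,5) that]]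
    by simp
  then show thesis using that by blast
qed

text \<open>The integer part of 1/e is decoded as a pair whose first entry selects a point of a
  countable dense subset. The second entry is free, so each point is selected by arbitrarily large
  integers, that is, for arbitrarily small e.\<close>

lemma dense_visits:
  fixes S :: "'a::euclidean_space set"
  assumes "S \<noteq> {}"
  obtains p :: "real \<Rightarrow> 'a" where "\<And>e. p e \<in> S"
    and "\<And>V. open V \<Longrightarrow> V \<inter> S \<noteq> {} \<Longrightarrow> \<exists>y\<in>V \<inter> S. \<forall>\<eta>>0. \<exists>e. 0 < e \<and> e < \<eta> \<and> p e = y"
proof -
  obtain T where T: "countable T" "T \<subseteq> S" "S \<subseteq> closure T" using separable by blast
  then have ne: "T \<noteq> {}" using assms by auto
  define p where "p = (\<lambda>e::real. from_nat_into T (fst (prod_decode (nat \<lfloor>1 / e\<rfloor>))))"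
  have "p e \<in> S" for e using from_nat_into[OF ne] T(2) by (auto simp: p_def)
  moreover have "\<exists>y\<in>V \<inter> S. \<forall>\<eta>>0. \<exists>e. 0 < e \<and> e < \<eta> \<and> p e = y" if V: "open V" "V \<inter> S \<noteq> {}" for V
  proof -
    have "V \<inter> closure T \<noteq> {}" using V(2) T(3) by blast
    then obtain y where y: "y \<in> V" "y \<in> T" using open_Int_closure_eq_empty[OF V(1), of T] by blast
    then obtain k where k: "from_nat_into T k = y" using from_nat_into_surj[OF T(1)] by blast
    have "\<exists>e. 0 < e \<and> e < \<eta> \<and> p e = y" if "\<eta> > 0" for \<eta> :: real
    proof -
      obtain i :: nat where i: "1 / \<eta> < real i" using reals_Archimedean2 by blast
      \<comment> \<open>\<open>prod_encode\<close> is at least its second component, so a large i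
        makes 1/n small while k stays fixed.\<close>
      define n where "n = prod_encode (k, i)"
      have "real i \<le> real n" using le_prod_encode_2[of i k] by (simp add: n_def)
      then have n: "1 / \<eta> < real n" using i by linarith
      moreover have "0 < 1 / \<eta>" using that by simp
      ultimately have n0: "0 < real n" by linarith
      have "1 / real n < \<eta>" using n n0 that by (simp add: field_simps)
      moreover have "p (1 / real n) = y" by (simp add: p_def n_def k)
      ultimately show ?thesis using n0 by (intro exI[of _ "1 / real n"]) simp
    qed
    then show ?thesis using y T(2) by blast
  qed
  ultimately show thesis by (rule that)
qed

lemma colombeau_regular_obtain:
  assumes "u \<in> colombeau_regular W"
  obtains r0 where "r0 \<in> regular_nets W" "u = net_rel W `` {r0}"
  using assms unfolding colombeau_regular_def by (rule quotientE) (use that in blast)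

text \<open>A compact set C on which the estimate is required may extend beyond K. Near the support
  the reproduction estimate applies; away from it both u and the integral are negligible.\<close>

lemma compactly_supported_reproduction:
  fixes W :: "'a::euclidean_space set" and u :: "('a, 'k::{real_normed_field, euclidean_space}) gen_fun"
  assumes W: "open W" and u: "u \<in> colombeau_regular_c W"
    and K: "compact K" "K \<subseteq> W" "gen_supp W u \<subseteq> interior K"
  shows "gen_integral W K (net_rel (W \<times> W) `` {delta_net}) u = u"
proof -
  define S where "S = gen_supp W u"
  have S: "compact S" "S \<subseteq> interior K" using u K(3) by (auto simp: S_def colombeau_regular_c_def)
  have "u \<in> colombeau_regular W" using u by (simp add: colombeau_regular_c_def)
  then obtain r0 where r0: "r0 \<in> regular_nets W" "u = net_rel W `` {r0}"
    by (rule colombeau_regular_obtain)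
  have WW: "open (W \<times> W)" using W by (simp add: open_Times)
  have dm: "(delta_net :: ('a \<times> 'a, 'k) net) \<in> moderate_nets (W \<times> W)" by (rule moderate_delta_net[OF WW])
  then have ds: "(delta_net :: ('a \<times> 'a, 'k) net) \<in> smooth_nets (W \<times> W)" by (simp add: moderate_nets_def)
  have "gen_integral W K (net_rel (W \<times> W) `` {delta_net}) (net_rel W `` {r0}) = net_rel W `` {r0}"
  proof (rule gen_integral_class[OF W W subset_refl K(1,2) dm regular_imp_moderate[OF r0(1)]])
    fix r assume r: "(r0, r) \<in> net_rel W"
    then have rm: "r \<in> moderate_nets W" by (simp add: net_rel_def)
    then have rs: "r \<in> smooth_nets W" by (simp add: moderate_nets_def)
    \<comment> \<open>The support belongs to the class, so it may be read off from r instead of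
      r0.\<close>
    have ur: "u = net_rel W `` {r}"
      unfolding r0(2) using net_rel_Image_eq[OF W, of "{r}" r0] r by simp
    have Is: "kernel_net K delta_net r \<in> smooth_nets W"
      by (rule smooth_nets_kernel_integral[OF W W K(1,2) ds rs])
    have "net_bound C ws (\<lambda>e x. kernel_net K delta_net r e x - r e x) (\<lambda>e. e ^ q)"
      if C: "compact C" "C \<subseteq> W" and ws: "set ws \<subseteq> Basis" for C ws q
    proof -
      obtain d where d: "d > 0" "(\<Union>x\<in>S. cball x d) \<subseteq> interior K"
        using compact_subset_open_imp_cball_epsilon_subset[OF S(1) open_interior S(2)] by blast
      \<comment> \<open>Closed balls for C1 and open balls for C2 make both sets compact; they still
        cover C.\<close>
      define C1 where "C1 = C \<inter> {x + z |x z. x \<in> S \<and> z \<in> cball 0 d}"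
      define C2 where "C2 = C - (\<Union>x\<in>S. ball x d)"
      have C1: "compact C1" unfolding C1_def
        by (intro compact_Int_closed C(1) compact_imp_closed compact_sums S(1) compact_cball)
      have C1K: "C1 \<subseteq> interior K"
      proof -
        have "x + z \<in> cball x d" if "z \<in> cball 0 d" for x z :: 'a using that by (simp add: dist_norm)
        then show ?thesis using d(2) unfolding C1_def by blast
      qed
      have C2: "compact C2" "C2 \<subseteq> W" "C2 \<inter> S = {}"
        unfolding C2_def using C d(1) by (auto intro!: compact_diff)
      have CC: "C \<subseteq> C1 \<union> C2"
      proof
        fix x assume x: "x \<in> C"
        show "x \<in> C1 \<union> C2"
        proof (cases "x \<in> (\<Union>x\<in>S. ball x d)")
          case True
          then obtain s where "s \<in> S" "dist s x < d" by auto
          then have "x = s + (x - s) \<and> s \<in> S \<and> x - s \<in> cball 0 d"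
            by (simp add: dist_norm norm_minus_commute)
          then have "x \<in> {x + z |x z. x \<in> S \<and> z \<in> cball 0 d}" by blast
          then show ?thesis using x by (simp add: C1_def)
        qed (use x in \<open>simp add: C2_def\<close>)
      qed
      obtain N :: nat where N: "\<And>vs. set vs \<subseteq> Basis \<Longrightarrow> net_bound K vs r (\<lambda>e. e powr (- real N))"
        using regular_class_bound[OF W r0(1) r K(1,2)] by blast
      have off: "net_bound D vs r (\<lambda>e. e ^ q)" if "compact D" "D \<subseteq> W" "D \<inter> S = {}" "set vs \<subseteq> Basis" for D vs q
        using negligible_bound_off_supp[OF W rm that(1,2) _ that(4)] that(3) unfolding S_def ur by blast
      have n1: "net_bound C1 ws (\<lambda>e x. kernel_net K delta_net r e x - r e x) (\<lambda>e. e ^ q)"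
        by (rule net_bound_delta_reproduces[OF rs C1 C1K K(1,2) N ws])
      have "net_bound C2 ws (kernel_net K delta_net r) (\<lambda>e. e ^ q)"
        by (rule net_bound_delta_off_support[OF W rs C2(1,2) K(1,2) compact_imp_closed[OF S(1)] C2(3) _ ws])
          (rule off, auto)
      then have n2: "net_bound C2 ws (\<lambda>e x. kernel_net K delta_net r e x - r e x) (\<lambda>e. e ^ q)"
        using net_bound_diff[OF W Is rs C2(2)] off[OF C2 ws] by blast
      have "net_bound (C1 \<union> C2) ws (\<lambda>e x. kernel_net K delta_net r e x - r e x) (\<lambda>e. e ^ q)"
        by (rule net_bound_Un[OF n1 n2]) simp
      then show ?thesis using net_bound_subset CC by blast
    qed
    then show "(\<lambda>e x. kernel_net K delta_net r e x - r e x) \<in> negligible_nets W"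
      using smooth_nets_diff[OF W Is rs] unfolding negligible_nets_iff[OF W] by simp
  qed
  then show ?thesis by (simp add: r0(2))
qed

text \<open>Every slice has all of \<open>closure V\<close> as its support. The condition that the
  supports lie in the interior of K thus becomes \<open>closure V \<subseteq> interior K\<close>,
  under which both kernels are estimated.\<close>

lemma local_reproduction:
  fixes V W :: "'a::euclidean_space set"
  assumes W: "open W" and V: "open V" "compact (closure V)" "closure V \<subseteq> W"
  obtains v0 :: "('a \<times> 'a, 'k::{real_normed_field, euclidean_space}) net"
  where "v0 \<in> moderate_nets (V \<times> W)"
    and "\<And>x. x \<in> V \<Longrightarrow> gen_supp W (gen_slice W (net_rel (V \<times> W) `` {v0}) x) = closure V"
    and "\<And>u K. u \<in> colombeau_regular W \<Longrightarrow> compact K \<Longrightarrow> K \<subseteq> W \<Longrightarrow> closure V \<subseteq> interior K \<Longrightarrow>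
      gen_integral V K (net_rel (V \<times> W) `` {v0}) u = gen_restrict V u"
proof -
  have VW: "open (V \<times> W)" "V \<subseteq> W" using W V closure_subset by (auto simp: open_Times)
  obtain b :: 'a where b: "norm b = 1" using nonempty_Basis norm_Basis by blast
  \<comment> \<open>For empty V nothing is asked of p.\<close>
  obtain p :: "real \<Rightarrow> 'a" where p: "V \<noteq> {} \<Longrightarrow> p e \<in> V"
    and visits: "\<And>U. open U \<Longrightarrow> U \<inter> V \<noteq> {} \<Longrightarrow> \<exists>y\<in>U \<inter> V. \<forall>\<eta>>0. \<exists>e. 0 < e \<and> e < \<eta> \<and> p e = y" for e
  proof (cases "V = {}")
    case False
    show thesis by (rule dense_visits[OF False]) (use that in blast)
  qed (use that in blast)
  define v0 where "v0 = (\<lambda>e z. delta_net e z + (wave_net p b e z :: 'k))"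
  have dm: "(delta_net :: ('a \<times> 'a, 'k) net) \<in> moderate_nets (V \<times> W)"
    by (rule moderate_delta_net[OF VW(1)])
  have wm: "(wave_net p b :: ('a \<times> 'a, 'k) net) \<in> moderate_nets (V \<times> W)"
    by (rule moderate_wave_net[OF VW(1)])
  have v0m: "v0 \<in> moderate_nets (V \<times> W)"
    unfolding v0_def by (rule moderate_nets_add[OF VW(1) dm wm])
  have sm: "(delta_net :: ('a \<times> 'a, 'k) net) \<in> smooth_nets (V \<times> W)"
    "(wave_net p b :: ('a \<times> 'a, 'k) net) \<in> smooth_nets (V \<times> W)" "v0 \<in> smooth_nets (V \<times> W)"
    using dm wm v0m by (auto simp: moderate_nets_def)
  have supp: "gen_supp W (gen_slice W (net_rel (V \<times> W) `` {v0}) x) = closure V" if x: "x \<in> V" for x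
  proof -
    have slm: "(\<lambda>e y. v0 e (x, y)) \<in> moderate_nets W" by (rule moderate_nets_slice[OF V(1) W v0m x])
    have pV: "p e \<in> V" for e using p x by blast
    have o: "open (W - closure V)" using W by (simp add: open_Diff)
    have out: "(\<lambda>e y. v0 e (x, y)) \<in> negligible_nets (W - closure V)"
    proof -
      have "net_bound C ws (\<lambda>e y. v0 e (x, y)) (\<lambda>e. e ^ q)" if C: "compact C" "C \<subseteq> W - closure V" for C ws q
      proof (rule net_bound_eventually_cong[where v = "\<lambda>_ _. 0"])
        have "C \<subseteq> - closure V" "open (- closure V)" using C(2) by auto
        then obtain d where d: "d > 0" "(\<Union>y\<in>C. cball y d) \<subseteq> - closure V"
          using compact_subset_open_imp_cball_epsilon_subset[OF C(1)] by blast
        have d2: "d / 2 > 0" using d(1) by simp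
        show "\<forall>\<^sub>F e in at_right 0. \<exists>U. open U \<and> C \<subseteq> U \<and> (\<forall>y\<in>U. v0 e (x, y) = 0)"
          using eventually_unit_interval eventually_small[OF d2]
        proof eventually_elim
          case (elim e)
          define U where "U = (\<Union>y\<in>C. ball y (d / 2))"
          have U: "open U" "C \<subseteq> U" using d(1) by (auto simp: U_def)
          have "v0 e (x, y) = 0" if y: "y \<in> U" for y
          proof -
            \<comment> \<open>Used twice: with w = x for the first kernel and with w = p e for the
              second.\<close>
            have far: "norm (y - w) \<ge> real (ord_of e) * e + e\<^sup>2" if "w \<in> V" for w
            proof -
              obtain y0 where y0: "y0 \<in> C" "dist y0 y < d / 2" using y by (auto simp: U_def)
              have "w \<notin> cball y0 d" using d(2) y0(1) that closure_subset[of V] by blast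
              then have "dist y0 w > d" by simp
              then have "dist y w > d / 2" using y0(2) dist_triangle[of y0 w y] by linarith
              then show ?thesis using elim(2) by (simp add: dist_norm)
            qed
            have "delta_net e (x, y) = (0 :: 'k)"
              using far[OF x] zero_le_power2[of e] by (intro delta_net_eq_0[OF elim(1)]) linarith
            moreover have "wave_net p b e (x, y) = (0 :: 'k)"
              by (rule wave_net_eq_0[OF elim(1) b far[OF pV]])
            ultimately show ?thesis by (simp add: v0_def)
          qed
          with U show ?case by blast
        qed
        show "net_bound C ws (\<lambda>_ _. 0 :: 'k) (\<lambda>e. e ^ q)"
          by (rule net_bound_zero)
      qed
      moreover have "(\<lambda>e y. v0 e (x, y)) \<in> smooth_nets (W - closure V)"
        using smooth_nets_subset[OF o _ smooth_nets_slice[OF V(1) W sm(3) x]] by blast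
      ultimately show ?thesis unfolding negligible_nets_iff[OF o] by blast
    qed
    \<comment> \<open>Every neighbourhood of y meets V in points that p visits for arbitrarily small
      e. At such a point the second kernel takes a fixed nonzero value, which contradicts
      negligibility on U.\<close>
    have inside: "\<not> y \<in> U" if y: "y \<in> closure V" and U: "open U" "(\<lambda>e y. v0 e (x, y)) \<in> negligible_nets U" for y U
    proof
      assume "y \<in> U"
      then have "U \<inter> V \<noteq> {}" using open_Int_closure_eq_empty[OF U(1), of V] y by blast
      \<comment> \<open>The point x is avoided because the first kernel need not vanish near it and
        might cancel the second one. A singleton is not open, so other points remain.\<close>
      moreover have "U \<inter> V \<noteq> {x}" using open_Int[OF U(1) V(1)] not_open_singleton by metis
      ultimately have "(U - {x}) \<inter> V \<noteq> {}" by blast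
      then obtain a where a: "a \<in> U" "a \<noteq> x" "a \<in> V" and av: "\<And>\<eta>. \<eta> > 0 \<Longrightarrow> \<exists>e. 0 < e \<and> e < \<eta> \<and> p e = a"
        using visits[of "U - {x}"] U(1) open_delete by blast
      have "net_bound {a} [] (\<lambda>e y. v0 e (x, y)) (\<lambda>e. e ^ 1)"
        using U(2)[unfolded negligible_nets_iff[OF U(1)], THEN conjunct2, rule_format, of "{a}" "[]" 1] a(1) by simp
      then obtain c where c: "c \<ge> 0" "\<forall>\<^sub>F e in at_right 0. e \<in> {0<..1} \<and> (\<forall>y\<in>{a}. norm (iter_partial [] (\<lambda>y. v0 e (x, y)) y) \<le> c * e ^ 1)"
        by (rule net_boundE) auto
      define m0 where "m0 = mollifier (0 :: 'a)"
      have m0: "m0 > 0" using mollifier_pos by (simp add: m0_def)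
      \<comment> \<open>Below this threshold c e < m0, so the value m0 at a violates the bound; 1 is
        added because c may be 0.\<close>
      have "m0 / (c + 1) > 0" using m0 c(1) by simp
      then have "\<forall>\<^sub>F e::real in at_right 0. e \<in> {0<..<m0 / (c + 1)}" by (rule eventually_at_right_real)
      moreover have "dist a x > 0" using a(2) by simp
      note eventually_small[OF this]
      ultimately have "\<forall>\<^sub>F e in at_right 0. p e \<noteq> a" using c(2)
      proof eventually_elim
        case (elim e)
        show ?case
        proof
          assume pa: "p e = a"
          have e: "e \<in> {0<..1}" using elim(3) by blast
          have "real (ord_of e) * e \<le> norm (a - x)"
            using elim(2) zero_le_power2[of e] unfolding dist_norm by linarith
          then have "delta_net e (x, a) = (0 :: 'k)" by (rule delta_net_eq_0[OF e])
          moreover have "wave_net p b e (x, a) = (kmoll (0 :: 'a) :: 'k)"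
            using wave_net_at_center[OF e b, of p x] by (simp add: pa)
          ultimately have "m0 \<le> c * e"
            using elim(3) m0 by (simp add: v0_def kmoll_def m0_def)
          also have "\<dots> \<le> (c + 1) * e" using e by (intro mult_right_mono) auto
          also have "\<dots> < m0" using elim(1) c(1) by (simp add: field_simps)
          finally show False by simp
        qed
      qed
      then obtain \<eta> where "\<eta> > 0" "\<And>e. 0 < e \<Longrightarrow> e < \<eta> \<Longrightarrow> p e \<noteq> a"
        unfolding eventually_at_right_field by blast
      then show False using av by blast
    qed
    show ?thesis
      unfolding gen_slice_class[OF V(1) W v0m x] gen_supp_class[OF W slm]
    proof
      show "W - \<Union>{U. open U \<and> U \<subseteq> W \<and> (\<lambda>e y. v0 e (x, y)) \<in> negligible_nets U} \<subseteq> closure V"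
        using o out by auto
      show "closure V \<subseteq> W - \<Union>{U. open U \<and> U \<subseteq> W \<and> (\<lambda>e y. v0 e (x, y)) \<in> negligible_nets U}"
      proof
        fix y assume y: "y \<in> closure V"
        then show "y \<in> W - \<Union>{U. open U \<and> U \<subseteq> W \<and> (\<lambda>e y. v0 e (x, y)) \<in> negligible_nets U}"
          using V(3) inside[OF y] by auto
      qed
    qed
  qed
  have int: "gen_integral V K (net_rel (V \<times> W) `` {v0}) u = gen_restrict V u"
    if u: "u \<in> colombeau_regular W" and K: "compact K" "K \<subseteq> W" "closure V \<subseteq> interior K" for u K
  proof -
    obtain r0 where r0: "r0 \<in> regular_nets W" "u = net_rel W `` {r0}"
      using u by (rule colombeau_regular_obtain)
    note r0m = regular_imp_moderate[OF r0(1)]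
    have "gen_integral V K (net_rel (V \<times> W) `` {v0}) (net_rel W `` {r0}) = net_rel V `` {r0}"
    proof (rule gen_integral_class[OF V(1) W VW(2) K(1,2) v0m r0m])
      fix r assume r: "(r0, r) \<in> net_rel W"
      then have rs: "r \<in> smooth_nets W" by (simp add: net_rel_def moderate_nets_def)
      then have rsV: "r \<in> smooth_nets V" using smooth_nets_subset V(1) VW(2) by blast
      obtain N :: nat where N: "\<And>vs. set vs \<subseteq> Basis \<Longrightarrow> net_bound K vs r (\<lambda>e. e powr (- real N))"
        using regular_class_bound[OF W r0(1) r K(1,2)] by blast
      define A where "A = (\<lambda>e (x :: 'a). kernel_net K delta_net r e x - r e x)"
      define B where "B = (kernel_net K (wave_net p b) r :: ('a, 'k) net)"
      have "A \<in> negligible_nets V"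
        unfolding negligible_nets_iff[OF V(1)] A_def
      proof (intro conjI allI impI)
        show "(\<lambda>e x. kernel_net K delta_net r e x - r e x) \<in> smooth_nets V"
          by (rule smooth_nets_diff[OF V(1) smooth_nets_kernel_integral[OF V(1) W K(1,2) sm(1) rs] rsV])
        fix C and ws :: "'a list" and q assume C: "compact C \<and> C \<subseteq> V \<and> set ws \<subseteq> Basis"
        then have "C \<subseteq> interior K" using K(3) closure_subset[of V] by blast
        then show "net_bound C ws (\<lambda>e x. kernel_net K delta_net r e x - r e x) (\<lambda>e. e ^ q)"
          using C by (intro net_bound_delta_reproduces[OF rs _ _ K(1,2) N]) auto
      qed
      moreover have "B \<in> negligible_nets V"
        unfolding negligible_nets_iff[OF V(1)] B_def
      proof (intro conjI allI impI)
        show "kernel_net K (wave_net p b) r \<in> smooth_nets V"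
          by (rule smooth_nets_kernel_integral[OF V(1) W K(1,2) sm(2) rs])
        fix C and ws :: "'a list" and q assume C: "compact C \<and> C \<subseteq> V \<and> set ws \<subseteq> Basis"
        show "net_bound C ws (kernel_net K (wave_net p b) r) (\<lambda>e. e ^ q)"
        \<comment> \<open>A nonempty C forces V to be nonempty, and only then is p e known to lie in
          V.\<close>
        proof (cases "C = {}")
          case False
          then have "p e \<in> closure V" for e using C p closure_subset[of V] by blast
          from net_bound_wave_annihilates[OF rs V(2) K(3) this b K(1,2) N] show ?thesis .
        qed (simp add: net_bound_def)
      qed
      ultimately have AB: "(\<lambda>e x. A e x + B e x) \<in> negligible_nets V" by (rule negligible_nets_add[OF V(1)])
      show "(\<lambda>e x. kernel_net K v0 r e x - r e x) \<in> negligible_nets V"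
      proof (rule negligible_nets_cong[OF V(1) AB])
        fix e :: real and x assume e: "e \<in> {0<..1}" and x: "x \<in> V"
        have s: "smooth_on (delta_net e :: 'a \<times> 'a \<Rightarrow> 'k) (V \<times> W)" "smooth_on (wave_net p b e :: 'a \<times> 'a \<Rightarrow> 'k) (V \<times> W)"
          using sm e by (auto simp: smooth_nets_def)
        note cr = continuous_on_smooth_net[OF rs K(2) e]
        have "kernel_net K v0 r e x
            = (LINT y:K|lborel. delta_net e (x, y) * r e y + wave_net p b e (x, y) * r e y)"
          by (simp add: v0_def distrib_right)
        also have "\<dots> = kernel_net K delta_net r e x + kernel_net K (wave_net p b) r e x"
          using kernel_integral(3)[OF V(1) W K(1,2) s(1) cr x, of "[]"] kernel_integral(3)[OF V(1) W K(1,2) s(2) cr x, of "[]"]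
          by (intro set_integral_add(2) set_integrable_compact K(1)) simp_all
        finally show "kernel_net K v0 r e x - r e x = A e x + B e x"
          by (simp add: A_def B_def)
      qed
    qed
    then show ?thesis unfolding r0(2) gen_restrict_class[OF V(1) W VW(2) r0m] .
  qed
  show thesis using that v0m supp int by blast
qed

theorem theorem2p3:
  shows "(\<forall>\<Omega> \<Omega>' :: (real^'n) set.
            open \<Omega> \<and> open \<Omega>' \<and> compact (closure \<Omega>') \<and> closure \<Omega>' \<subseteq> \<Omega> \<longrightarrow>
            (\<exists>v \<in> (colombeau (\<Omega>' \<times> \<Omega>)
                    :: ((real^'n) \<times> (real^'n), 'k::{real_normed_field, euclidean_space}) gen_fun set).
               (\<Union>x\<in>\<Omega>'. gen_supp \<Omega> (gen_slice \<Omega> v x)) \<subseteq> \<Omega> \<and>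
               compact (\<Union>x\<in>\<Omega>'. gen_supp \<Omega> (gen_slice \<Omega> v x)) \<and>
               (\<forall>u \<in> colombeau_regular \<Omega>. \<forall>K.
                  compact K \<and> K \<subseteq> \<Omega> \<and>
                  (\<Union>x\<in>\<Omega>'. gen_supp \<Omega> (gen_slice \<Omega> v x)) \<subseteq> interior K \<longrightarrow>
                  gen_restrict \<Omega>' u = gen_integral \<Omega>' K v u)))
       \<and> (\<forall>\<Omega> :: (real^'n) set.
            open \<Omega> \<longrightarrow>
            (\<exists>v \<in> (colombeau (\<Omega> \<times> \<Omega>)
                    :: ((real^'n) \<times> (real^'n), 'k) gen_fun set).
               \<forall>u \<in> colombeau_regular_c \<Omega>. \<forall>K.
                  compact K \<and> K \<subseteq> \<Omega> \<and> gen_supp \<Omega> u \<subseteq> interior K \<longrightarrow>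
                  u = gen_integral \<Omega> K v u))"
proof (intro conjI allI impI, goal_cases)
  case (1 \<Omega> \<Omega>')
  obtain v0 :: "((real^'n) \<times> (real^'n), 'k) net" where v0: "v0 \<in> moderate_nets (\<Omega>' \<times> \<Omega>)"
    and supp: "\<And>x. x \<in> \<Omega>' \<Longrightarrow> gen_supp \<Omega> (gen_slice \<Omega> (net_rel (\<Omega>' \<times> \<Omega>) `` {v0}) x) = closure \<Omega>'"
    and int: "\<And>u K. u \<in> colombeau_regular \<Omega> \<Longrightarrow> compact K \<Longrightarrow> K \<subseteq> \<Omega> \<Longrightarrow> closure \<Omega>' \<subseteq> interior K \<Longrightarrow>
      gen_integral \<Omega>' K (net_rel (\<Omega>' \<times> \<Omega>) `` {v0}) u = gen_restrict \<Omega>' u"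
    using local_reproduction[where 'k = 'k, of \<Omega> \<Omega>'] 1 by blast
  define v where "v = net_rel (\<Omega>' \<times> \<Omega>) `` {v0}"
  \<comment> \<open>For empty \<Omega>' the union runs over no x at all, but the closure is empty
    too.\<close>
  have un: "(\<Union>x\<in>\<Omega>'. gen_supp \<Omega> (gen_slice \<Omega> v x)) = closure \<Omega>'"
    by (cases "\<Omega>' = {}") (simp_all add: v_def supp)
  show ?case
  proof (intro bexI[of _ v] conjI ballI allI impI)
    show "v \<in> colombeau (\<Omega>' \<times> \<Omega>)" unfolding v_def colombeau_def using v0 by (rule quotientI)
  qed (use 1 int in \<open>auto simp: un v_def[symmetric]\<close>)
next
  case (2 \<Omega>)
  then have "(delta_net :: ((real^'n) \<times> (real^'n), 'k) net) \<in> moderate_nets (\<Omega> \<times> \<Omega>)"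
    by (intro moderate_delta_net open_Times)
  then have "net_rel (\<Omega> \<times> \<Omega>) `` {delta_net :: ((real^'n) \<times> (real^'n), 'k) net} \<in> colombeau (\<Omega> \<times> \<Omega>)"
    unfolding colombeau_def by (rule quotientI)
  then show ?case
    using compactly_supported_reproduction[OF 2] by (intro bexI) auto
qed

end
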